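(* For every $\epsilon>0$ there is $R$ such that for every $r>R$ the following hold for the curve $\Upsilon_r:[r,\infty)\to\mathbb{R}^2$, $\Upsilon_r(L)=\big(\tfrac12a_L(r),\tfrac12b_L(r)\big)$: $\Upsilon_r$ has exactly one cusp $L_r$; at every $L\ne L_r$ the velocity $d\Upsilon_r/dL$ has negative slope; and the cusp point $\Upsilon_r(L_r)=(a_r,b_r)$ satisfies $a_r<2+\epsilon$ and $b_r<(e^2/2+\epsilon)e^{r/2}$.
   Context: For $\alpha\in(0,1/\sqrt2)$ let $L_\alpha=\pi/\mathrm{AGM}(\alpha,\tfrac12\sqrt{1+2\alpha^2})$; $\alpha\mapsto L_\alpha$ is a decreasing bijection from $(0,1/\sqrt2)$ onto $(\pi\sqrt2,\infty)$. For $L>\pi\sqrt2$ let $\alpha$ satisfy $L_\alpha=L$ and let $x_0>y_0>0$ satisfy $x_0^2+y_0^2=1$, $x_0y_0=\alpha^2$. Let $(x_L,y_L,z_L)(t)$ solve $x'=-xz$, $y'=yz$, $z'=x^2-y^2$ with initial value $(x_0,y_0,0)$, and let $a_L,b_L$ solve $a'=2x_L+az_L$, $b'=2y_L-bz_L$ with $a_L(0)=b_L(0)=0$ ($'=d/dt$). A cusp of $\Upsilon_r$ is a parameter $L$ at which $d\Upsilon_r/dL=0$. *)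

theory Defs
  imports "HOL-Analysis.Analysis"
begin

primrec agm_seq :: "real \<Rightarrow> real \<Rightarrow> nat \<Rightarrow> real \<times> real" where
  "agm_seq a b 0 = (a, b)"
| "agm_seq a b (Suc n) =
     (let (p, q) = agm_seq a b n in ((p + q) / 2, sqrt (p * q)))"

definition AGM :: "real \<Rightarrow> real \<Rightarrow> real" where
  "AGM a b = lim (\<lambda>n. fst (agm_seq a b n))"

definition Lalpha :: "real \<Rightarrow> real" where
  "Lalpha \<alpha> = pi / AGM \<alpha> (sqrt (1 + 2 * \<alpha>\<^sup>2) / 2)"

definition alpha_of :: "real \<Rightarrow> real" where
  "alpha_of L = (THE \<alpha>. 0 < \<alpha> \<and> \<alpha> < 1 / sqrt 2 \<and> Lalpha \<alpha> = L)"

definition init_xy :: "real \<Rightarrow> real \<times> real" where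
  "init_xy L = (THE (x0, y0). x0 > y0 \<and> y0 > 0 \<and> x0\<^sup>2 + y0\<^sup>2 = 1
                  \<and> x0 * y0 = (alpha_of L)\<^sup>2)"

definition xyz_sol :: "real \<Rightarrow> real \<Rightarrow> real \<times> real \<times> real" where
  "xyz_sol L = (THE f. f 0 = (fst (init_xy L), snd (init_xy L), 0) \<and>
     (\<forall>t. (f has_vector_derivative
            (let (x, y, z) = f t in (- x * z, y * z, x\<^sup>2 - y\<^sup>2))) (at t)))"

definition ab_sol :: "real \<Rightarrow> real \<Rightarrow> real \<times> real" where
  "ab_sol L = (THE g. g 0 = (0, 0) \<and>
     (\<forall>t. (g has_vector_derivative
            (let (x, y, z) = xyz_sol L t; (a, b) = g t
             in (2 * x + a * z, 2 * y - b * z))) (at t)))"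

definition a_sol :: "real \<Rightarrow> real \<Rightarrow> real" where
  "a_sol L t = fst (ab_sol L t)"

definition b_sol :: "real \<Rightarrow> real \<Rightarrow> real" where
  "b_sol L t = snd (ab_sol L t)"

definition Upsilon :: "real \<Rightarrow> real \<Rightarrow> real \<times> real" where
  "Upsilon r L = (a_sol L r / 2, b_sol L r / 2)"

definition velocity :: "real \<Rightarrow> real \<Rightarrow> real \<times> real" where
  "velocity r L = vector_derivative (Upsilon r) (at L within {r..})"

definition is_cusp :: "real \<Rightarrow> real \<Rightarrow> bool" where
  "is_cusp r L \<longleftrightarrow> r \<le> L \<and> velocity r L = 0"

end

theory Submission
  imports Defs
begin

text \<open>Integrating the linear equations gives \<open>a = (G + z) / x\<close> and \<open>b = (G - z) / y\<close>, where \<open>G\<close> is the time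
  integral of \<open>x\<^sup>2 + y\<^sup>2\<close>. Differentiating in the parameter at fixed time yields
  \<open>x \<partial>a + y \<partial>b = 0\<close> (the Gauss lemma for the geodesics of Sol), so the slope is negative wherever the velocity does
  not vanish, and the cusps are the zeros of \<open>\<partial>a\<close>. The linearised flow is solved by an explicit
  combination of \<open>z'\<close>, \<open>z G\<close> and \<open>t z\<close>, which turns \<open>\<partial>a\<close> into a polynomial \<open>N\<close> in
  \<open>z\<close>, \<open>z'\<close>, \<open>G\<close>, \<open>t\<close>. On the first half period \<open>N / z\<close> increases and is positive; by reflection
  \<open>N > 0\<close> also afterwards, except on the last stretch of bounded length. There the orbit converges to the separatrix
  \<open>z = - tanh s\<close> (\<open>s\<close> the remaining time), \<open>N\<close> is negative at \<open>s = 0\<close>, and the parameter derivative of \<open>N\<close> has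
  the limit \<open>64 (1 - tanh\<^sup>2 s) > 0\<close>. Hence \<open>N\<close> has exactly one zero along the curve, and it lies on the last stretch,
  where the separatrix also gives the two bounds.\<close>

section \<open>The arithmetic-geometric mean and the complete elliptic integral\<close>

text \<open>The curve is taken at fixed time, whereas explicit formulas exist at fixed phase, as
  elliptic integrals; implicit differentiation of the elapsed time links the two. The period
  decreases in b = alpha^2, so L \<ge> r becomes 0 < b \<le> br, where r is a whole period for br.
  Taking r beyond the period of a small B keeps all these b below B, so that facts about b tending
  to 0 hold along the entire curve. The parameter derivative of N is under control only on the last
  stretch. Hence N is not shown to be monotone: N \<le> 0 forces the phase into that stretch, where
  N strictly decreases in b, and this excludes a second zero. On the separatrix N = 8 (2 tanh s -
  1), so the limiting cusp has tanh s = 1/2. The stretch is cut off at tanh s = 3/5: above 1/2,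
  which leaves room to prove N > 0 before it, and below 4/5, up to which the limit (2 - tanh s) /
  sqrt (1 - tanh^2 s) of a/2 stays at most 2.\<close>

definition prim :: "(real \<Rightarrow> real) \<Rightarrow> real \<Rightarrow> real" where
  "prim f x = integral {0..x} f - integral {x..0} f"

lemma prim_0 [simp]: "prim f 0 = 0"
  by (simp add: prim_def)

lemma prim_nonneg_eq: "x \<ge> 0 \<Longrightarrow> prim f x = integral {0..x} f"
  by (cases "x = 0") (auto simp: prim_def)

text \<open>One of the two integrals in \<open>prim\<close> always runs over an empty or one-point
  interval, which makes the primitive signed. Rebasing at \<open>-c\<close>, to the left of both 0
  and x, reduces the claim to the fundamental theorem on one interval.\<close>

lemma prim_deriv:
  assumes "continuous_on UNIV f"
  shows "(prim f has_real_derivative f x) (at x)"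
proof -
  define c where "c = \<bar>x\<bar> + 1"
  have cont: "continuous_on S f" for S
    using assms continuous_on_subset by blast
  have eq: "prim f y = integral {-c..y} f - integral {-c..0} f" if "y \<in> {-c<..<c}" for y
  proof (cases "y \<ge> 0")
    case True
    have "integral {-c..0} f + integral {0..y} f = integral {-c..y} f"
      by (rule Henstock_Kurzweil_Integration.integral_combine)
         (use True c_def that in \<open>auto intro!: integrable_continuous_interval cont\<close>)
    then show ?thesis using True by (simp add: prim_nonneg_eq)
  next
    case False
    have "integral {-c..y} f + integral {y..0} f = integral {-c..0} f"
      by (rule Henstock_Kurzweil_Integration.integral_combine)
         (use False c_def that in \<open>auto intro!: integrable_continuous_interval cont\<close>)
    then show ?thesis using False by (simp add: prim_def)
  qed
  have "((\<lambda>y. integral {-c..y} f) has_real_derivative f x) (at x within {-c..c})"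
    by (rule integral_has_real_derivative) (auto simp: cont c_def)
  then have "((\<lambda>y. integral {-c..y} f) has_real_derivative f x) (at x)"
    by (subst (asm) at_within_interior) (auto simp: c_def)
  then have "((\<lambda>y. integral {-c..y} f - integral {-c..0} f) has_real_derivative f x) (at x)"
    by (auto intro!: derivative_eq_intros)
  then show ?thesis
    by (rule has_field_derivative_transform_within_open[where S="{-c<..<c}"])
       (auto simp: eq c_def)
qed

lemma prim_deriv_chain [derivative_intros]:
  assumes "continuous_on UNIV f" "(g has_real_derivative g') (at x)"
  shows "((\<lambda>x. prim f (g x)) has_real_derivative f (g x) * g') (at x)"
  using DERIV_chain2[OF prim_deriv[OF assms(1)] assms(2)] .

lemma prim_reflect:
  assumes "continuous_on UNIV f" "\<And>x. f (c - x) = f x"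
  shows "prim f (c - x) = prim f c - prim f x"
proof -
  have "(\<lambda>x. prim f (c - x) + prim f x) x = (\<lambda>x. prim f (c - x) + prim f x) 0"
    by (rule DERIV_isconst_all)
       (auto intro!: derivative_eq_intros assms(1) simp: assms(2))
  then show ?thesis by simp
qed

definition ell_rad :: "real \<Rightarrow> real \<Rightarrow> real \<Rightarrow> real" where
  "ell_rad a c p = a\<^sup>2 * (cos p)\<^sup>2 + c\<^sup>2 * (sin p)\<^sup>2"

text \<open>Gauss's form of the complete elliptic integral of the first kind, the one that the
  arithmetic-geometric iteration leaves invariant.\<close>

definition ell_int :: "real \<Rightarrow> real \<Rightarrow> real" where
  "ell_int a c = prim (\<lambda>p. 1 / sqrt (ell_rad a c p)) (pi / 2)"

lemma ell_rad_bounds: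
  assumes "0 \<le> l" "l \<le> a" "l \<le> c" "a \<le> u" "c \<le> u"
  shows "l\<^sup>2 \<le> ell_rad a c p" "ell_rad a c p \<le> u\<^sup>2"
proof -
  have "l\<^sup>2 \<le> a\<^sup>2" "l\<^sup>2 \<le> c\<^sup>2" "a\<^sup>2 \<le> u\<^sup>2" "c\<^sup>2 \<le> u\<^sup>2"
    using assms by (auto intro!: power_mono)
  then have "l\<^sup>2 * (cos p)\<^sup>2 + l\<^sup>2 * (sin p)\<^sup>2 \<le> ell_rad a c p"
    "ell_rad a c p \<le> u\<^sup>2 * (cos p)\<^sup>2 + u\<^sup>2 * (sin p)\<^sup>2"
    unfolding ell_rad_def by (auto intro!: add_mono mult_right_mono)
  moreover have "v * (cos p)\<^sup>2 + v * (sin p)\<^sup>2 = v" for v :: real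
    by (metis distrib_left mult.right_neutral sin_cos_squared_add2)
  ultimately show "l\<^sup>2 \<le> ell_rad a c p" "ell_rad a c p \<le> u\<^sup>2" by auto
qed

lemma ell_rad_pos: "a > 0 \<Longrightarrow> c > 0 \<Longrightarrow> ell_rad a c p > 0"
  using ell_rad_bounds(1)[of "min a c" a c "max a c" p]
  by (smt (verit) zero_less_power)

lemma continuous_on_ell_rad [continuous_intros]: "continuous_on S (ell_rad a c)"
  unfolding ell_rad_def by (intro continuous_intros)

lemma continuous_on_ell_integrand:
  "a > 0 \<Longrightarrow> c > 0 \<Longrightarrow> continuous_on S (\<lambda>p. 1 / sqrt (ell_rad a c p))"
  by (intro continuous_intros) (metis ell_rad_pos less_irrefl real_sqrt_eq_0_iff)

lemma ell_int_bounds: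
  assumes "0 < l" "l \<le> a" "l \<le> c" "a \<le> u" "c \<le> u"
  shows "pi / (2 * u) \<le> ell_int a c" "ell_int a c \<le> pi / (2 * l)"
proof -
  have ac: "a > 0" "c > 0" "u > 0" using assms by auto
  have e: "ell_int a c = integral {0..pi/2} (\<lambda>p. 1 / sqrt (ell_rad a c p))"
    unfolding ell_int_def by (rule prim_nonneg_eq) simp
  have I: "(\<lambda>p. 1 / sqrt (ell_rad a c p)) integrable_on {0..pi/2}"
    by (intro integrable_continuous_interval continuous_on_ell_integrand ac)
  have b: "1 / u \<le> 1 / sqrt (ell_rad a c p)" "1 / sqrt (ell_rad a c p) \<le> 1 / l" for p
  proof -
    have *: "l \<le> sqrt (ell_rad a c p)" "sqrt (ell_rad a c p) \<le> u"
      using ell_rad_bounds[of l a c u p] assms by (auto intro: real_le_rsqrt real_le_lsqrt simp: ac less_imp_le)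
    then show "1 / u \<le> 1 / sqrt (ell_rad a c p)" "1 / sqrt (ell_rad a c p) \<le> 1 / l"
      using assms ac by (auto intro!: divide_left_mono mult_pos_pos simp: ell_rad_pos)
  qed
  have "integral {0..pi/2} (\<lambda>p. 1 / u) \<le> ell_int a c"
    unfolding e by (rule integral_le) (use I b in auto)
  then show "pi / (2 * u) \<le> ell_int a c" by simp
  have "ell_int a c \<le> integral {0..pi/2} (\<lambda>p. 1 / l)"
    unfolding e by (rule integral_le) (use I b in auto)
  then show "ell_int a c \<le> pi / (2 * l)" by simp
qed

text \<open>Landen's transformation, lifted to a smooth map of the line that sends
  \<open>0\<close> to \<open>0\<close> and \<open>pi / 2\<close> to \<open>pi\<close>.\<close>

lemma ell_int_landen:
  assumes a: "a > 0" and c: "c > 0"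
  shows "ell_int ((a + c) / 2) (sqrt (a * c)) = ell_int a c"
proof -
  define f where "f p = 1 / sqrt (ell_rad a c p)" for p
  define f1 where "f1 p = 1 / sqrt (ell_rad ((a + c) / 2) (sqrt (a * c)) p)" for p
  define q where "q p = a * (cos p)\<^sup>2 + c * (sin p)\<^sup>2" for p
  define u where "u p = (a - c) * sin p * cos p / q p" for p
  \<comment> \<open>Landen's relation is tan (psi - p) = (c / a) tan p, and \<open>u p\<close> is
    tan (2 p - psi). Its denominator \<open>q p\<close> never vanishes, so this form of psi has no
    branch jump at pi / 2.\<close>
  define psi where "psi p = 2 * p - arctan (u p)" for p
  have cf: "continuous_on UNIV f" "continuous_on UNIV f1"
    unfolding f_def f1_def using a c by (auto intro!: continuous_on_ell_integrand)
  have qpos: "q p > 0" for p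
    using ell_rad_pos[of "sqrt a" "sqrt c" p] a c by (simp add: ell_rad_def q_def)
  have D: "1 + (u p)\<^sup>2 = ell_rad a c p / (q p)\<^sup>2" for p
  proof -
    have "(q p)\<^sup>2 + ((a - c) * sin p * cos p)\<^sup>2 = ell_rad a c p"
      unfolding q_def ell_rad_def using sin_cos_squared_add[of p] by algebra
    then show ?thesis using qpos[of p] by (simp add: u_def field_simps)
  qed
  have du: "(u has_real_derivative ((a - c) * ((cos p)\<^sup>2 - (sin p)\<^sup>2) * q p
       - (a - c) * sin p * cos p * (2 * (c - a) * sin p * cos p)) / (q p)\<^sup>2) (at p)" for p
    unfolding u_def q_def using qpos[of p, unfolded q_def]
    by (auto intro!: derivative_eq_intros simp: field_simps power2_eq_square)
  have dpsi: "(psi has_real_derivative (a + c) * q p / ell_rad a c p) (at p)" for p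
  proof -
    let ?w = "(a - c) * ((cos p)\<^sup>2 - (sin p)\<^sup>2) * q p
       - (a - c) * sin p * cos p * (2 * (c - a) * sin p * cos p)"
    have "(psi has_real_derivative 2 - inverse (1 + (u p)\<^sup>2) * (?w / (q p)\<^sup>2)) (at p)"
      unfolding psi_def by (auto intro!: derivative_eq_intros du)
    moreover have "2 - inverse (1 + (u p)\<^sup>2) * (?w / (q p)\<^sup>2) = 2 - ?w / ell_rad a c p"
      unfolding D inverse_divide using qpos[of p] by simp
    moreover have "2 * ell_rad a c p - ?w = (a + c) * q p"
      unfolding q_def ell_rad_def using sin_cos_squared_add[of p] by algebra
    then have "2 - ?w / ell_rad a c p = (a + c) * q p / ell_rad a c p"
      using ell_rad_pos[OF a c, of p] by (simp add: field_simps)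
    ultimately show ?thesis by simp
  qed
  have f1psi: "f1 (psi p) = 2 * sqrt (ell_rad a c p) / ((a + c) * q p)" for p
  proof -
    define s where "s = sqrt (ell_rad a c p)"
    have s: "s > 0" "s\<^sup>2 = ell_rad a c p"
      using ell_rad_pos[OF a c, of p] by (auto simp: s_def)
    have r: "sqrt (1 + (u p)\<^sup>2) = s / q p"
      unfolding D using qpos[of p] by (simp add: s_def real_sqrt_divide)
    have "cos (psi p) = (cos (2 * p) * q p + sin (2 * p) * (u p * q p)) / s"
      unfolding psi_def cos_diff cos_arctan sin_arctan r using s qpos[of p] by (simp add: field_simps)
    also have "u p * q p = (a - c) * sin p * cos p"
      using qpos[of p] by (simp add: u_def)
    also have "cos (2 * p) * q p + sin (2 * p) * ((a - c) * sin p * cos p) = a * (cos p)\<^sup>2 - c * (sin p)\<^sup>2"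
      unfolding sin_double cos_double q_def using sin_cos_squared_add[of p] by algebra
    finally have cs: "cos (psi p) = (a * (cos p)\<^sup>2 - c * (sin p)\<^sup>2) / s" .
    have "ell_rad ((a + c) / 2) (sqrt (a * c)) (psi p)
        = ((a + c) / 2)\<^sup>2 * (cos (psi p))\<^sup>2 + (a * c) * (1 - (cos (psi p))\<^sup>2)"
      using a c by (simp add: ell_rad_def sin_squared_eq)
    also have "\<dots> = (((a + c) / 2)\<^sup>2 * (a * (cos p)\<^sup>2 - c * (sin p)\<^sup>2)\<^sup>2
         + a * c * (s\<^sup>2 - (a * (cos p)\<^sup>2 - c * (sin p)\<^sup>2)\<^sup>2)) / s\<^sup>2"
      unfolding cs using s(1) by (simp add: field_simps)
    also have "((a + c) / 2)\<^sup>2 * (a * (cos p)\<^sup>2 - c * (sin p)\<^sup>2)\<^sup>2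
         + a * c * (s\<^sup>2 - (a * (cos p)\<^sup>2 - c * (sin p)\<^sup>2)\<^sup>2) = ((a + c) * q p / 2)\<^sup>2"
    proof -
      have "(a + c)\<^sup>2 * (a * (cos p)\<^sup>2 - c * (sin p)\<^sup>2)\<^sup>2
         + 4 * a * c * (s\<^sup>2 - (a * (cos p)\<^sup>2 - c * (sin p)\<^sup>2)\<^sup>2) = ((a + c) * q p)\<^sup>2"
        unfolding s(2) ell_rad_def q_def
        using sin_cos_squared_add[of p] by algebra
      then show ?thesis by (simp add: power_divide)
    qed
    finally have "ell_rad ((a + c) / 2) (sqrt (a * c)) (psi p) = ((a + c) * q p / (2 * s))\<^sup>2"
      by (simp add: power_divide power_mult_distrib)
    then show ?thesis
      unfolding f1_def using a c qpos[of p] s(1) by (simp add: s_def[symmetric])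
  qed
  have "prim f1 (psi p) - 2 * prim f p = prim f1 (psi 0) - 2 * prim f 0" for p
  proof (rule DERIV_isconst_all[where f = "\<lambda>p. prim f1 (psi p) - 2 * prim f p"])
    show "\<forall>p. ((\<lambda>p. prim f1 (psi p) - 2 * prim f p) has_real_derivative 0) (at p)"
    proof
      fix p
      define s where "s = sqrt (ell_rad a c p)"
      have s: "s > 0" "ell_rad a c p = s * s"
        using ell_rad_pos[OF a c, of p] by (auto simp: s_def)
      have "f1 (psi p) * ((a + c) * q p / ell_rad a c p) = 2 * f p"
        unfolding f1psi f_def s_def[symmetric] s(2) using qpos[of p] s(1) a c
        by simp
      then show "((\<lambda>p. prim f1 (psi p) - 2 * prim f p) has_real_derivative 0) (at p)"
        by (auto intro!: derivative_eq_intros cf dpsi)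
    qed
  qed
  from this[of "pi / 2"] have "prim f1 pi = 2 * prim f (pi / 2)"
    by (simp add: psi_def u_def)
  moreover have "f1 (pi - p) = f1 p" for p
    by (simp add: f1_def ell_rad_def)
  with prim_reflect[OF cf(2), of pi "pi / 2"] have "prim f1 pi = 2 * prim f1 (pi / 2)"
    by simp
  ultimately show ?thesis unfolding ell_int_def f_def f1_def by simp
qed

text \<open>The integral is constant along the iteration and lies between pi / (2 P) and pi / (2 Q),
  which have a common limit. Indices start at \<open>Suc n\<close> because the arithmetic component
  dominates the geometric one only after the first step.\<close>

lemma ell_int_AGM:
  assumes a: "a > 0" and c: "c > 0"
  shows "ell_int a c = pi / (2 * AGM a c)" "AGM a c > 0"
proof -
  define P where "P n = fst (agm_seq a c n)" for n
  define Q where "Q n = snd (agm_seq a c n)" for n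
  have P0: "P 0 = a" "Q 0 = c" by (simp_all add: P_def Q_def)
  have S: "P (Suc n) = (P n + Q n) / 2" "Q (Suc n) = sqrt (P n * Q n)" for n
    by (simp_all add: P_def Q_def split_beta Let_def)
  have pos: "P n > 0 \<and> Q n > 0" for n
    by (induction n) (use a c in \<open>auto simp: S P0\<close>)
  have I: "ell_int (P n) (Q n) = ell_int a c" for n
    by (induction n) (use pos in \<open>auto simp: S ell_int_landen P0\<close>)
  have QP: "Q (Suc n) \<le> P (Suc n)" for n
    unfolding S using arith_geo_mean_sqrt[of "P n" "Q n"] pos[of n] by simp
  have Pdec: "P (Suc (Suc n)) \<le> P (Suc n)" for n
    using QP[of n] by (simp add: S(1)[of "Suc n"])
  have Qinc: "Q (Suc n) \<le> Q (Suc (Suc n))" for n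
  proof -
    have "(Q (Suc n))\<^sup>2 \<le> P (Suc n) * Q (Suc n)"
      unfolding power2_eq_square using QP[of n] pos[of "Suc n"] by (intro mult_right_mono) auto
    then show ?thesis unfolding S(2)[of "Suc n"] by (rule real_le_rsqrt)
  qed
  have dist: "P (Suc n) - Q (Suc n) \<le> (P 1 - Q 1) * (1 / 2) ^ n" for n
  proof (induction n)
    case (Suc n)
    have "P (Suc (Suc n)) - Q (Suc (Suc n)) \<le> P (Suc (Suc n)) - Q (Suc n)"
      using Qinc[of n] by simp
    also have "\<dots> = (P (Suc n) - Q (Suc n)) / 2"
      by (simp add: S(1)[of "Suc n"] field_simps)
    finally show ?case using Suc by simp
  qed simp
  have Pd: "decseq (\<lambda>n. P (Suc n))" using Pdec by (intro decseq_SucI) simp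
  have Qi: "incseq (\<lambda>n. Q (Suc n))" using Qinc by (intro incseq_SucI) simp
  have Q1: "Q 1 \<le> Q (Suc n)" for n using incseqD[OF Qi, of 0 n] by simp
  have "Q 1 \<le> P (Suc n)" for n using Q1[of n] QP[of n] by simp
  then obtain M where M: "(\<lambda>n. P (Suc n)) \<longlonglongrightarrow> M"
    using decseq_convergent[OF Pd] by blast
  have "(\<lambda>n. P (Suc n) - Q (Suc n)) \<longlonglongrightarrow> 0"
  proof (rule tendsto_sandwich[of "\<lambda>_. 0" _ _ "\<lambda>n. (P 1 - Q 1) * (1 / 2) ^ n"])
    show "\<forall>\<^sub>F n in sequentially. P (Suc n) - Q (Suc n) \<le> (P 1 - Q 1) * (1 / 2) ^ n"
      using dist by simp
    show "(\<lambda>n. (P 1 - Q 1) * (1 / 2) ^ n) \<longlonglongrightarrow> 0"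
      by (rule tendsto_mult_right_zero) (rule LIMSEQ_realpow_zero, auto)
    show "(\<lambda>n. 0::real) \<longlonglongrightarrow> 0" by simp
  qed (use QP in simp)
  from tendsto_diff[OF M this] have MQ: "(\<lambda>n. Q (Suc n)) \<longlonglongrightarrow> M" by simp
  have "Q 1 \<le> M" by (rule Lim_bounded2[OF MQ]) (use Q1 in auto)
  then have Mpos: "M > 0" using pos[of 1] by linarith
  have "P \<longlonglongrightarrow> M" using M by (simp add: filterlim_sequentially_Suc)
  then have AM: "AGM a c = M" unfolding AGM_def P_def by (rule limI)
  have b: "pi / (2 * P (Suc n)) \<le> ell_int a c" "ell_int a c \<le> pi / (2 * Q (Suc n))" for n
    using ell_int_bounds[of "Q (Suc n)" "P (Suc n)" "Q (Suc n)" "P (Suc n)"] I[of "Suc n"] QP[of n] pos[of "Suc n"]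
    by auto
  have "(\<lambda>n. pi / (2 * P (Suc n))) \<longlonglongrightarrow> pi / (2 * M)" "(\<lambda>n. pi / (2 * Q (Suc n))) \<longlonglongrightarrow> pi / (2 * M)"
    using Mpos by (auto intro!: tendsto_intros M MQ)
  then have "pi / (2 * M) \<le> ell_int a c" "ell_int a c \<le> pi / (2 * M)"
    using b by (auto intro: LIMSEQ_le_const LIMSEQ_le_const2)
  then show "ell_int a c = pi / (2 * AGM a c)" "AGM a c > 0" using AM Mpos by auto
qed

section \<open>Explicit solutions in terms of a phase\<close>

text \<open>Throughout \<open>b\<close> stands for \<open>\<alpha>\<^sup>2 = x y\<close>. Since \<open>x\<^sup>2 + y\<^sup>2 + z\<^sup>2 = 1\<close>, one has
  \<open>(x - y)\<^sup>2 + z\<^sup>2 = 1 - 2 b\<close>, and the angle \<open>p\<close> on this circle moves with speed \<open>x + y = Del b p\<close>.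
  At phase \<open>p\<close>, \<open>Tm b p\<close> is the elapsed time, \<open>Gm b p\<close> is the time integral of \<open>x\<^sup>2 + y\<^sup>2\<close>,
  and \<open>zd b p\<close> is \<open>z' = x\<^sup>2 - y\<^sup>2\<close>.\<close>

definition Del :: "real \<Rightarrow> real \<Rightarrow> real" where
  "Del b p = sqrt ((cos p)\<^sup>2 + 2 * b * (1 + (sin p)\<^sup>2))"

definition Tm :: "real \<Rightarrow> real \<Rightarrow> real" where
  "Tm b = prim (\<lambda>p. 1 / Del b p)"

definition Gm :: "real \<Rightarrow> real \<Rightarrow> real" where
  "Gm b p = prim (Del b) p - 2 * b * Tm b p"

definition mm :: "real \<Rightarrow> real" where
  "mm b = sqrt (1 - 2 * b)"

definition zz :: "real \<Rightarrow> real \<Rightarrow> real" where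
  "zz b p = mm b * sin p"

definition xx :: "real \<Rightarrow> real \<Rightarrow> real" where
  "xx b p = (Del b p + mm b * cos p) / 2"

definition yy :: "real \<Rightarrow> real \<Rightarrow> real" where
  "yy b p = (Del b p - mm b * cos p) / 2"

definition zd :: "real \<Rightarrow> real \<Rightarrow> real" where
  "zd b p = mm b * cos p * Del b p"

lemma Del_rad_pos:
  fixes b :: real
  assumes "b > 0"
  shows "(cos p)\<^sup>2 + 2 * b * (1 + (sin p)\<^sup>2) > 0"
proof -
  have "2 * b * (1 + (sin p)\<^sup>2) > 0"
    using assms by (auto intro!: mult_pos_pos add_pos_nonneg)
  then show ?thesis by (smt (verit) zero_le_power2)
qed

lemma Del_pos: "b > 0 \<Longrightarrow> Del b p > 0"
  using Del_rad_pos by (simp add: Del_def)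

lemma mm_pos: "b < 1 / 2 \<Longrightarrow> mm b > 0"
  by (simp add: mm_def)

lemma mm_sq: "b < 1 / 2 \<Longrightarrow> (mm b)\<^sup>2 = 1 - 2 * b"
  by (simp add: mm_def)

lemma Del_sq:
  assumes "b > 0"
  shows "(Del b p)\<^sup>2 = (cos p)\<^sup>2 + 2 * b * (1 + (sin p)\<^sup>2)"
  using Del_rad_pos[OF assms, of p] by (simp add: Del_def)

lemma Del_sq':
  assumes "b > 0" "b < 1 / 2"
  shows "(Del b p)\<^sup>2 = 1 + 2 * b - (zz b p)\<^sup>2"
  unfolding Del_sq[OF assms(1)] zz_def power_mult_distrib mm_sq[OF assms(2)] cos_squared_eq
  by (simp add: algebra_simps)

lemma mm_cos_sq:
  assumes "b < 1 / 2"
  shows "(mm b * cos p)\<^sup>2 = 1 - 2 * b - (zz b p)\<^sup>2"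
  unfolding zz_def power_mult_distrib mm_sq[OF assms] cos_squared_eq
  by (simp add: algebra_simps)

lemma xx_yy:
  assumes "b > 0" "b < 1 / 2"
  shows "xx b p * yy b p = b" "(xx b p)\<^sup>2 + (yy b p)\<^sup>2 = 1 - (zz b p)\<^sup>2"
    "(xx b p)\<^sup>2 - (yy b p)\<^sup>2 = zd b p"
proof -
  have "xx b p * yy b p = ((Del b p)\<^sup>2 - (mm b * cos p)\<^sup>2) / 4"
    unfolding xx_def yy_def by (simp add: power2_eq_square field_simps)
  then show "xx b p * yy b p = b"
    unfolding Del_sq'[OF assms] mm_cos_sq[OF assms(2)] by simp
  have "(xx b p)\<^sup>2 + (yy b p)\<^sup>2 = ((Del b p)\<^sup>2 + (mm b * cos p)\<^sup>2) / 2"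
    unfolding xx_def yy_def by (simp add: power2_eq_square field_simps)
  then show "(xx b p)\<^sup>2 + (yy b p)\<^sup>2 = 1 - (zz b p)\<^sup>2"
    unfolding Del_sq'[OF assms] mm_cos_sq[OF assms(2)] by simp
  show "(xx b p)\<^sup>2 - (yy b p)\<^sup>2 = zd b p"
    unfolding xx_def yy_def zd_def by (simp add: power2_eq_square field_simps)
qed

lemma xx_yy_pos:
  assumes "b > 0" "b < 1 / 2"
  shows "xx b p > 0" "yy b p > 0"
proof -
  have *: "xx b p + yy b p > 0" "xx b p * yy b p > 0"
    using Del_pos[OF assms(1), of p] xx_yy(1)[OF assms, of p] assms by (auto simp: xx_def yy_def field_simps)
  then show "xx b p > 0" "yy b p > 0"
    by (auto simp: zero_less_mult_iff)
qed

lemma zd_sq: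
  assumes "b > 0" "b < 1 / 2"
  shows "(zd b p)\<^sup>2 = (1 - (zz b p)\<^sup>2)\<^sup>2 - 4 * b\<^sup>2"
proof -
  have "((xx b p)\<^sup>2 - (yy b p)\<^sup>2)\<^sup>2 = ((xx b p)\<^sup>2 + (yy b p)\<^sup>2)\<^sup>2 - 4 * (xx b p * yy b p)\<^sup>2"
    by algebra
  then show ?thesis by (simp add: xx_yy[OF assms])
qed

lemma continuous_on_Del [continuous_intros]: "continuous_on S (Del b)"
  unfolding Del_def by (intro continuous_intros)

lemma continuous_on_inv_Del: "b > 0 \<Longrightarrow> continuous_on S (\<lambda>p. 1 / Del b p)"
  by (intro continuous_intros) (metis Del_pos less_irrefl)

lemma Del_deriv_p:
  assumes "b > 0" "b < 1 / 2"
  shows "(Del b has_real_derivative - (zz b p * (mm b * cos p)) / Del b p) (at p)"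
proof -
  have d: "(Del b has_real_derivative
     (2 * cos p * (- sin p) + 2 * b * (2 * sin p * cos p)) * (inverse (Del b p) / 2)) (at p)"
    unfolding Del_def using Del_rad_pos[OF assms(1), of p]
    by (auto intro!: derivative_eq_intros simp: field_simps)
  have e: "2 * cos p * (- sin p) + 2 * b * (2 * sin p * cos p) = - 2 * (zz b p * (mm b * cos p))"
    using mm_sq[OF assms(2)] unfolding zz_def by algebra
  have "- 2 * w * (inverse v / 2) = - w / v" for v w :: real
    by (simp add: field_simps)
  with d show ?thesis unfolding e by simp
qed

lemma Tm_deriv: "b > 0 \<Longrightarrow> (Tm b has_real_derivative 1 / Del b p) (at p)"
  unfolding Tm_def by (intro prim_deriv continuous_on_inv_Del)

lemma Gm_deriv:
  assumes "b > 0" "b < 1 / 2"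
  shows "(Gm b has_real_derivative (1 - (zz b p)\<^sup>2) / Del b p) (at p)"
proof -
  have "(Gm b has_real_derivative Del b p - 2 * b * (1 / Del b p)) (at p)"
    unfolding Gm_def using assms
    by (auto intro!: derivative_eq_intros prim_deriv continuous_intros Tm_deriv)
  moreover have "Del b p - 2 * b * (1 / Del b p) = ((Del b p)\<^sup>2 - 2 * b) / Del b p"
    using Del_pos[OF assms(1), of p] by (simp add: field_simps power2_eq_square)
  ultimately show ?thesis by (simp add: Del_sq'[OF assms])
qed

lemma zz_deriv:
  assumes "b > 0"
  shows "(zz b has_real_derivative zd b p / Del b p) (at p)"
  unfolding zz_def zd_def using Del_pos[OF assms, of p]
  by (auto intro!: derivative_eq_intros)

lemma xx_deriv:
  assumes "b > 0" "b < 1 / 2"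
  shows "(xx b has_real_derivative - (xx b p * zz b p) / Del b p) (at p)"
  unfolding xx_def using Del_pos[OF assms(1), of p]
  by (auto intro!: derivative_eq_intros Del_deriv_p[OF assms] simp: zz_def field_simps)

lemma yy_deriv:
  assumes "b > 0" "b < 1 / 2"
  shows "(yy b has_real_derivative (yy b p * zz b p) / Del b p) (at p)"
  unfolding yy_def using Del_pos[OF assms(1), of p]
  by (auto intro!: derivative_eq_intros Del_deriv_p[OF assms] simp: zz_def field_simps)

lemma zd_deriv:
  assumes "b > 0" "b < 1 / 2"
  shows "(zd b has_real_derivative - (2 * zz b p * (1 - (zz b p)\<^sup>2)) / Del b p) (at p)"
proof -
  have "zd b = (\<lambda>p. (xx b p)\<^sup>2 - (yy b p)\<^sup>2)"
    using xx_yy(3)[OF assms] by auto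
  moreover have "((\<lambda>p. (xx b p)\<^sup>2 - (yy b p)\<^sup>2) has_real_derivative
      - (2 * zz b p * ((xx b p)\<^sup>2 + (yy b p)\<^sup>2)) / Del b p) (at p)"
    using Del_pos[OF assms(1), of p]
    by (auto intro!: derivative_eq_intros xx_deriv[OF assms] yy_deriv[OF assms]
        simp: field_simps power2_eq_square)
  ultimately show ?thesis by (simp add: xx_yy(2)[OF assms])
qed

lemma at_0 [simp]: "Tm b 0 = 0" "Gm b 0 = 0" "zz b 0 = 0"
  by (simp_all add: Tm_def Gm_def zz_def)

section \<open>Parameter derivatives at fixed phase\<close>

lemma Del_deriv_b:
  assumes "b > 0"
  shows "((\<lambda>b. Del b p) has_real_derivative (1 + (sin p)\<^sup>2) / Del b p) (at b)"
  unfolding Del_def using Del_rad_pos[OF assms, of p]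
  by (auto intro!: derivative_eq_intros simp: field_simps)

lemma continuous_on_Del2 [continuous_intros]:
  fixes f g :: "'a :: t2_space \<Rightarrow> real"
  assumes "continuous_on S f" "continuous_on S g"
  shows "continuous_on S (\<lambda>x. Del (f x) (g x))"
  unfolding Del_def by (intro continuous_intros assms)

text \<open>Differentiation under the integral sign with the integral of \<open>f'\<close> evaluated
  at once by a known primitive \<open>F\<close>; this keeps all parameter derivatives in closed
  form.\<close>

lemma prim_leibniz:
  fixes f f' :: "real \<Rightarrow> real \<Rightarrow> real"
  assumes "p \<ge> 0" "b > 0"
    and d: "\<And>b p. b > 0 \<Longrightarrow> ((\<lambda>b. f b p) has_real_derivative f' b p) (at b)"
    and c: "\<And>b S. b > 0 \<Longrightarrow> continuous_on S (f b)"
    and c': "continuous_on ({0<..} \<times> {0..p}) (\<lambda>(b, p). f' b p)"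
    and F: "\<And>q. (F has_real_derivative f' b q) (at q)" "F 0 = 0"
  shows "((\<lambda>b. prim (f b) p) has_real_derivative F p) (at b)"
proof -
  have "((\<lambda>b. integral (cbox 0 p) (f b)) has_field_derivative integral (cbox 0 p) (f' b)) (at b within {0<..})"
    by (rule leibniz_rule_field_derivative)
       (use assms in \<open>auto intro: has_field_derivative_at_within integrable_continuous_interval\<close>)
  moreover have "(f' b has_integral F p - F 0) {0..p}"
    by (rule fundamental_theorem_of_calculus[OF assms(1)])
       (use F(1) in \<open>auto simp: has_real_derivative_iff_has_vector_derivative[symmetric] intro: has_field_derivative_at_within\<close>)
  then have "integral (cbox 0 p) (f' b) = F p" using F(2) by (simp add: integral_unique)
  ultimately show ?thesis using assms(1,2)
    by (simp add: prim_nonneg_eq at_within_open[of b "{0<..}"])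
qed

text \<open>The classical modulus derivative of an incomplete integral of the first kind: a
  combination of integrals of the first and second kind and an algebraic boundary term, which
  vanishes at multiples of pi / 2.\<close>

definition Tb :: "real \<Rightarrow> real \<Rightarrow> real" where
  "Tb b p = (4 * b\<^sup>2 * Tm b p - Gm b p + (mm b)\<^sup>2 * sin p * cos p / Del b p) / (2 * b * (1 - 4 * b\<^sup>2))"

lemma one_minus_4b2_pos:
  assumes "b > 0" "b < 1 / 2"
  shows "1 - 4 * b\<^sup>2 > (0::real)"
  using mult_strict_mono[of b "1/2" b "1/2"] assms by (simp add: power2_eq_square)

text \<open>Certifies the closed form: its phase derivative is the b-derivative of the integrand
  \<open>1 / Del b p\<close>.\<close>

lemma Tb_deriv_p:
  assumes "b > 0" "b < 1 / 2"
  shows "(Tb b has_real_derivative - (1 + (sin p)\<^sup>2) / (Del b p) ^ 3) (at p)"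
proof -
  define D where "D = Del b p"
  have D: "D > 0" "D\<^sup>2 = (cos p)\<^sup>2 + 2 * b * (1 + (sin p)\<^sup>2)"
    using Del_pos[OF assms(1)] Del_sq[OF assms(1)] by (auto simp: D_def)
  have k: "1 - 4 * b\<^sup>2 > 0" by (rule one_minus_4b2_pos[OF assms])
  let ?Z = "1 - (zz b p)\<^sup>2"
  have n: "((\<lambda>p. (mm b)\<^sup>2 * sin p * cos p) has_real_derivative
      (mm b)\<^sup>2 * cos p * cos p - (mm b)\<^sup>2 * sin p * sin p) (at p)"
    by (auto intro!: derivative_eq_intros)
  have "((\<lambda>p. 4 * b\<^sup>2 * Tm b p - Gm b p + (mm b)\<^sup>2 * sin p * cos p / Del b p) has_real_derivative
     4 * b\<^sup>2 * (1 / D) - ?Z / D +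
     (((mm b)\<^sup>2 * cos p * cos p - (mm b)\<^sup>2 * sin p * sin p) * D - (mm b)\<^sup>2 * sin p * cos p * (- (zz b p * (mm b * cos p)) / D)) / (D * D)) (at p)"
    using D(1) unfolding D_def
    by (intro DERIV_add DERIV_diff DERIV_cmult DERIV_divide n Tm_deriv Gm_deriv Del_deriv_p assms) simp
  from DERIV_cdivide[OF this, of "2 * b * (1 - 4 * b\<^sup>2)"]
  have "(Tb b has_real_derivative (4 * b\<^sup>2 * (1 / D) - ?Z / D +
     (((mm b)\<^sup>2 * cos p * cos p - (mm b)\<^sup>2 * sin p * sin p) * D - (mm b)\<^sup>2 * sin p * cos p * (- (zz b p * (mm b * cos p)) / D)) / (D * D))
       / (2 * b * (1 - 4 * b\<^sup>2))) (at p)"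
    unfolding Tb_def[abs_def] .
  moreover have "(4 * b\<^sup>2 * (1 / D) - ?Z / D +
     (((mm b)\<^sup>2 * cos p * cos p - (mm b)\<^sup>2 * sin p * sin p) * D - (mm b)\<^sup>2 * sin p * cos p * (- (zz b p * (mm b * cos p)) / D)) / (D * D))
     = ((4 * b\<^sup>2 - ?Z) * D\<^sup>2 + (mm b)\<^sup>2 * ((cos p)\<^sup>2 - (sin p)\<^sup>2) * D\<^sup>2 + (mm b)^4 * (sin p)\<^sup>2 * (cos p)\<^sup>2) / D ^ 3"
    using D(1) by (simp add: zz_def field_simps power2_eq_square power3_eq_cube power4_eq_xxxx)
  moreover have "(4 * b\<^sup>2 - ?Z) * D\<^sup>2 + (mm b)\<^sup>2 * ((cos p)\<^sup>2 - (sin p)\<^sup>2) * D\<^sup>2 + (mm b)^4 * (sin p)\<^sup>2 * (cos p)\<^sup>2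
      = - (1 + (sin p)\<^sup>2) * (2 * b * (1 - 4 * b\<^sup>2))"
  proof -
    define w where "w = (sin p)\<^sup>2"
    have 1: "(cos p)\<^sup>2 = 1 - w" "(mm b)^4 = (1 - 2 * b)\<^sup>2" "?Z = 1 - (1 - 2 * b) * w"
      using mm_sq[OF assms(2)]
      by (simp_all add: w_def cos_squared_eq zz_def power_mult_distrib flip: power_mult)
        (simp add: power4_eq_xxxx power2_eq_square)
    show ?thesis
      unfolding D(2) 1 mm_sq[OF assms(2)] w_def[symmetric]
      by (simp add: algebra_simps power2_eq_square)
  qed
  ultimately show ?thesis using k assms by (simp add: D_def)
qed

lemma Tm_deriv_b:
  assumes "p \<ge> 0" "b > 0" "b < 1 / 2"
  shows "((\<lambda>b. Tm b p) has_real_derivative Tb b p) (at b)"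
  unfolding Tm_def
proof (rule prim_leibniz[where F = "Tb b"])
  show "(Tb b has_real_derivative - (1 + (sin q)\<^sup>2) / (Del b q) ^ 3) (at q)" for q
    by (rule Tb_deriv_p[OF assms(2,3)])
  fix b p :: real assume "b > 0"
  then show "((\<lambda>b. 1 / Del b p) has_real_derivative - (1 + (sin p)\<^sup>2) / (Del b p) ^ 3) (at b)"
    using Del_pos[of b p]
    by (auto intro!: derivative_eq_intros Del_deriv_b simp: field_simps power3_eq_cube)
next
  show "continuous_on ({0<..} \<times> {0..p}) (\<lambda>(b, p). - (1 + (sin p)\<^sup>2) / (Del b p) ^ 3)"
    unfolding split_beta by (intro continuous_intros) (use Del_pos in \<open>force simp: less_le\<close>)
qed (use assms continuous_on_inv_Del in \<open>auto simp: Tb_def\<close>)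

text \<open>Since (1 - 2 b) (1 + sin^2 p) = 2 - Del^2, the b-derivative of the second-kind integral
  is again a combination of the two integrals.\<close>

lemma Gm_deriv_b:
  assumes "p \<ge> 0" "b > 0" "b < 1 / 2"
  shows "((\<lambda>b. Gm b p) has_real_derivative (2 * b * Tm b p - Gm b p) / (1 - 2 * b) - 2 * b * Tb b p) (at b)"
proof -
  have "((\<lambda>b. prim (Del b) p) has_real_derivative (2 * Tm b p - prim (Del b) p) / (1 - 2 * b)) (at b)"
  proof (rule prim_leibniz)
    show "continuous_on ({0<..} \<times> {0..p}) (\<lambda>(b, p). (1 + (sin p)\<^sup>2) / Del b p)"
      unfolding split_beta by (intro continuous_intros) (use Del_pos in \<open>force simp: less_le\<close>)
    fix q
    have "((\<lambda>q. (2 * Tm b q - prim (Del b) q) / (1 - 2 * b)) has_real_derivative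
        (2 * (1 / Del b q) - Del b q) / (1 - 2 * b)) (at q)"
      using assms by (auto intro!: derivative_eq_intros Tm_deriv prim_deriv continuous_intros)
    moreover have "2 * (1 / Del b q) - Del b q = (2 - (Del b q)\<^sup>2) / Del b q"
      using Del_pos[OF assms(2), of q] by (simp add: field_simps power2_eq_square)
    moreover have "2 - (Del b q)\<^sup>2 = (1 - 2 * b) * (1 + (sin q)\<^sup>2)"
      unfolding Del_sq[OF assms(2)] cos_squared_eq by algebra
    ultimately show "((\<lambda>q. (2 * Tm b q - prim (Del b) q) / (1 - 2 * b)) has_real_derivative
        (1 + (sin q)\<^sup>2) / Del b q) (at q)"
      using assms by simp
  qed (use assms Del_deriv_b in \<open>auto intro!: continuous_intros\<close>)
  then have "((\<lambda>b. Gm b p) has_real_derivative (2 * Tm b p - prim (Del b) p) / (1 - 2 * b)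
      - (2 * Tm b p + 2 * b * Tb b p)) (at b)"
    unfolding Gm_def by (auto intro!: derivative_eq_intros Tm_deriv_b assms)
  moreover have "(2 * Tm b p - prim (Del b) p) / (1 - 2 * b) - 2 * Tm b p = (2 * b * Tm b p - Gm b p) / (1 - 2 * b)"
    using assms unfolding Gm_def by (simp add: field_simps)
  ultimately show ?thesis by (simp add: algebra_simps)
qed

section \<open>Differentiation with respect to the parameter at fixed time\<close>

lemma Del_le_2:
  assumes "b > 0" "b < 1 / 2"
  shows "Del b p \<le> 2"
proof -
  have "(Del b p)\<^sup>2 \<le> 2\<^sup>2"
    unfolding Del_sq'[OF assms] using assms zero_le_power2[of "zz b p"]
    by (simp only: power2_eq_square)
  then show ?thesis by (rule power2_le_imp_le) simp
qed

text \<open>As \<open>Del\<close> is at most 2, time grows at rate at least 1/2 in the phase. The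
  rate does not depend on b, so it yields the bijectivity of \<open>Tm b\<close> and also the
  continuity of the phase in the parameter.\<close>

lemma Tm_lower_Lipschitz:
  assumes "b > 0" "b < 1 / 2" "q \<le> p"
  shows "(p - q) / 2 \<le> Tm b p - Tm b q"
proof -
  have "(\<lambda>p. Tm b p - p / 2) q \<le> (\<lambda>p. Tm b p - p / 2) p"
  proof (rule DERIV_nonneg_imp_nondecreasing[OF assms(3)])
    fix x
    have "1 / Del b x \<ge> 1 / 2"
      using Del_pos[OF assms(1), of x] Del_le_2[OF assms(1,2), of x] by (intro divide_left_mono) auto
    moreover have "((\<lambda>p. Tm b p - p / 2) has_real_derivative (1 / Del b x - 1 / 2)) (at x)"
      by (auto intro!: derivative_eq_intros Tm_deriv assms)
    ultimately show "\<exists>y. ((\<lambda>p. Tm b p - p / 2) has_real_derivative y) (at x) \<and> 0 \<le> y"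
      by (intro exI[of _ "1 / Del b x - 1 / 2"]) auto
  qed
  then show ?thesis by (simp add: field_simps)
qed

lemma Tm_less_iff:
  assumes "b > 0" "b < 1 / 2"
  shows "Tm b p < Tm b q \<longleftrightarrow> p < q" "Tm b p \<le> Tm b q \<longleftrightarrow> p \<le> q" "Tm b p = Tm b q \<longleftrightarrow> p = q"
  using Tm_lower_Lipschitz[OF assms, of p q] Tm_lower_Lipschitz[OF assms, of q p]
  by (cases p q rule: linorder_cases; auto)+

lemma abs_diff_le_Tm:
  assumes "b > 0" "b < 1 / 2"
  shows "\<bar>p - q\<bar> \<le> 2 * \<bar>Tm b p - Tm b q\<bar>"
  using Tm_lower_Lipschitz[OF assms, of p q] Tm_lower_Lipschitz[OF assms, of q p]
  by (cases "p \<le> q") auto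

section \<open>The phase as a function of time\<close>

definition phase :: "real \<Rightarrow> real \<Rightarrow> real" where
  "phase b t = (THE p. Tm b p = t)"

lemma Tm_surj:
  assumes "b > 0" "b < 1 / 2"
  shows "\<exists>p. Tm b p = t"
proof -
  let ?l = "- 2 * \<bar>t\<bar>" and ?u = "2 * \<bar>t\<bar>"
  have "Tm b ?l \<le> t" "t \<le> Tm b ?u"
    using Tm_lower_Lipschitz[OF assms, of ?l 0] Tm_lower_Lipschitz[OF assms, of 0 ?u] by auto
  moreover have "?l \<le> ?u" by simp
  moreover have "\<forall>x. ?l \<le> x \<and> x \<le> ?u \<longrightarrow> isCont (Tm b) x"
    using DERIV_isCont[OF Tm_deriv[OF assms(1)]] by blast
  ultimately show ?thesis using IVT by blast
qed

lemma Tm_phase [simp]: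
  assumes "b > 0" "b < 1 / 2"
  shows "Tm b (phase b t) = t"
proof -
  obtain p where p: "Tm b p = t" using Tm_surj[OF assms] by blast
  show ?thesis unfolding phase_def
    by (rule theI[of _ p]) (use p Tm_less_iff(3)[OF assms] in auto)
qed

lemma phase_Tm [simp]:
  assumes "b > 0" "b < 1 / 2"
  shows "phase b (Tm b p) = p"
  using Tm_phase[OF assms, of "Tm b p"] Tm_less_iff(3)[OF assms] by blast

lemma phase_0 [simp]: "b > 0 \<Longrightarrow> b < 1 / 2 \<Longrightarrow> phase b 0 = 0"
  using phase_Tm[of b 0] by simp

lemma phase_deriv_t:
  assumes "b > 0" "b < 1 / 2"
  shows "(phase b has_real_derivative Del b (phase b t)) (at t)"
proof -
  have "isCont (phase b) t"
    unfolding isCont_def LIM_eq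
  proof (intro allI impI)
    fix e :: real assume e: "e > 0"
    have "\<bar>phase b x - phase b t\<bar> < e" if "\<bar>x - t\<bar> < e / 2" for x
      using abs_diff_le_Tm[OF assms, of "phase b x" "phase b t"] that unfolding Tm_phase[OF assms] by simp
    with e show "\<exists>s>0. \<forall>x. x \<noteq> t \<and> norm (x - t) < s \<longrightarrow> norm (phase b x - phase b t) < e"
      by (intro exI[of _ "e / 2"]) auto
  qed
  then have "(phase b has_real_derivative inverse (1 / Del b (phase b t))) (at t)"
    by (intro DERIV_inverse_function[where f = "Tm b" and a = "t - 1" and b = "t + 1"])
       (use assms Del_pos[OF assms(1), of "phase b t"] in \<open>auto intro: Tm_deriv\<close>)
  then show ?thesis by simp
qed

text \<open>The slope of \<open>F b\<close> between \<open>g b\<close> and \<open>g b0\<close> is a value of \<open>f b\<close> at an intermediate point,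
  so only the joint continuity of \<open>f\<close> is needed to differentiate along a curve.\<close>

lemma slope_along_curve:
  fixes F f :: "real \<Rightarrow> real \<Rightarrow> real" and g :: "real \<Rightarrow> real"
  assumes ev: "\<forall>\<^sub>F b in at b0. \<forall>p. (F b has_real_derivative f b p) (at p)"
    and f: "isCont (\<lambda>(b, p). f b p) (b0, g b0)"
    and g: "isCont g b0"
  obtains q where "\<forall>\<^sub>F b in at b0. F b (g b) - F b (g b0) = q b * (g b - g b0)"
    "(q \<longlongrightarrow> f b0 (g b0)) (at b0)"
proof -
  have "\<exists>\<xi>. \<bar>\<xi> - g b0\<bar> \<le> \<bar>g b - g b0\<bar> \<and> F b (g b) - F b (g b0) = f b \<xi> * (g b - g b0)"
    if d: "\<forall>p. (F b has_real_derivative f b p) (at p)" for b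
  proof (cases "g b" "g b0" rule: linorder_cases)
    case less
    obtain z where "z > g b" "z < g b0" "F b (g b0) - F b (g b) = (g b0 - g b) * f b z"
      using MVT2[OF less, of "F b" "f b"] d by blast
    then show ?thesis by (intro exI[of _ z]) (auto simp: algebra_simps)
  next
    case greater
    obtain z where "z > g b0" "z < g b" "F b (g b) - F b (g b0) = (g b - g b0) * f b z"
      using MVT2[OF greater, of "F b" "f b"] d by blast
    then show ?thesis by (intro exI[of _ z]) (auto simp: algebra_simps)
  qed auto
  then obtain \<xi> where x: "\<bar>\<xi> b - g b0\<bar> \<le> \<bar>g b - g b0\<bar>" "F b (g b) - F b (g b0) = f b (\<xi> b) * (g b - g b0)"
    if "\<forall>p. (F b has_real_derivative f b p) (at p)" for b
    by metis
  have "(\<xi> \<longlongrightarrow> g b0) (at b0)"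
  proof (rule Lim_transform)
    show "((\<lambda>_. g b0) \<longlongrightarrow> g b0) (at b0)" by simp
    have "((\<lambda>b. g b - g b0) \<longlongrightarrow> 0) (at b0)"
      using g LIM_zero unfolding isCont_def by blast
    moreover have "\<forall>\<^sub>F b in at b0. norm (\<xi> b - g b0) \<le> norm (g b - g b0) * 1"
      using ev by eventually_elim (use x(1) in simp)
    ultimately show "((\<lambda>b. \<xi> b - g b0) \<longlongrightarrow> 0) (at b0)"
      by (rule tendsto_0_le)
  qed
  then have "((\<lambda>b. (b, \<xi> b)) \<longlongrightarrow> (b0, g b0)) (at b0)"
    by (intro tendsto_Pair) auto
  then have "((\<lambda>b. f b (\<xi> b)) \<longlongrightarrow> f b0 (g b0)) (at b0)"
    using isCont_tendsto_compose[OF f] by fastforce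
  moreover have "\<forall>\<^sub>F b in at b0. F b (g b) - F b (g b0) = f b (\<xi> b) * (g b - g b0)"
    using ev by eventually_elim (rule x(2))
  ultimately show ?thesis using that[of "\<lambda>b. f b (\<xi> b)"] by blast
qed

lemma deriv_along_curve:
  fixes F f :: "real \<Rightarrow> real \<Rightarrow> real" and g :: "real \<Rightarrow> real"
  assumes ev: "\<forall>\<^sub>F b in at b0. \<forall>p. (F b has_real_derivative f b p) (at p)"
    and f: "isCont (\<lambda>(b, p). f b p) (b0, g b0)"
    and g: "(g has_real_derivative g') (at b0)"
    and Fb: "((\<lambda>b. F b (g b0)) has_real_derivative Fb) (at b0)"
  shows "((\<lambda>b. F b (g b)) has_real_derivative f b0 (g b0) * g' + Fb) (at b0)"
proof -
  obtain q where q: "\<forall>\<^sub>F b in at b0. F b (g b) - F b (g b0) = q b * (g b - g b0)"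
    "(q \<longlongrightarrow> f b0 (g b0)) (at b0)"
    using slope_along_curve[OF ev f DERIV_isCont[OF g]] .
  have "((\<lambda>b. q b * ((g b - g b0) / (b - b0)) + (F b (g b0) - F b0 (g b0)) / (b - b0))
      \<longlongrightarrow> f b0 (g b0) * g' + Fb) (at b0)"
    using g Fb unfolding has_field_derivative_iff by (intro tendsto_intros q)
  moreover have "\<forall>\<^sub>F b in at b0. q b * ((g b - g b0) / (b - b0)) + (F b (g b0) - F b0 (g b0)) / (b - b0)
      = (F b (g b) - F b0 (g b0)) / (b - b0)"
    using q(1) by eventually_elim (simp flip: add_divide_distrib)
  ultimately show ?thesis
    unfolding has_field_derivative_iff by (rule Lim_transform_eventually)
qed

text \<open>Constancy of \<open>F b (g b)\<close> balances the change of \<open>F\<close> along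
  \<open>g\<close>, which is \<open>q b * (g b - g b0)\<close>, against its change in b at the fixed
  point \<open>g b0\<close>. Dividing by \<open>q b\<close>, whose limit is nonzero, gives the
  quotient of partial derivatives.\<close>

lemma deriv_implicit:
  fixes F f :: "real \<Rightarrow> real \<Rightarrow> real" and g :: "real \<Rightarrow> real"
  assumes ev: "\<forall>\<^sub>F b in at b0. \<forall>p. (F b has_real_derivative f b p) (at p)"
    and f: "isCont (\<lambda>(b, p). f b p) (b0, g b0)" "f b0 (g b0) \<noteq> 0"
    and g: "isCont g b0"
    and Fb: "((\<lambda>b. F b (g b0)) has_real_derivative Fb) (at b0)"
    and r: "\<forall>\<^sub>F b in at b0. F b (g b) = F b0 (g b0)"
  shows "(g has_real_derivative - Fb / f b0 (g b0)) (at b0)"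
proof -
  obtain q where q: "\<forall>\<^sub>F b in at b0. F b (g b) - F b (g b0) = q b * (g b - g b0)"
    "(q \<longlongrightarrow> f b0 (g b0)) (at b0)"
    using slope_along_curve[OF ev f(1) g] .
  have nz: "\<forall>\<^sub>F b in at b0. q b \<noteq> 0"
    using tendsto_imp_eventually_ne[OF q(2) f(2)] .
  have "((\<lambda>b. - ((F b (g b0) - F b0 (g b0)) / (b - b0)) / q b) \<longlongrightarrow> - Fb / f b0 (g b0)) (at b0)"
    using Fb f(2) unfolding has_field_derivative_iff by (intro tendsto_intros q)
  moreover have "\<forall>\<^sub>F b in at b0. - ((F b (g b0) - F b0 (g b0)) / (b - b0)) / q b = (g b - g b0) / (b - b0)"
    using q(1) nz r
  proof eventually_elim
    case (elim b)
    then have e: "- (F b (g b0) - F b0 (g b0)) = q b * (g b - g b0)" by simp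
    have "- ((F b (g b0) - F b0 (g b0)) / (b - b0)) / q b = - (F b (g b0) - F b0 (g b0)) / q b / (b - b0)"
      by (simp only: minus_divide_left divide_divide_eq_left mult.commute)
    also have "\<dots> = (g b - g b0) / (b - b0)"
      unfolding e using elim(2) by simp
    finally show ?case .
  qed
  ultimately show ?thesis
    unfolding has_field_derivative_iff by (rule Lim_transform_eventually)
qed

lemma eventually_at_b:
  assumes "(b0::real) > 0" "b0 < 1 / 2"
  shows "\<forall>\<^sub>F b in at b0. b > 0 \<and> b < 1 / 2"
  using eventually_at_in_open'[of "{0<..<1/2}" b0] assms by auto

lemma isCont_Del2: "isCont (\<lambda>(b, p). Del b p) x"
proof -
  have "continuous_on UNIV (\<lambda>(b, p). Del b p)"
    unfolding split_beta by (intro continuous_intros)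
  then show ?thesis by (metis UNIV_I continuous_on_eq_continuous_at open_UNIV)
qed

text \<open>Implicit differentiation of \<open>Tm b (phase b r) = r\<close>. Continuity of the phase
  in the parameter comes from the uniform Lipschitz bound: the phase for c differs from
  \<open>?p\<close> by at most twice the distance of \<open>Tm c ?p\<close> from r.\<close>

lemma phase_deriv_b:
  assumes "b > 0" "b < 1 / 2" "r \<ge> 0"
  shows "((\<lambda>b. phase b r) has_real_derivative - Tb b (phase b r) * Del b (phase b r)) (at b)"
proof -
  let ?p = "phase b r"
  have p: "?p \<ge> 0"
    using Tm_less_iff(2)[OF assms(1,2), of 0 ?p] assms by simp
  have Fb: "((\<lambda>b. Tm b ?p) has_real_derivative Tb b ?p) (at b)"
    by (rule Tm_deriv_b[OF p assms(1,2)])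
  have "isCont (\<lambda>b. phase b r) b"
    unfolding isCont_def
  proof (rule Lim_transform)
    show "((\<lambda>_. ?p) \<longlongrightarrow> ?p) (at b)" by simp
    have "((\<lambda>b. Tm b ?p) \<longlongrightarrow> Tm b ?p) (at b)"
      using DERIV_isCont[OF Fb] unfolding isCont_def .
    then have "((\<lambda>b. r - Tm b ?p) \<longlongrightarrow> r - Tm b ?p) (at b)"
      by (intro tendsto_intros)
    then have "((\<lambda>b. r - Tm b ?p) \<longlongrightarrow> 0) (at b)"
      using assms by simp
    moreover have "\<forall>\<^sub>F c in at b. norm (phase c r - ?p) \<le> norm (r - Tm c ?p) * 2"
      using eventually_at_b[OF assms(1,2)]
    proof eventually_elim
      case (elim c)
      then show ?case using abs_diff_le_Tm[of c "phase c r" ?p] by simp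
    qed
    ultimately show "((\<lambda>c. phase c r - ?p) \<longlongrightarrow> 0) (at b)"
      by (rule tendsto_0_le)
  qed
  moreover have "isCont (\<lambda>x. 1 / (case x of (b, p) \<Rightarrow> Del b p)) (b, ?p)"
    by (intro continuous_divide isCont_Del2) (use Del_pos[OF assms(1), of ?p] in auto)
  then have "isCont (\<lambda>(b, p). 1 / Del b p) (b, ?p)" by (simp add: case_prod_beta')
  moreover have "\<forall>\<^sub>F c in at b. \<forall>p. (Tm c has_real_derivative 1 / Del c p) (at p)"
    using eventually_at_b[OF assms(1,2)] by eventually_elim (simp add: Tm_deriv)
  moreover have "\<forall>\<^sub>F c in at b. Tm c (phase c r) = Tm b ?p"
    using eventually_at_b[OF assms(1,2)] by eventually_elim (use assms in simp)
  ultimately have "((\<lambda>b. phase b r) has_real_derivative - Tb b ?p / (1 / Del b ?p)) (at b)"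
    using Del_pos[OF assms(1), of ?p] Fb
    by (intro deriv_implicit[where F = Tm and f = "\<lambda>b p. 1 / Del b p"]) auto
  then show ?thesis by simp
qed


text \<open>Let \<open>D = - 2 b d/db\<close> at fixed time. Then \<open>ww\<close> is \<open>D\<close> of \<open>ln (y / \<alpha>)\<close> and \<open>zw\<close> is \<open>D z\<close>, both in
  closed form; they solve the linearised equation \<open>w'' = - 2 w (x\<^sup>2 + y\<^sup>2) - 2 z'\<close>.\<close>

definition HH :: "real \<Rightarrow> real \<Rightarrow> real" where
  "HH b p = zd b p + zz b p * Gm b p"

definition ww :: "real \<Rightarrow> real \<Rightarrow> real" where
  "ww b p = (4 * b\<^sup>2 * Tm b p * zz b p - HH b p) / (1 - 4 * b\<^sup>2)"

definition zw :: "real \<Rightarrow> real \<Rightarrow> real" where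
  "zw b p = (4 * b\<^sup>2 * (zz b p + Tm b p * zd b p) - zd b p * Gm b p + zz b p * (1 - (zz b p)\<^sup>2)) / (1 - 4 * b\<^sup>2)"

lemma mm_deriv: "b < 1 / 2 \<Longrightarrow> (mm has_real_derivative - 1 / mm b) (at b)"
  unfolding mm_def by (auto intro!: derivative_eq_intros simp: field_simps)

lemma one_minus_4b2: "b < 1 / 2 \<Longrightarrow> 1 - 4 * b\<^sup>2 = (mm b)\<^sup>2 * (1 + 2 * b)"
  unfolding mm_sq by (simp add: power2_eq_square algebra_simps)

context
  fixes b r p :: real
  assumes b: "b > 0" "b < 1 / 2" and r: "r \<ge> 0" and p: "p = phase b r"
begin

private definition "k = 1 - 4 * b\<^sup>2"
private definition "n = 1 + 2 * b"
text \<open>The transcendental part, acting as a time shift: in \<open>pb\<close>, \<open>zw\<close>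
  and \<open>ww\<close> it multiplies the time derivative of the phase, of z and of ln y
  respectively, and what remains is algebraic.\<close>

private definition "Q = (4 * b\<^sup>2 * Tm b p - Gm b p) / k"
private definition "pb = - (Del b p * Q + sin p * cos p / n) / (2 * b)"

private lemma k: "k > 0" "n > 0" "k = (mm b)\<^sup>2 * n" "mm b > 0" "k \<noteq> 0"
  using one_minus_4b2_pos[OF b] one_minus_4b2[OF b(2)] b mm_pos[OF b(2)]
  by (auto simp: k_def n_def)

private lemma ww_Q: "ww b p = zz b p * Q - zd b p / k"
  unfolding ww_def Q_def HH_def k_def[symmetric] using k(1) by (simp add: field_simps)

private lemma zw_Q: "zw b p = zd b p * Q + (4 * b\<^sup>2 + 1 - (zz b p)\<^sup>2) * zz b p / k"
  unfolding zw_def Q_def k_def[symmetric] using k(1) by (simp add: field_simps)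

private lemma phase_deriv: "((\<lambda>b. phase b r) has_real_derivative pb) (at b)"
proof -
  let ?N = "4 * b\<^sup>2 * Tm b p - Gm b p + (mm b)\<^sup>2 * sin p * cos p / Del b p"
  have "Tb b p * Del b p = ?N / k * Del b p / (2 * b)"
    unfolding Tb_def k_def[symmetric] by (simp add: mult.commute mult.left_commute)
  also have "?N / k * Del b p = Q * Del b p + (mm b)\<^sup>2 * sin p * cos p / k"
    unfolding Q_def add_divide_distrib using Del_pos[OF b(1), of p] by (simp add: field_simps)
  also have "(mm b)\<^sup>2 * sin p * cos p / k = sin p * cos p / n"
    unfolding k(3) using k(4) by simp
  finally have "- Tb b p * Del b p = pb"
    unfolding pb_def mult_minus_left by (simp only: minus_divide_left mult.commute[of Q])
  with phase_deriv_b[OF b r] show ?thesis by (simp add: p)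
qed

private lemma n_sq: "(mm b)\<^sup>2 = 1 - 2 * b" "4 * b\<^sup>2 + 1 = (mm b)\<^sup>2 + 2 * b * n"
  using mm_sq[OF b(2)] by (auto simp: n_def algebra_simps power2_eq_square)

lemma zz_deriv_b: "((\<lambda>b. zz b (phase b r)) has_real_derivative - zw b p / (2 * b)) (at b)"
proof -
  have "((\<lambda>b. zz b (phase b r)) has_real_derivative - 1 / mm b * sin p + mm b * (cos p * pb)) (at b)"
    unfolding zz_def by (auto intro!: derivative_eq_intros mm_deriv phase_deriv b simp: p)
  moreover have "- 1 / mm b * sin p + mm b * (cos p * pb) = - zw b p / (2 * b)"
  proof -
    have "4 * b\<^sup>2 + 1 - (zz b p)\<^sup>2 = 2 * b * n + (mm b)\<^sup>2 * (cos p)\<^sup>2"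
      unfolding n_sq(2) zz_def power_mult_distrib sin_squared_eq by (simp add: algebra_simps)
    then have "(4 * b\<^sup>2 + 1 - (zz b p)\<^sup>2) * zz b p / k = 2 * b * sin p / mm b + mm b * sin p * (cos p)\<^sup>2 / n"
      unfolding k(3) zz_def using k by (simp add: field_simps power2_eq_square)
    then have zw: "zw b p = mm b * cos p * Del b p * Q + 2 * b * sin p / mm b + mm b * sin p * (cos p)\<^sup>2 / n"
      unfolding zw_Q by (simp add: zd_def)
    show ?thesis
      unfolding pb_def zw using b k by (simp add: field_simps power2_eq_square)
  qed
  ultimately show ?thesis by simp
qed

private lemma mc_deriv:
  "((\<lambda>b. mm b * cos (phase b r)) has_real_derivative (mm b * cos p + ww b p * Del b p) / (2 * b)) (at b)"
proof -
  have "((\<lambda>b. mm b * cos (phase b r)) has_real_derivative - 1 / mm b * cos p - mm b * (sin p * pb)) (at b)"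
    by (auto intro!: derivative_eq_intros mm_deriv phase_deriv b simp: p)
  moreover have "- 1 / mm b * cos p - mm b * (sin p * pb) = (mm b * cos p + ww b p * Del b p) / (2 * b)"
  proof -
    have "zd b p * Del b p = mm b * cos p * (Del b p)\<^sup>2"
      by (simp add: zd_def power2_eq_square)
    also have "(Del b p)\<^sup>2 = n - (mm b)\<^sup>2 * (sin p)\<^sup>2"
      unfolding Del_sq'[OF b] n_def zz_def by (simp add: power_mult_distrib)
    finally have "zd b p * Del b p / k = cos p / mm b - mm b * cos p * (sin p)\<^sup>2 / n"
      unfolding k(3) using k by (simp add: field_simps power2_eq_square)
    moreover have "cos p / mm b = cos p * ((mm b)\<^sup>2 + 2 * b) / mm b"
      using n_sq(1) by simp
    moreover have "\<dots> = mm b * cos p + 2 * b * cos p / mm b"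
      using k(4) by (simp add: field_simps power2_eq_square)
    ultimately have ww: "ww b p * Del b p = mm b * sin p * Q * Del b p - mm b * cos p - 2 * b * cos p / mm b + mm b * cos p * (sin p)\<^sup>2 / n"
      unfolding ww_Q zz_def by (simp add: algebra_simps)
    have "(mm b * cos p + ww b p * Del b p) / (2 * b) = - 1 / mm b * cos p - mm b * (sin p * pb)"
      unfolding pb_def ww using b k by (simp add: field_simps power2_eq_square)
    then show ?thesis by simp
  qed
  ultimately show ?thesis by simp
qed

text \<open>What \<open>D\<close> makes of Del^2 = 1 + 2 b - z^2, needed to differentiate
  \<open>Del\<close> as a square root. It is provable beforehand because the multiples of
  \<open>Q\<close> cancel in z zw - z' ww.\<close>

private lemma zw_zz: "zw b p * zz b p = - 2 * b + (Del b p)\<^sup>2 + Del b p * (mm b * cos p) * ww b p"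
proof -
  have zd2: "(zd b p)\<^sup>2 = (1 - (zz b p)\<^sup>2)\<^sup>2 - 4 * b\<^sup>2" by (rule zd_sq[OF b])
  have "zw b p * zz b p - zd b p * ww b p = ((4 * b\<^sup>2 + 1 - (zz b p)\<^sup>2) * (zz b p)\<^sup>2 + (zd b p)\<^sup>2) / k"
    unfolding zw_Q ww_Q add_divide_distrib by (simp add: algebra_simps power2_eq_square)
  also have "(4 * b\<^sup>2 + 1 - (zz b p)\<^sup>2) * (zz b p)\<^sup>2 + (zd b p)\<^sup>2 = (1 - (zz b p)\<^sup>2) * k"
    unfolding zd2 k_def by algebra
  finally show ?thesis
    using k by (simp add: Del_sq'[OF b] zd_def ac_simps)
qed

private lemma Del_deriv:
  "((\<lambda>b. Del b (phase b r)) has_real_derivative (Del b p + mm b * cos p * ww b p) / (2 * b)) (at b)"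
proof -
  have D: "Del b p > 0" by (rule Del_pos[OF b(1)])
  have D2: "1 + 2 * b - (zz b p)\<^sup>2 > 0" unfolding Del_sq'[OF b, symmetric] using D by simp
  have Ds: "sqrt (1 + 2 * b - (zz b p)\<^sup>2) = Del b p" unfolding Del_sq'[OF b, symmetric] using D by simp
  have "((\<lambda>b. 1 + 2 * b - (zz b (phase b r))\<^sup>2) has_real_derivative 2 - 2 * zz b p * (- zw b p / (2 * b))) (at b)"
    by (auto intro!: derivative_eq_intros zz_deriv_b simp: p)
  from DERIV_chain2[OF DERIV_real_sqrt this]
  have d: "((\<lambda>b. sqrt (1 + 2 * b - (zz b (phase b r))\<^sup>2)) has_real_derivative
      inverse (Del b p) / 2 * (2 - 2 * zz b p * (- zw b p / (2 * b)))) (at b)"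
    using D2 Ds by (simp add: p)
  have e1: "inverse (Del b p) / 2 * (2 - 2 * zz b p * (- zw b p / (2 * b))) = (2 + zz b p * zw b p / b) / (2 * Del b p)"
    using b D by (simp add: field_simps)
  have e2: "(2 + zz b p * zw b p / b) / (2 * Del b p) = (2 * b + zw b p * zz b p) / (2 * b * Del b p)"
    using b D by (simp add: field_simps)
  have e3: "(2 * b + zw b p * zz b p) / (2 * b * Del b p) = (Del b p + mm b * cos p * ww b p) / (2 * b)"
    unfolding zw_zz using b D by (simp add: field_simps power2_eq_square)
  from d have "((\<lambda>b. sqrt (1 + 2 * b - (zz b (phase b r))\<^sup>2)) has_real_derivative
      (Del b p + mm b * cos p * ww b p) / (2 * b)) (at b)" unfolding e1 e2 e3 .
  then show ?thesis
  proof (rule has_field_derivative_transform_within_open[where S = "{0<..<1/2}"])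
    fix c :: real assume "c \<in> {0<..<1/2}"
    then show "sqrt (1 + 2 * c - (zz c (phase c r))\<^sup>2) = Del c (phase c r)"
      using Del_sq'[of c "phase c r"] Del_pos[of c "phase c r"] by (metis greaterThanLessThan_iff less_imp_le real_sqrt_unique)
  qed (use b in auto)
qed

lemma xx_deriv_b: "((\<lambda>b. xx b (phase b r)) has_real_derivative xx b p * (1 + ww b p) / (2 * b)) (at b)"
  unfolding xx_def
  by (rule DERIV_cong[OF DERIV_cdivide[OF DERIV_add[OF Del_deriv mc_deriv]]])
     (use b in \<open>simp add: field_simps\<close>)

lemma yy_deriv_b: "((\<lambda>b. yy b (phase b r)) has_real_derivative yy b p * (1 - ww b p) / (2 * b)) (at b)"
  unfolding yy_def
  by (rule DERIV_cong[OF DERIV_cdivide[OF DERIV_diff[OF Del_deriv mc_deriv]]])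
     (use b in \<open>simp add: field_simps\<close>)

lemma zd_deriv_b:
  "((\<lambda>b. zd b (phase b r)) has_real_derivative (zd b p + ww b p * (1 - (zz b p)\<^sup>2)) / b) (at b)"
proof -
  have "((\<lambda>b. zd b (phase b r)) has_real_derivative
      (mm b * cos p + ww b p * Del b p) / (2 * b) * Del b p + (Del b p + mm b * cos p * ww b p) / (2 * b) * (mm b * cos p)) (at b)"
    unfolding zd_def using DERIV_mult[OF mc_deriv Del_deriv] by (simp add: p)
  moreover have "(mm b * cos p + ww b p * Del b p) / (2 * b) * Del b p + (Del b p + mm b * cos p * ww b p) / (2 * b) * (mm b * cos p)
     = (zd b p + ww b p * (((Del b p)\<^sup>2 + (mm b * cos p)\<^sup>2) / 2)) / b"
    unfolding zd_def using b by (simp add: field_simps power2_eq_square)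
  moreover have "((Del b p)\<^sup>2 + (mm b * cos p)\<^sup>2) / 2 = 1 - (zz b p)\<^sup>2"
    unfolding Del_sq'[OF b] mm_cos_sq[OF b(2)] by simp
  ultimately show ?thesis by simp
qed

lemma Gm_deriv_b_phase: "((\<lambda>b. Gm b (phase b r)) has_real_derivative (Gm b p + zz b p * ww b p) / (2 * b)) (at b)"
proof -
  have D: "Del b p > 0" by (rule Del_pos[OF b(1)])
  have p0: "phase b r \<ge> 0"
    using Tm_less_iff(2)[OF b, of 0 "phase b r"] b r by simp
  have "isCont (\<lambda>x. (1 - (zz (fst x) (snd x))\<^sup>2) / (case x of (b, p) \<Rightarrow> Del b p)) (b, phase b r)"
    unfolding zz_def mm_def
    by (intro continuous_divide isCont_Del2 continuous_intros) (use D p in auto)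
  then have c: "isCont (\<lambda>(b, p). (1 - (zz b p)\<^sup>2) / Del b p) (b, phase b r)"
    by (simp add: case_prod_beta')
  have e: "\<forall>\<^sub>F c in at b. \<forall>q. (Gm c has_real_derivative (1 - (zz c q)\<^sup>2) / Del c q) (at q)"
    using eventually_at_b[OF b] by eventually_elim (simp add: Gm_deriv)
  have d: "((\<lambda>b. Gm b (phase b r)) has_real_derivative (1 - (zz b p)\<^sup>2) / Del b p * pb
     + ((2 * b * Tm b p - Gm b p) / (mm b)\<^sup>2 - 2 * b * Tb b p)) (at b)"
    using deriv_along_curve[OF e c phase_deriv Gm_deriv_b[OF p0 b]] by (simp add: p n_sq(1))
  \<comment> \<open>Eliminating \<open>Tb\<close> in favour of \<open>pb\<close> merges the
    fixed-phase term with the chain-rule term: together they carry the factor (1 - z^2 + 2 b) / Del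
    = Del.\<close>
  have Tb: "2 * b * Tb b p = - 2 * b * pb / Del b p"
  proof -
    have "((\<lambda>b. phase b r) has_real_derivative - Tb b p * Del b p) (at b)"
      using phase_deriv_b[OF b r] by (simp add: p)
    from DERIV_unique[OF this phase_deriv] have "Tb b p = - pb / Del b p" using D by (simp add: field_simps)
    then show ?thesis by simp
  qed
  have pbD: "2 * b * (pb * Del b p) = - ((Del b p)\<^sup>2 * Q + zd b p * zz b p / k)"
    unfolding pb_def k(3) zd_def zz_def using b k by (simp add: field_simps power2_eq_square)
  have "2 * b * ((1 - (zz b p)\<^sup>2) / Del b p * pb + ((2 * b * Tm b p - Gm b p) / (mm b)\<^sup>2 - 2 * b * Tb b p))
     = (1 - (zz b p)\<^sup>2 + 2 * b) / (Del b p)\<^sup>2 * (2 * b * (pb * Del b p)) + 2 * b * (2 * b * Tm b p - Gm b p) / (mm b)\<^sup>2"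
    unfolding Tb using D by (simp add: field_simps power2_eq_square)
  also have "1 - (zz b p)\<^sup>2 + 2 * b = (Del b p)\<^sup>2"
    by (simp add: Del_sq'[OF b])
  also have "(Del b p)\<^sup>2 / (Del b p)\<^sup>2 * (2 * b * (pb * Del b p)) + 2 * b * (2 * b * Tm b p - Gm b p) / (mm b)\<^sup>2
      = zz b p * ww b p - (n * Q - 2 * b * (2 * b * Tm b p - Gm b p) / (mm b)\<^sup>2)"
  proof -
    have "n * Q = ((Del b p)\<^sup>2 + (zz b p)\<^sup>2) * Q"
      by (simp add: Del_sq'[OF b] n_def)
    then show ?thesis
      unfolding pbD ww_Q using D by (simp add: algebra_simps power2_eq_square)
  qed
  also have "n * Q - 2 * b * (2 * b * Tm b p - Gm b p) / (mm b)\<^sup>2 = - Gm b p"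
  proof -
    have "n * Q = (4 * b\<^sup>2 * Tm b p - Gm b p) / (mm b)\<^sup>2"
      unfolding Q_def k(3) using k by simp
    then have "n * Q - 2 * b * (2 * b * Tm b p - Gm b p) / (mm b)\<^sup>2
        = ((4 * b\<^sup>2 * Tm b p - Gm b p) - 2 * b * (2 * b * Tm b p - Gm b p)) / (mm b)\<^sup>2"
      by (simp only: diff_divide_distrib)
    also have "(4 * b\<^sup>2 * Tm b p - Gm b p) - 2 * b * (2 * b * Tm b p - Gm b p) = - Gm b p * (1 - 2 * b)"
      by (simp add: algebra_simps power2_eq_square)
    finally have "n * Q - 2 * b * (2 * b * Tm b p - Gm b p) / (mm b)\<^sup>2 = - Gm b p * (1 - 2 * b) / (mm b)\<^sup>2" .
    then show ?thesis using b by (simp add: n_sq(1))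
  qed
  finally have "(1 - (zz b p)\<^sup>2) / Del b p * pb + ((2 * b * Tm b p - Gm b p) / (mm b)\<^sup>2 - 2 * b * Tb b p)
      = (Gm b p + zz b p * ww b p) / (2 * b)"
    using b by (simp add: field_simps)
  with d show ?thesis by simp
qed

end

section \<open>The sign of the cusp function for fixed parameter\<close>

lemma deriv_nonneg_mono:
  fixes f f' :: "real \<Rightarrow> real"
  assumes "a \<le> x" "\<And>t. a \<le> t \<Longrightarrow> t \<le> x \<Longrightarrow> (f has_real_derivative f' t) (at t)"
    "\<And>t. a \<le> t \<Longrightarrow> t \<le> x \<Longrightarrow> f' t \<ge> 0"
  shows "f a \<le> f x"
  by (rule DERIV_nonneg_imp_nondecreasing[OF assms(1)]) (use assms in blast)

lemma wronskian_mono: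
  fixes f g f' g' :: "real \<Rightarrow> real"
  assumes "a \<le> c"
    and f: "\<And>t. a \<le> t \<Longrightarrow> t \<le> c \<Longrightarrow> (f has_real_derivative f' t) (at t)"
    and g: "\<And>t. a \<le> t \<Longrightarrow> t \<le> c \<Longrightarrow> (g has_real_derivative g' t) (at t)"
    and pos: "\<And>t. a \<le> t \<Longrightarrow> t \<le> c \<Longrightarrow> g t > 0"
    and W: "\<And>t. a \<le> t \<Longrightarrow> t \<le> c \<Longrightarrow> g t * f' t - g' t * f t \<ge> 0"
  shows "f a / g a \<le> f c / g c"
proof (rule deriv_nonneg_mono[OF assms(1), where f' = "\<lambda>t. (f' t * g t - f t * g' t) / (g t * g t)"])
  fix t assume t: "a \<le> t" "t \<le> c"
  show "((\<lambda>t. f t / g t) has_real_derivative (f' t * g t - f t * g' t) / (g t * g t)) (at t)"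
    using pos[OF t] by (intro DERIV_divide f g t) simp
  show "(f' t * g t - f t * g' t) / (g t * g t) \<ge> 0"
    using pos[OF t] W[OF t] by (simp add: mult.commute)
qed

text \<open>\<open>cusp_fun\<close> is \<open>(1 - 4 b\<^sup>2) x\<close> times the derivative of \<open>a\<close>, in the direction \<open>D\<close> above.\<close>

definition cusp_fun :: "real \<Rightarrow> real \<Rightarrow> real" where
  "cusp_fun b p = 4 * b\<^sup>2 * Tm b p * HH b p + 2 * zz b p - (zz b p) ^ 3 - 2 * zd b p * Gm b p - zz b p * (Gm b p)\<^sup>2"

context
  fixes b :: real
  assumes b: "b > 0" "b < 1 / 2"
begin

private abbreviation "z \<equiv> zz b"
private abbreviation "d \<equiv> zd b"
private abbreviation "G \<equiv> Gm b"
private abbreviation "T \<equiv> Tm b"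
private definition "c = 4 * b\<^sup>2"
text \<open>This is dt/dp: derivatives here are taken in the phase, so each one is the time
  derivative times \<open>i p\<close>.\<close>

private definition "i p = 1 / Del b p"

private lemma c: "c > 0" "c < 1"
  using one_minus_4b2_pos[OF b] b by (auto simp: c_def)

private lemma i: "i p > 0"
  using Del_pos[OF b(1), of p] by (simp add: i_def)

private lemma dd: "d p * d p = (1 - z p * z p) * (1 - z p * z p) - c"
  using zd_sq[OF b, of p] by (simp add: power2_eq_square c_def)

private lemma D:
  "(z has_real_derivative d p * i p) (at p)"
  "(d has_real_derivative - 2 * z p * (1 - z p * z p) * i p) (at p)"
  "(T has_real_derivative i p) (at p)"
  "(G has_real_derivative (1 - z p * z p) * i p) (at p)"
  "(xx b has_real_derivative - xx b p * z p * i p) (at p)"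
  "(yy b has_real_derivative yy b p * z p * i p) (at p)"
  using zz_deriv[OF b(1), of p] zd_deriv[OF b, of p] Tm_deriv[OF b(1), of p] Gm_deriv[OF b, of p]
    xx_deriv[OF b, of p] yy_deriv[OF b, of p]
  by (simp_all add: i_def power2_eq_square)

text \<open>The chain behind the monotonicity of N / z. \<open>Y\<close> is the Wronskian z N' - z'
  N with respect to time; in time Y' = 2 z (v + 2 c z) and v' = 2 z u, while u' is 2 z v plus a
  positive forcing term. All of them vanish at phase 0, so nonnegativity passes from
  \<open>u\<close> to \<open>v\<close> to \<open>Y\<close> while z is nonnegative.\<close>

private definition "E p = (2 - c) * G p - c * T p"
private definition "u p = (1 - z p * z p) * E p - (2 - c) * z p * d p"
private definition "v p = (2 - 2 * c) * z p - (2 - c) * z p * z p * z p - d p * E p"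
private definition "Y p = - (2 - c) * z p * d p + (2 * (1 - c) - z p * z p * (2 - c)) * G p - c * T p * ((1 - c) - z p * z p)"
private definition "N p = c * T p * (d p + z p * G p) + 2 * z p - z p * z p * z p - 2 * d p * G p - z p * G p * G p"

private lemma N_eq: "cusp_fun b p = N p"
  by (simp add: cusp_fun_def N_def c_def HH_def power2_eq_square power3_eq_cube)

private lemma E_deriv: "(E has_real_derivative ((2 - c) * (1 - z p * z p) - c) * i p) (at p)"
  unfolding E_def
  by (rule DERIV_cong, (rule derivative_intros D)+) algebra

private lemma u_deriv: "(u has_real_derivative ((1 - c) * c + 3 * c * z p * z p + 2 * z p * v p) * i p) (at p)"
  unfolding u_def v_def
  by (rule DERIV_cong, (rule derivative_intros D E_deriv)+) (use dd[of p] in algebra)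

private lemma v_deriv: "(v has_real_derivative 2 * z p * u p * i p) (at p)"
  unfolding u_def v_def
  by (rule DERIV_cong, (rule derivative_intros D E_deriv)+) algebra

private lemma Y_deriv: "(Y has_real_derivative 2 * z p * (v p + 2 * c * z p) * i p) (at p)"
  unfolding Y_def v_def E_def
  by (rule DERIV_cong, (rule derivative_intros D)+) (use dd[of p] in algebra)

private definition "N' p = (d p * (c - z p * z p - G p * G p) + 2 * z p * G p * (1 - z p * z p) + c * z p * G p
   + c * T p * (d p * G p - z p * (1 - z p * z p))) * i p"

private lemma N_deriv: "(N has_real_derivative N' p) (at p)"
  unfolding N_def N'_def
  by (rule DERIV_cong, (rule derivative_intros D)+) algebra

private lemma N_wronskian: "z p * N' p - d p * i p * N p = Y p * i p"
  unfolding N_def N'_def Y_def using dd[of p] by algebra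

lemma zz_nonneg: "0 \<le> p \<Longrightarrow> p \<le> pi \<Longrightarrow> zz b p \<ge> 0"
  using mm_pos[OF b(2)] sin_ge_zero[of p] by (simp add: zz_def)

lemma zz_pos: "0 < p \<Longrightarrow> p < pi \<Longrightarrow> zz b p > 0"
  using mm_pos[OF b(2)] sin_gt_zero[of p] by (simp add: zz_def)

private lemma uv_0: "u 0 = 0" "v 0 = 0" "Y 0 = 0" "N 0 = 0"
  by (simp_all add: u_def v_def Y_def N_def E_def)

text \<open>\<open>u\<close> and \<open>v\<close> solve a forced linear system that \<open>u + v\<close> and \<open>u - v\<close> diagonalise,
  with integrating factors \<open>x\<^sup>2\<close> and \<open>y\<^sup>2\<close>.\<close>

private lemma u_nonneg: assumes "p \<ge> 0" shows "u p \<ge> 0"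
proof -
  have f: "((1 - c) * c + 3 * c * z t * z t) * s * s * i t \<ge> 0" for t s
    using c i[of t] by (intro mult_nonneg_nonneg add_nonneg_nonneg zero_le_mult_iff[THEN iffD2] disjI1; simp add: mult.assoc zero_le_mult_iff; linarith)
  have "(u 0 + v 0) * xx b 0 * xx b 0 \<le> (u p + v p) * xx b p * xx b p"
  proof (rule deriv_nonneg_mono[OF assms, where f' = "\<lambda>t. ((1 - c) * c + 3 * c * z t * z t) * xx b t * xx b t * i t"])
    show "((\<lambda>p. (u p + v p) * xx b p * xx b p) has_real_derivative
      ((1 - c) * c + 3 * c * z t * z t) * xx b t * xx b t * i t) (at t)" for t
      by (rule DERIV_cong, (rule derivative_intros D u_deriv v_deriv)+) algebra
  qed (rule f)
  then have 1: "u p + v p \<ge> 0" using xx_yy_pos[OF b, of p] by (simp add: uv_0 zero_le_mult_iff)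
  have "(u 0 - v 0) * yy b 0 * yy b 0 \<le> (u p - v p) * yy b p * yy b p"
  proof (rule deriv_nonneg_mono[OF assms, where f' = "\<lambda>t. ((1 - c) * c + 3 * c * z t * z t) * yy b t * yy b t * i t"])
    show "((\<lambda>p. (u p - v p) * yy b p * yy b p) has_real_derivative
      ((1 - c) * c + 3 * c * z t * z t) * yy b t * yy b t * i t) (at t)" for t
      by (rule DERIV_cong, (rule derivative_intros D u_deriv v_deriv)+) algebra
  qed (rule f)
  then have 2: "u p - v p \<ge> 0" using xx_yy_pos[OF b, of p] by (simp add: uv_0 zero_le_mult_iff)
  show ?thesis using 1 2 by simp
qed

private lemma Y_nonneg:
  assumes "p \<ge> 0" "p \<le> pi" shows "Y p \<ge> 0"
proof -
  have v: "v q \<ge> 0" if "q \<ge> 0" "q \<le> pi" for q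
    using deriv_nonneg_mono[OF that(1), of v "\<lambda>p. 2 * z p * u p * i p", OF v_deriv] that
    by (simp add: uv_0 u_nonneg zz_nonneg less_imp_le[OF i])
  show ?thesis
    using deriv_nonneg_mono[OF assms(1), of Y "\<lambda>p. 2 * z p * (v p + 2 * c * z p) * i p", OF Y_deriv] assms
    by (simp add: uv_0 v zz_nonneg less_imp_le[OF i] less_imp_le[OF c(1)])
qed

private lemma N_over_z_mono:
  assumes "0 < p" "p \<le> q" "q < pi"
  shows "N p / z p \<le> N q / z q"
proof (rule wronskian_mono[OF assms(2) N_deriv D(1)])
  fix t assume t: "p \<le> t" "t \<le> q"
  show "z t > 0" using t assms by (intro zz_pos) auto
  show "z t * N' t - d t * i t * N t \<ge> 0"
    unfolding N_wronskian using t assms by (intro mult_nonneg_nonneg Y_nonneg less_imp_le[OF i]) auto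
qed

text \<open>The integrand x^2 + y^2 of G is at least 2 x y = 2 b, which exceeds 4 b^2 for b <
  1/2.\<close>

lemma Gm_gt_4b2_Tm:
  assumes "p > 0" shows "4 * b\<^sup>2 * Tm b p < Gm b p"
proof -
  have "(\<lambda>p. G p - c * T p) 0 < (\<lambda>p. G p - c * T p) p"
  proof (rule DERIV_pos_imp_increasing[OF assms])
    fix t
    have "(mm b)\<^sup>2 * (sin t)\<^sup>2 \<le> (mm b)\<^sup>2 * 1"
      by (intro mult_left_mono) (auto simp: abs_square_le_1)
    then have "z t * z t \<le> 1 - 2 * b"
      using mm_sq[OF b(2)] by (simp add: zz_def power2_eq_square mult_ac)
    moreover have "c < 2 * b"
      using b by (simp add: c_def power2_eq_square)
    ultimately have "(1 - z t * z t - c) * i t > 0" using i[of t] by simp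
    moreover have "((\<lambda>p. G p - c * T p) has_real_derivative (1 - z t * z t - c) * i t) (at t)"
      by (rule DERIV_cong, (rule derivative_intros D)+) algebra
    ultimately show "\<exists>y. ((\<lambda>p. G p - c * T p) has_real_derivative y) (at t) \<and> y > 0" by blast
  qed
  then show ?thesis by (simp add: c_def)
qed

lemma Tm_nonneg: "p \<ge> 0 \<Longrightarrow> Tm b p \<ge> 0"
  using Tm_less_iff(2)[OF b, of 0 p] by simp

lemma Gm_nonneg: "p \<ge> 0 \<Longrightarrow> Gm b p \<ge> 0"
  using Gm_gt_4b2_Tm[of p] Tm_nonneg[of p] by (cases "p = 0") (auto intro: less_imp_le order_trans[rotated])

text \<open>N / z does not decrease, and it is positive just after 0 because N starts at 0 with
  positive slope. At pi, where z vanishes, N is evaluated directly.\<close>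

lemma cusp_fun_pos_first_half:
  assumes "0 < p" "p \<le> pi"
  shows "cusp_fun b p > 0"
proof (cases "p = pi")
  case True
  have "N pi = - d pi * (2 * G pi - c * T pi)"
    by (simp add: N_def zz_def algebra_simps)
  moreover have "d pi < 0"
    using mm_pos[OF b(2)] Del_pos[OF b(1), of pi] by (simp add: zd_def)
  moreover have "2 * G pi - c * T pi > 0"
    using Gm_gt_4b2_Tm[of pi] Gm_nonneg[of pi] pi_gt_zero
    unfolding c_def by linarith
  ultimately show ?thesis unfolding N_eq True by (simp add: mult_neg_pos)
next
  case False
  show ?thesis
  proof (rule ccontr)
    assume "\<not> cusp_fun b p > 0"
    then have n: "N p \<le> 0" by (simp add: N_eq)
    have p: "p < pi" using False assms by simp
    have "N' 0 > 0"
      using c i[of 0] mm_pos[OF b(2)] Del_pos[OF b(1), of 0] by (simp add: N'_def zd_def)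
    from DERIV_pos_inc_right[OF N_deriv this] obtain e where e: "e > 0" "\<And>h. 0 < h \<Longrightarrow> h < e \<Longrightarrow> N h > 0"
      by (auto simp: uv_0)
    define h where "h = min (e / 2) p"
    have h: "0 < h" "h \<le> p" "h < e" using e(1) assms by (auto simp: h_def min_def)
    have "N h / z h > 0" using e(2)[OF h(1,3)] zz_pos[of h] h p by simp
    moreover have "N p / z p \<le> 0" using n zz_pos[OF assms(1) p] by (simp add: divide_nonpos_pos)
    ultimately show False using N_over_z_mono[OF h(1,2) p] by simp
  qed
qed

text \<open>The monotone ratio N / z read in the other direction: the coefficient is its value at pi
  / 2, where z' = 0. It tends to 0 with b, so N on the first quarter is negligible in the reflection
  formulas for the later quarters.\<close>

lemma cusp_fun_le_first_quarter:
  assumes "0 \<le> p" "p \<le> pi / 2"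
  shows "cusp_fun b p \<le> (4 * b\<^sup>2 * Tm b (pi/2) * Gm b (pi/2) + 2 - (mm b)\<^sup>2 - (Gm b (pi/2))\<^sup>2) * zz b p"
proof (cases "p = 0")
  case True
  then show ?thesis by (simp add: N_eq uv_0)
next
  case False
  then have "N p / z p \<le> N (pi/2) / z (pi/2)"
    using assms by (intro N_over_z_mono) auto
  also have "z (pi/2) = mm b" "d (pi/2) = 0"
    by (simp_all add: zz_def zd_def)
  then have "N (pi/2) / z (pi/2) = 4 * b\<^sup>2 * T (pi/2) * G (pi/2) + 2 - (mm b)\<^sup>2 - (G (pi/2))\<^sup>2"
    unfolding N_def using mm_pos[OF b(2)] by (simp add: c_def field_simps power2_eq_square)
  finally show ?thesis
    using zz_pos[of p] False assms by (simp add: N_eq field_simps)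
qed

text \<open>z N is a quadratic in \<open>HH\<close>, so positivity of N bounds \<open>HH\<close>
  from above.\<close>

lemma zz_cusp_fun: "zz b p * cusp_fun b p = 1 - 4 * b\<^sup>2 + 4 * b\<^sup>2 * Tm b p * zz b p * HH b p - (HH b p)\<^sup>2"
  unfolding N_eq N_def HH_def c_def[symmetric] using dd[of p] by algebra


section \<open>Reflection symmetries and the second half of the period\<close>

private lemma Del_reflect: "Del b (pi - p) = Del b p" "Del b (2 * pi - p) = Del b p"
  by (simp_all add: Del_def)

private lemma Tm_reflect: "Tm b (pi - p) = 2 * Tm b (pi / 2) - Tm b p" "Tm b (2 * pi - p) = 4 * Tm b (pi / 2) - Tm b p"
proof -
  have 1: "Tm b (pi - p) = Tm b pi - Tm b p" "Tm b (2 * pi - p) = Tm b (2 * pi) - Tm b p" for p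
    unfolding Tm_def by (intro prim_reflect continuous_on_inv_Del b; simp add: Del_reflect)+
  have "Tm b pi = 2 * Tm b (pi / 2)" using 1(1)[of "pi / 2"] by simp
  moreover have "Tm b (2 * pi) = 2 * Tm b pi" using 1(2)[of pi] by simp
  ultimately show "Tm b (pi - p) = 2 * Tm b (pi / 2) - Tm b p" "Tm b (2 * pi - p) = 4 * Tm b (pi / 2) - Tm b p"
    using 1 by auto
qed

private lemma Gm_reflect: "Gm b (pi - p) = 2 * Gm b (pi / 2) - Gm b p" "Gm b (2 * pi - p) = 4 * Gm b (pi / 2) - Gm b p"
proof -
  have 1: "prim (Del b) (pi - p) = prim (Del b) pi - prim (Del b) p"
    "prim (Del b) (2 * pi - p) = prim (Del b) (2 * pi) - prim (Del b) p" for p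
    by (intro prim_reflect continuous_on_Del; simp add: Del_reflect)+
  have "prim (Del b) pi = 2 * prim (Del b) (pi / 2)" using 1(1)[of "pi / 2"] by simp
  moreover have "prim (Del b) (2 * pi) = 2 * prim (Del b) pi" using 1(2)[of pi] by simp
  ultimately show "Gm b (pi - p) = 2 * Gm b (pi / 2) - Gm b p" "Gm b (2 * pi - p) = 4 * Gm b (pi / 2) - Gm b p"
    unfolding Gm_def Tm_reflect 1 by (simp_all add: algebra_simps)
qed

lemma Tm_symm: "Tm b (pi + p) = 2 * Tm b (pi / 2) + Tm b p" "Tm b (2 * pi - p) = 4 * Tm b (pi / 2) - Tm b p"
  "Tm b (2 * pi) = 4 * Tm b (pi / 2)"
  using Tm_reflect(2)[of "pi - p"] Tm_reflect(1)[of p] Tm_reflect(2)[of p] Tm_reflect(2)[of 0] by simp_all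

lemma Gm_symm: "Gm b (pi + p) = 2 * Gm b (pi / 2) + Gm b p" "Gm b (2 * pi - p) = 4 * Gm b (pi / 2) - Gm b p"
  "Gm b (2 * pi) = 4 * Gm b (pi / 2)"
  using Gm_reflect(2)[of "pi - p"] Gm_reflect(1)[of p] Gm_reflect(2)[of p] Gm_reflect(2)[of 0] by simp_all

lemma zz_symm: "zz b (pi + p) = - zz b p" "zz b (2 * pi - p) = - zz b p"
  by (simp_all add: zz_def)

lemma zd_symm: "zd b (pi + p) = - zd b p" "zd b (2 * pi - p) = zd b p"
  by (simp_all add: zd_def Del_def)

lemma xx_symm: "xx b (2 * pi - p) = xx b p"
  by (simp add: xx_def Del_def)

private abbreviation "Gq \<equiv> Gm b (pi / 2)"
private abbreviation "Tq \<equiv> Tm b (pi / 2)"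
private definition "C = c * Tq * Gq + 2 - (mm b)\<^sup>2 - Gq\<^sup>2"

private lemma cusp_fun_le_C: "0 \<le> p \<Longrightarrow> p \<le> pi / 2 \<Longrightarrow> N p \<le> C * z p"
  using cusp_fun_le_first_quarter[of p] by (simp add: C_def c_def N_eq)

private lemma zd_nonneg: "0 \<le> p \<Longrightarrow> p \<le> pi / 2 \<Longrightarrow> d p \<ge> 0"
  using cos_ge_zero[of p] mm_pos[OF b(2)] Del_pos[OF b(1), of p] by (simp add: zd_def)

private lemma Gq_pos: "Gq > 0" "c * Tq < Gq" "c * Tq \<ge> 0"
  using Gm_gt_4b2_Tm[of "pi/2"] Tm_nonneg[of "pi/2"] c pi_gt_zero
  by (auto simp: c_def intro: le_less_trans[rotated] mult_nonneg_nonneg)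

private lemma Tm_le_Tq: "p \<le> pi / 2 \<Longrightarrow> c * T p \<le> c * Tq"
  using c Tm_less_iff(2)[OF b, of p "pi/2"] by simp

text \<open>Passing to pi + p flips the signs of z and z' and shifts T and G by their half-period
  increments; passing to 2 pi - p flips z only and subtracts T and G from their full-period values.
  Expanding the polynomial N expresses it on later quarters by - N on the first one and explicit
  corrections.\<close>

private lemma N_third: "N (pi + p) = - N p + (d p + z p * G p) * (4 * Gq - 2 * c * Tq)
    + 2 * Gq * z p * (2 * Gq - c * (2 * Tq + T p))"
  unfolding N_def Tm_symm Gm_symm zz_symm zd_symm by algebra

private lemma N_fourth: "N (2 * pi - p) = - N p - (d p + z p * G p) * (8 * Gq - 4 * c * Tq)
    + 4 * Gq * z p * (4 * Gq - c * (4 * Tq - T p))"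
  unfolding N_def Tm_symm Gm_symm zz_symm zd_symm by algebra

text \<open>In \<open>N_third\<close> the middle term is nonnegative, and the third hypothesis lets
  the last term outweigh the upper bound for N on the first quarter. In the limit b = 0 that
  hypothesis reads 0 < 4.\<close>

lemma cusp_fun_pos_third_quarter:
  assumes "0 < p" "p \<le> pi / 2"
    and "4 * b\<^sup>2 * Tq * Gq + 2 - (mm b)\<^sup>2 - Gq\<^sup>2 < 2 * Gq * (2 * Gq - 12 * b\<^sup>2 * Tq)"
  shows "cusp_fun b (pi + p) > 0"
proof -
  have zp: "z p > 0" using assms by (intro zz_pos) auto
  have "(d p + z p * G p) * (4 * Gq - 2 * c * Tq) \<ge> 0"
    using zd_nonneg[of p] zp Gm_nonneg[of p] Gq_pos assms
    by (intro mult_nonneg_nonneg add_nonneg_nonneg) auto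
  moreover have "2 * Gq * z p * (2 * Gq - c * (2 * Tq + T p)) \<ge> 2 * Gq * z p * (2 * Gq - 3 * c * Tq)"
    using Tm_le_Tq[OF assms(2)] Gq_pos zp by (intro mult_left_mono) (auto simp: algebra_simps)
  moreover have "C * z p < (2 * Gq * (2 * Gq - 3 * c * Tq)) * z p"
    using assms(3) zp by (intro mult_strict_right_mono) (simp_all add: C_def c_def)
  moreover have "N p \<le> C * z p" using assms by (intro cusp_fun_le_C) auto
  ultimately have "N (pi + p) > 0" unfolding N_third by (simp add: algebra_simps)
  then show ?thesis by (simp add: N_eq)
qed

text \<open>\<open>N_fourth\<close> has a term of the wrong sign, proportional to H = z' + z G.
  Since N > 0 on the first half, \<open>zz_cusp_fun\<close> gives a quadratic inequality for H that
  forces H to be at most 1 + c Tq. In the limit b = 0 positivity then needs 16 z > 8, which z = 3/5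
  meets with slack.\<close>

lemma cusp_fun_pos_fourth_quarter:
  assumes "0 \<le> p" "p \<le> pi / 2" "zz b p \<ge> 3 / 5"
    and *: "8 * Gq * (1 + 4 * b\<^sup>2 * Tq)
      < 3 / 5 * (16 * Gq * (Gq - 4 * b\<^sup>2 * Tq) - (4 * b\<^sup>2 * Tq * Gq + 2 - (mm b)\<^sup>2 - Gq\<^sup>2))"
  shows "cusp_fun b (2 * pi - p) > 0"
proof -
  define H where "H = d p + z p * G p"
  have *: "8 * Gq * (1 + c * Tq) < 3 / 5 * (16 * Gq * (Gq - c * Tq) - C)"
    using * by (simp add: C_def c_def)
  have p: "0 < p" using assms(1,3) by (cases "p = 0") auto
  have "mm b * sin p \<le> 1 * 1"
    using b mm_sq[OF b(2)] mm_pos[OF b(2)] sin_le_one[of p] sin_ge_zero[of p] assms pi_gt_zero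
    by (intro mult_mono) (auto simp: mm_def)
  then have z1: "z p \<le> 1" by (simp add: zz_def)
  have z0: "z p > 0" using assms by simp
  have H0: "H \<ge> 0"
    using zd_nonneg[of p] Gm_nonneg[of p] z0 assms by (simp add: H_def)
  have Tp: "c * T p \<le> c * Tq" "c * T p \<ge> 0"
    using Tm_le_Tq[OF assms(2)] c Tm_nonneg[OF assms(1)] by auto
  have H1: "H \<le> 1 + c * Tq"
  proof (rule ccontr)
    assume h: "\<not> H \<le> 1 + c * Tq"
    have "0 < z p * N p"
      using cusp_fun_pos_first_half[OF p] assms z0 by (simp add: N_eq)
    then have "H * H < 1 - c + c * T p * z p * H"
      using zz_cusp_fun[of p] by (simp add: N_eq H_def HH_def c_def power2_eq_square)
    also have "c * T p * z p * H \<le> c * Tq * 1 * H"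
      using Tp z0 z1 H0 c Gq_pos Tm_nonneg[OF assms(1)] by (intro mult_right_mono mult_mono) auto
    finally have "H * (H - c * Tq) < 1" using c by (simp add: algebra_simps)
    moreover have "1 * 1 \<le> H * (H - c * Tq)"
      using h Gq_pos by (intro mult_mono) auto
    ultimately show False by simp
  qed
  have "H * (8 * Gq - 4 * c * Tq) \<le> (1 + c * Tq) * (8 * Gq)"
    using H0 H1 Gq_pos by (intro mult_mono) auto
  moreover have "4 * Gq * z p * (4 * Gq - c * (4 * Tq - T p)) \<ge> 4 * Gq * z p * (4 * Gq - 4 * c * Tq)"
    using Tp Gq_pos z0 by (intro mult_left_mono) (auto simp: algebra_simps)
  moreover have "N p \<le> C * z p" using assms by (intro cusp_fun_le_C) auto
  moreover have "(16 * Gq * (Gq - c * Tq) - C) * (3 / 5) \<le> (16 * Gq * (Gq - c * Tq) - C) * z p"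
  proof (rule mult_left_mono[OF assms(3)])
    have "8 * Gq * (1 + c * Tq) \<ge> 0" using Gq_pos by simp
    then have "0 < 3 / 5 * (16 * Gq * (Gq - c * Tq) - C)" using * by (rule le_less_trans)
    then show "16 * Gq * (Gq - c * Tq) - C \<ge> 0" by (simp add: zero_less_mult_iff)
  qed
  ultimately have "N (2 * pi - p) > 0"
    using * unfolding N_fourth H_def[symmetric] by (simp add: algebra_simps)
  then show ?thesis by (simp add: N_eq)
qed

lemma cusp_fun_2pi_neg: "cusp_fun b (2 * pi) < 0"
proof -
  have "N (2 * pi) = - d 0 * (8 * Gq - 4 * c * Tq)"
    using N_fourth[of 0] by (simp add: uv_0)
  moreover have "d 0 > 0" using mm_pos[OF b(2)] Del_pos[OF b(1), of 0] by (simp add: zd_def)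
  moreover have "8 * Gq - 4 * c * Tq > 0" using Gq_pos by simp
  ultimately show ?thesis by (simp add: N_eq)
qed

text \<open>G - z has time derivative 2 y^2, hence increases. The bound for G uses Del^2 = (1 + 2 b)
  cos^2 + 4 b sin^2 and subadditivity of the root. \<open>Tq\<close> diverges as b tends to 0, but
  it occurs multiplied by b^2, so the crude estimate of order b^(-1/2) from \<open>Del_ge\<close>
  suffices.\<close>

lemma quarter_bounds:
  shows "mm b \<le> Gq" "Gq \<le> sqrt (1 + 2 * b) + 2 * sqrt b" "0 \<le> b\<^sup>2 * Tq" "b\<^sup>2 * Tq \<le> pi / 4 * (b * sqrt b)"
    and Gm_minus_zz: "\<And>p. 0 \<le> p \<Longrightarrow> p \<le> pi / 2 \<Longrightarrow> 0 \<le> Gm b p - zz b p \<and> Gm b p - zz b p \<le> Gq - mm b"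
proof -
  have mono: "G p - z p \<le> G q - z q" if "p \<le> q" for p q
  proof (rule deriv_nonneg_mono[OF that, where f' = "\<lambda>t. 2 * (yy b t)\<^sup>2 * i t"])
    show "((\<lambda>p. G p - z p) has_real_derivative 2 * (yy b t)\<^sup>2 * i t) (at t)" for t
      by (rule DERIV_cong, (rule derivative_intros D)+)
         (use xx_yy(2,3)[OF b, of t] in algebra)
    show "0 \<le> 2 * (yy b t)\<^sup>2 * i t" for t
      using i[of t] by simp
  qed
  have zq: "z (pi / 2) = mm b" by (simp add: zz_def)
  show "0 \<le> G p - z p \<and> G p - z p \<le> Gq - mm b" if "0 \<le> p" "p \<le> pi / 2" for p
    using mono[OF that(1)] mono[OF that(2)] zq by simp
  from this[of "pi / 2"] show "mm b \<le> Gq" by (simp add: zq)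
  have sb: "0 < sqrt b" "(sqrt b)\<^sup>2 = b" using b by auto
  have Del_ge: "2 * sqrt b \<le> Del b p" for p
  proof (rule power2_le_imp_le)
    have "(2 * sqrt b)\<^sup>2 = 4 * b" using sb by (simp add: power_mult_distrib)
    moreover have "(Del b p)\<^sup>2 = 4 * b + (1 - 2 * b) * (cos p)\<^sup>2"
      unfolding Del_sq[OF b(1)] sin_squared_eq by (simp add: algebra_simps)
    ultimately show "(2 * sqrt b)\<^sup>2 \<le> (Del b p)\<^sup>2" using b by simp
  qed (use Del_pos[OF b(1), of p] in simp)
  have "(\<lambda>p. p / (2 * sqrt b) - T p) 0 \<le> (\<lambda>p. p / (2 * sqrt b) - T p) (pi / 2)"
  proof (rule deriv_nonneg_mono[where f = "\<lambda>p. p / (2 * sqrt b) - T p" and f' = "\<lambda>t. 1 / (2 * sqrt b) - i t"])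
    show "((\<lambda>p. p / (2 * sqrt b) - T p) has_real_derivative 1 / (2 * sqrt b) - i t) (at t)" for t
      by (intro DERIV_diff DERIV_cdivide DERIV_ident D)
    show "1 / (2 * sqrt b) - i t \<ge> 0" for t
      unfolding i_def using Del_ge[of t] sb Del_pos[OF b(1), of t] by (simp add: frac_le)
  qed simp
  then have "Tq \<le> pi / 2 / (2 * sqrt b)" by simp
  then have "b\<^sup>2 * Tq \<le> b\<^sup>2 * (pi / 2 / (2 * sqrt b))" by (intro mult_left_mono) auto
  also have "b\<^sup>2 * (pi / 2 / (2 * sqrt b)) = pi / 4 * (b * sqrt b)"
    using sb b by (simp add: field_simps power2_eq_square)
  finally show "b\<^sup>2 * Tq \<le> pi / 4 * (b * sqrt b)" .
  show T0: "0 \<le> b\<^sup>2 * Tq" using Tm_nonneg[of "pi/2"] by simp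
  have "(\<lambda>p. sqrt (1 + 2 * b) * sin p - 2 * sqrt b * cos p - prim (Del b) p) 0
      \<le> (\<lambda>p. sqrt (1 + 2 * b) * sin p - 2 * sqrt b * cos p - prim (Del b) p) (pi / 2)"
  proof (rule deriv_nonneg_mono[where f = "\<lambda>p. sqrt (1 + 2 * b) * sin p - 2 * sqrt b * cos p - prim (Del b) p"
        and f' = "\<lambda>t. sqrt (1 + 2 * b) * cos t + 2 * sqrt b * sin t - Del b t"])
    show "((\<lambda>p. sqrt (1 + 2 * b) * sin p - 2 * sqrt b * cos p - prim (Del b) p) has_real_derivative
      sqrt (1 + 2 * b) * cos t + 2 * sqrt b * sin t - Del b t) (at t)" for t
      by (auto intro!: derivative_eq_intros prim_deriv continuous_on_Del)
    fix t assume t: "0 \<le> t" "t \<le> pi / 2"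
    have sc: "cos t \<ge> 0" "sin t \<ge> 0" using t cos_ge_zero[of t] sin_ge_zero[of t] by auto
    have "Del b t \<le> sqrt (1 + 2 * b) * cos t + 2 * sqrt b * sin t"
    proof (rule power2_le_imp_le)
      have "(Del b t)\<^sup>2 = (1 + 2 * b) * (cos t)\<^sup>2 + 4 * b * (sin t)\<^sup>2"
        unfolding Del_sq[OF b(1)] sin_squared_eq by (simp add: algebra_simps)
      also have "\<dots> = (sqrt (1 + 2 * b) * cos t)\<^sup>2 + (2 * sqrt b * sin t)\<^sup>2"
        using b by (simp add: power_mult_distrib)
      also have "\<dots> \<le> (sqrt (1 + 2 * b) * cos t + 2 * sqrt b * sin t)\<^sup>2"
        unfolding power2_sum using b sc by (simp add: mult_nonneg_nonneg)
      finally show "(Del b t)\<^sup>2 \<le> (sqrt (1 + 2 * b) * cos t + 2 * sqrt b * sin t)\<^sup>2" .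
    qed (use sc b in auto)
    then show "sqrt (1 + 2 * b) * cos t + 2 * sqrt b * sin t - Del b t \<ge> 0" by simp
  qed simp
  then have "prim (Del b) (pi / 2) \<le> sqrt (1 + 2 * b) + 2 * sqrt b" by simp
  moreover have "Gq \<le> prim (Del b) (pi / 2)"
    using Tm_nonneg[of "pi/2"] b by (simp add: Gm_def)
  ultimately show "Gq \<le> sqrt (1 + 2 * b) + 2 * sqrt b" by simp
qed

end

lemma eventually_b: "\<forall>\<^sub>F b in at_right (0::real). b > 0 \<and> b < 1 / 2"
  by (rule eventually_at_rightI[of 0 "1/2"]) auto

lemma quarter_limits:
  "(mm \<longlongrightarrow> 1) (at_right 0)" "((\<lambda>b. Gm b (pi / 2)) \<longlongrightarrow> 1) (at_right 0)"
  "((\<lambda>b. b\<^sup>2 * Tm b (pi / 2)) \<longlongrightarrow> 0) (at_right 0)"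
proof -
  have "((\<lambda>b. sqrt (1 - 2 * b)) \<longlongrightarrow> sqrt (1 - 2 * 0)) (at_right 0)"
    by (intro tendsto_intros)
  then show m: "(mm \<longlongrightarrow> 1) (at_right 0)"
    unfolding mm_def[abs_def] by simp
  have "((\<lambda>b. sqrt (1 + 2 * b) + 2 * sqrt b) \<longlongrightarrow> sqrt (1 + 2 * 0) + 2 * sqrt 0) (at_right 0)"
    by (intro tendsto_intros)
  then have u: "((\<lambda>b. sqrt (1 + 2 * b) + 2 * sqrt b) \<longlongrightarrow> 1) (at_right 0)" by simp
  show "((\<lambda>b. Gm b (pi / 2)) \<longlongrightarrow> 1) (at_right 0)"
    by (rule tendsto_sandwich[OF _ _ m u]; rule eventually_mono[OF eventually_b]) (simp_all add: quarter_bounds)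
  have "((\<lambda>b. pi / 4 * (b * sqrt b)) \<longlongrightarrow> pi / 4 * (0 * sqrt 0)) (at_right 0)"
    by (intro tendsto_intros)
  then have u: "((\<lambda>b. pi / 4 * (b * sqrt b)) \<longlongrightarrow> 0) (at_right 0)" by simp
  show "((\<lambda>b. b\<^sup>2 * Tm b (pi / 2)) \<longlongrightarrow> 0) (at_right 0)"
    by (rule tendsto_sandwich[OF _ _ tendsto_const u]; rule eventually_mono[OF eventually_b]) (use quarter_bounds in auto)
qed

section \<open>The last part of the period for small parameter\<close>

text \<open>\<open>1 - 4 b\<^sup>2\<close> times the \<open>D\<close>-derivative of \<open>cusp_fun\<close>, as a polynomial in
  \<open>z\<close>, \<open>z'\<close>, \<open>G\<close>, \<open>u = 4 b\<^sup>2 t\<close> and \<open>c = 4 b\<^sup>2\<close>.\<close>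

definition cusp_fun_slope :: "real \<Rightarrow> real \<Rightarrow> real \<Rightarrow> real \<Rightarrow> real \<Rightarrow> real" where
  "cusp_fun_slope z d G u c =
    - 4 * u * (d + z * G) * (1 - c)
    + u * (- 2 * d * (1 - c) - 2 * (u * z - (d + z * G)) * (1 - z * z)
        + (c * z + u * d - d * G + z * (1 - z * z)) * G - z * (G * (1 - c) + z * (u * z - (d + z * G))))
    + (2 - 3 * z * z - G * G) * (c * z + u * d - d * G + z * (1 - z * z))
    - 2 * G * (- 2 * d * (1 - c) - 2 * (u * z - (d + z * G)) * (1 - z * z))
    + 2 * (d + z * G) * (G * (1 - c) + z * (u * z - (d + z * G)))"

lemma cusp_fun_deriv_b:
  assumes b: "b > 0" "b < 1 / 2" and r: "r \<ge> 0" and p: "p = phase b r"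
  shows "((\<lambda>b. cusp_fun b (phase b r)) has_real_derivative
    - cusp_fun_slope (zz b p) (zd b p) (Gm b p) (4 * b\<^sup>2 * Tm b p) (4 * b\<^sup>2) / (2 * b * (1 - 4 * b\<^sup>2))) (at b)"
proof -
  define k where "k = 1 - 4 * b\<^sup>2"
  define j where "j = 1 / (2 * b)"
  define z where "z = zz b p"
  define d where "d = zd b p"
  define G where "G = Gm b p"
  define w where "w = ww b p"
  define q where "q = zw b p"
  have Tr: "Tm b p = r" using b by (simp add: p)
  have k: "k > 0" using one_minus_4b2_pos[OF b] by (simp add: k_def)
  have j: "2 * b * j = 1" using b by (simp add: j_def)
  have kw: "k * w = 4 * b * b * r * z - (d + z * G)"
    using k unfolding w_def ww_def Tr k_def[symmetric] HH_def z_def[symmetric] d_def[symmetric] G_def[symmetric]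
    by (simp add: power2_eq_square)
  have kq: "k * q = 4 * b * b * (z + r * d) - d * G + z * (1 - z * z)"
    using k unfolding q_def zw_def Tr k_def[symmetric] z_def[symmetric] d_def[symmetric] G_def[symmetric]
    by (simp add: power2_eq_square)
  have h: "v / (2 * b) = v * j" "v / b = 2 * v * j" for v by (simp_all add: j_def)
  have D: "((\<lambda>b. zz b (phase b r)) has_real_derivative - q * j) (at b)"
    "((\<lambda>b. zd b (phase b r)) has_real_derivative 2 * (d + w * (1 - z * z)) * j) (at b)"
    "((\<lambda>b. Gm b (phase b r)) has_real_derivative (G + z * w) * j) (at b)"
    using zz_deriv_b[OF b r p] zd_deriv_b[OF b r p] Gm_deriv_b_phase[OF b r p]
    unfolding h by (simp_all add: q_def d_def w_def z_def G_def power2_eq_square mult.commute[of _ j])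
  have Dz: "zz b (phase b r) = z" "zd b (phase b r) = d" "Gm b (phase b r) = G"
    by (simp_all add: z_def d_def G_def p)
  let ?N = "\<lambda>b. 4 * (b * b) * r * (zd b (phase b r) + zz b (phase b r) * Gm b (phase b r)) + 2 * zz b (phase b r)
    - zz b (phase b r) * zz b (phase b r) * zz b (phase b r) - 2 * zd b (phase b r) * Gm b (phase b r)
    - zz b (phase b r) * (Gm b (phase b r) * Gm b (phase b r))"
  define z' d' G' where "z' = - q * j" and "d' = 2 * (d + w * (1 - z * z)) * j" and "G' = (G + z * w) * j"
  have N': "(?N has_real_derivative
      8 * b * r * (d + z * G) + 4 * b * b * r * (d' + z' * G + z * G') + 2 * z' - 3 * z * z * z'
      - 2 * d' * G - 2 * d * G' - z' * G * G - 2 * z * G * G') (at b)"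
    by (rule DERIV_cong, (rule derivative_intros D[folded z'_def d'_def G'_def])+) (unfold Dz, algebra)
  \<comment> \<open>The factor \<open>2 * b * k\<close> clears the denominators of
    \<open>ww\<close>, \<open>zw\<close> and of d/db, which turns the claim into a polynomial
    identity.\<close>
  have "(8 * b * r * (d + z * G) + 4 * b * b * r * (d' + z' * G + z * G') + 2 * z' - 3 * z * z * z'
      - 2 * d' * G - 2 * d * G' - z' * G * G - 2 * z * G * G') * (2 * b * k)
     = - cusp_fun_slope z d G (4 * b\<^sup>2 * r) (4 * b\<^sup>2)"
  proof -
    have 1: "z' * (2 * b * k) = - (k * q)" "d' * (2 * b * k) = 2 * (d * k + (k * w) * (1 - z * z))"
      "G' * (2 * b * k) = G * k + z * (k * w)"
      unfolding z'_def d'_def G'_def using j by algebra+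
    have "(8 * b * r * (d + z * G) + 4 * b * b * r * (d' + z' * G + z * G') + 2 * z' - 3 * z * z * z'
      - 2 * d' * G - 2 * d * G' - z' * G * G - 2 * z * G * G') * (2 * b * k)
      = 16 * b * b * r * (d + z * G) * k + 4 * b * b * r * (d' * (2 * b * k) + z' * (2 * b * k) * G + z * (G' * (2 * b * k)))
        + (2 - 3 * z * z - G * G) * (z' * (2 * b * k)) - 2 * G * (d' * (2 * b * k)) - 2 * (d + z * G) * (G' * (2 * b * k))"
      by algebra
    also have "\<dots> = - cusp_fun_slope z d G (4 * b\<^sup>2 * r) (4 * b\<^sup>2)"
      unfolding 1 kw kq unfolding k_def cusp_fun_slope_def by algebra
    finally show ?thesis .
  qed
  then have eq: "8 * b * r * (d + z * G) + 4 * b * b * r * (d' + z' * G + z * G') + 2 * z' - 3 * z * z * z'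
      - 2 * d' * G - 2 * d * G' - z' * G * G - 2 * z * G * G'
     = - cusp_fun_slope z d G (4 * b\<^sup>2 * r) (4 * b\<^sup>2) / (2 * b * k)"
    using b k by (subst nonzero_eq_divide_eq) simp_all
  from N'[unfolded eq] have "(?N has_real_derivative
    - cusp_fun_slope (zz b p) (zd b p) (Gm b p) (4 * b\<^sup>2 * Tm b p) (4 * b\<^sup>2) / (2 * b * (1 - 4 * b\<^sup>2))) (at b)"
    by (simp add: Tr z_def d_def G_def k_def)
  then show ?thesis
    by (rule has_field_derivative_transform_within_open[where S = "{0<..<1/2}"])
       (use b in \<open>auto simp: cusp_fun_def HH_def power2_eq_square power3_eq_cube\<close>)
qed

lemma cusp_fun_slope_limit: "cusp_fun_slope (- z) (1 - z * z) (4 - z) 0 0 = 64 * (1 - z * z)"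
  unfolding cusp_fun_slope_def by algebra

text \<open>The quantity is 2 y^2, and y \<le> x on the first quarter gives y^2 \<le> x y = b. It
  measures the deviation from the separatrix relation z' = 1 - z^2.\<close>

lemma yy_sq_le:
  assumes "b > 0" "b < 1 / 2" "0 \<le> s" "s \<le> pi / 2"
  shows "0 \<le> 1 - (zz b s)\<^sup>2 - zd b s" "1 - (zz b s)\<^sup>2 - zd b s \<le> 2 * b"
proof -
  have e: "1 - (zz b s)\<^sup>2 - zd b s = 2 * (yy b s)\<^sup>2"
    using xx_yy(2,3)[OF assms(1,2), of s] by simp
  show "0 \<le> 1 - (zz b s)\<^sup>2 - zd b s" unfolding e by simp
  have "yy b s \<le> xx b s"
    using mm_pos[OF assms(2)] cos_ge_zero[of s] assms by (simp add: xx_def yy_def)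
  then have "yy b s * yy b s \<le> xx b s * yy b s"
    using xx_yy_pos[OF assms(1,2), of s] by (intro mult_right_mono) auto
  then show "1 - (zz b s)\<^sup>2 - zd b s \<le> 2 * b"
    unfolding e xx_yy(1)[OF assms(1,2)] by (simp add: power2_eq_square)
qed

text \<open>For small \<open>b\<close> the orbit near the end of a period is a small perturbation of the
  separatrix \<open>z = - tanh s\<close>, along which \<open>z' = 1 - z\<^sup>2\<close> and \<open>G = 4 + z\<close>.\<close>

lemma separatrix_perturbation:
  fixes f :: "real \<times> real \<times> real \<times> real \<times> real \<Rightarrow> real"
  assumes cont: "continuous_on UNIV f" and pos: "\<And>z. 0 \<le> z \<Longrightarrow> z \<le> 3 / 5 \<Longrightarrow> f (z, 0, 0, 0, 0) > 0"
  shows "\<forall>\<^sub>F b in at_right 0. \<forall>s. 0 \<le> s \<and> s \<le> pi / 2 \<and> zz b s \<le> 3 / 5 \<longrightarrow>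
    f (zz b s, 1 - (zz b s)\<^sup>2 - zd b s, Gm b (2 * pi - s) - 4 + zz b s,
       4 * b\<^sup>2 * Tm b (2 * pi - s), 4 * b\<^sup>2) > 0"
proof -
  \<comment> \<open>Compactness makes positivity uniform: \<open>?K\<close> is the separatrix
    segment with all four deviations zero, and a whole neighbourhood of width e stays inside f > 0.
    It then suffices that each deviation is below e / 4.\<close>
  let ?K = "{0..3/5} \<times> {(0, 0, 0, 0)} :: (real \<times> real \<times> real \<times> real \<times> real) set"
  have "open {x. f x > 0}"
    using open_Collect_less[OF continuous_on_const cont] .
  moreover have "compact ?K" by (intro compact_Times) auto
  moreover have "?K \<subseteq> {x. f x > 0}" using pos by auto
  moreover have "?K \<noteq> {}" by simp
  ultimately obtain e where e: "e > 0" "{x. infdist x ?K \<le> e} \<subseteq> {x. f x > 0}"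
    using compact_in_open_separated by metis
  have near: "f (z, d1, d2, d3, d4) > 0"
    if "0 \<le> z" "z \<le> 3 / 5" "\<bar>d1\<bar> \<le> e / 4" "\<bar>d2\<bar> \<le> e / 4" "\<bar>d3\<bar> \<le> e / 4" "\<bar>d4\<bar> \<le> e / 4" for z d1 d2 d3 d4
  proof -
    have "infdist (z, d1, d2, d3, d4) ?K \<le> dist (z, d1, d2, d3, d4) (z, 0, 0, 0, 0)"
      by (rule infdist_le) (use that in auto)
    also have "\<dots> = norm (0 :: real, d1, d2, d3, d4)" by (simp add: dist_norm)
    also have "\<dots> \<le> norm d1 + (norm d2 + (norm d3 + norm d4))"
      using norm_Pair_le[of "0 :: real" "(d1, d2, d3, d4)"] norm_Pair_le[of d1 "(d2, d3, d4)"]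
        norm_Pair_le[of d2 "(d3, d4)"] norm_Pair_le[of d3 d4] by simp
    also have "\<dots> \<le> e" using that by simp
    finally show ?thesis using e(2) by auto
  qed
  have "((\<lambda>b. 2 * b) \<longlongrightarrow> 2 * 0) (at_right (0::real))"
    "((\<lambda>b. 4 * \<bar>Gm b (pi/2) - 1\<bar> + (Gm b (pi/2) - mm b)) \<longlongrightarrow> 4 * \<bar>1 - 1\<bar> + (1 - 1)) (at_right 0)"
    "((\<lambda>b. 16 * (b\<^sup>2 * Tm b (pi/2))) \<longlongrightarrow> 16 * 0) (at_right 0)"
    "((\<lambda>b. 4 * b\<^sup>2) \<longlongrightarrow> 4 * 0\<^sup>2) (at_right (0::real))"
    by (intro tendsto_intros quarter_limits)+
  then have "\<forall>\<^sub>F b in at_right (0::real). 2 * b < e / 4"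
    "\<forall>\<^sub>F b in at_right 0. 4 * \<bar>Gm b (pi/2) - 1\<bar> + (Gm b (pi/2) - mm b) < e / 4"
    "\<forall>\<^sub>F b in at_right 0. 16 * (b\<^sup>2 * Tm b (pi/2)) < e / 4"
    "\<forall>\<^sub>F b in at_right (0::real). 4 * b\<^sup>2 < e / 4"
    using e(1) by (auto dest!: order_tendstoD(2)[where a = "e / 4"])
  with eventually_b show ?thesis
  proof eventually_elim
    case (elim b)
    then have b: "b > 0" "b < 1 / 2" by auto
    show ?case
    proof (intro allI impI)
      fix s assume s: "0 \<le> s \<and> s \<le> pi / 2 \<and> zz b s \<le> 3 / 5"
      then have s1: "0 \<le> s" and s2: "s \<le> pi / 2" by auto
      show "f (zz b s, 1 - (zz b s)\<^sup>2 - zd b s, Gm b (2 * pi - s) - 4 + zz b s,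
       4 * b\<^sup>2 * Tm b (2 * pi - s), 4 * b\<^sup>2) > 0"
      proof (rule near)
        show "0 \<le> zz b s" using zz_nonneg[OF b, of s] s by simp
        show "zz b s \<le> 3 / 5" using s by simp
        show "\<bar>1 - (zz b s)\<^sup>2 - zd b s\<bar> \<le> e / 4"
          using yy_sq_le[OF b s1 s2] elim by linarith
        show "\<bar>Gm b (2 * pi - s) - 4 + zz b s\<bar> \<le> e / 4"
          unfolding Gm_symm[OF b]
        proof (rule abs_leI)
          have "Gm b (pi/2) - 1 \<le> \<bar>Gm b (pi/2) - 1\<bar>" "- (Gm b (pi/2) - 1) \<le> \<bar>Gm b (pi/2) - 1\<bar>"
            by simp_all
          note * = this Gm_minus_zz[OF b s1 s2, THEN conjunct1] Gm_minus_zz[OF b s1 s2, THEN conjunct2] elim(3)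
          show "4 * Gm b (pi / 2) - Gm b s - 4 + zz b s \<le> e / 4"
            using * by argo
          show "- (4 * Gm b (pi / 2) - Gm b s - 4 + zz b s) \<le> e / 4"
            using * by argo
        qed
        have "0 \<le> 4 * b\<^sup>2 * Tm b (2 * pi - s)" using Tm_nonneg[OF b, of "2 * pi - s"] s pi_gt_zero by simp
        moreover have "4 * b\<^sup>2 * Tm b (2 * pi - s) \<le> 4 * b\<^sup>2 * (4 * Tm b (pi / 2))"
          using Tm_nonneg[OF b, of s] s unfolding Tm_symm[OF b] by (intro mult_left_mono) auto
        moreover have "4 * b\<^sup>2 * (4 * Tm b (pi / 2)) = 16 * (b\<^sup>2 * Tm b (pi / 2))" by simp
        ultimately show "\<bar>4 * b\<^sup>2 * Tm b (2 * pi - s)\<bar> \<le> e / 4"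
          using elim(4) unfolding abs_of_nonneg[OF \<open>0 \<le> 4 * b\<^sup>2 * Tm b (2 * pi - s)\<close>] by argo
        show "\<bar>4 * b\<^sup>2\<bar> \<le> e / 4" using elim by simp
      qed
    qed
  qed
qed

section \<open>Estimates on the last stretch\<close>

lemma eventually_cusp_fun_decreasing:
  "\<forall>\<^sub>F b in at_right 0. \<forall>s. 0 \<le> s \<and> s \<le> pi / 2 \<and> zz b s \<le> 3 / 5 \<longrightarrow>
    cusp_fun_slope (zz b (2 * pi - s)) (zd b (2 * pi - s)) (Gm b (2 * pi - s)) (4 * b\<^sup>2 * Tm b (2 * pi - s)) (4 * b\<^sup>2) > 0"
proof -
  define f :: "real \<times> real \<times> real \<times> real \<times> real \<Rightarrow> real" where
    "f = (\<lambda>x. cusp_fun_slope (- fst x) (1 - fst x * fst x - fst (snd x)) (4 - fst x + fst (snd (snd x)))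
       (fst (snd (snd (snd x)))) (snd (snd (snd (snd x)))))"
  have "continuous_on UNIV f"
    unfolding f_def cusp_fun_slope_def by (intro continuous_intros)
  moreover have "f (z, 0, 0, 0, 0) > 0" if "0 \<le> z" "z \<le> 3 / 5" for z
  proof -
    have "z * z \<le> 3 / 5 * (3 / 5)" using that by (intro mult_mono) auto
    then show ?thesis by (simp add: f_def cusp_fun_slope_limit)
  qed
  ultimately have "\<forall>\<^sub>F b in at_right 0. \<forall>s. 0 \<le> s \<and> s \<le> pi / 2 \<and> zz b s \<le> 3 / 5 \<longrightarrow>
    f (zz b s, 1 - (zz b s)\<^sup>2 - zd b s, Gm b (2 * pi - s) - 4 + zz b s,
       4 * b\<^sup>2 * Tm b (2 * pi - s), 4 * b\<^sup>2) > 0"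
    by (rule separatrix_perturbation)
  then show ?thesis using eventually_b
    by eventually_elim (simp add: f_def zz_symm zd_symm power2_eq_square)
qed

text \<open>Squared, with x^2 written through z and the first deviation. In the limit it rests on (4
  - 2 z)^2 \<le> 16 (1 - z^2), true exactly for z between 0 and 4/5, with equality at both ends; the
  surplus \<open>e\<close> makes the inequality strict at z = 0.\<close>

lemma eventually_a_bound:
  assumes "e > 0"
  shows "\<forall>\<^sub>F b in at_right 0. \<forall>s. 0 \<le> s \<and> s \<le> pi / 2 \<and> zz b s \<le> 3 / 5 \<longrightarrow>
    Gm b (2 * pi - s) + zz b (2 * pi - s) < 2 * (2 + e) * xx b (2 * pi - s)"
proof -
  define f :: "real \<times> real \<times> real \<times> real \<times> real \<Rightarrow> real" where
    "f = (\<lambda>x. (2 * (2 + e))\<^sup>2 * (1 - (fst x)\<^sup>2 - fst (snd x) / 2) - (4 - 2 * fst x + fst (snd (snd x)))\<^sup>2)"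
  have "continuous_on UNIV f"
    unfolding f_def by (intro continuous_intros) simp
  moreover have "f (z, 0, 0, 0, 0) > 0" if z: "0 \<le> z" "z \<le> 3 / 5" for z
  proof -
    have zz: "z * z \<le> 3 / 5 * z" "z * z \<le> 3 / 5 * (3 / 5)" using z by (intro mult_mono; simp)+
    have "(2 * (2 + e))\<^sup>2 > 16" using assms by (simp add: power2_eq_square algebra_simps add_pos_pos)
    then have "(2 * (2 + e))\<^sup>2 * (1 - z * z) > 16 * (1 - z * z)"
      using zz by (intro mult_strict_right_mono) auto
    moreover have "16 * (1 - z * z) \<ge> (4 - 2 * z)\<^sup>2"
      using zz z by (simp add: power2_eq_square algebra_simps)
    ultimately show ?thesis by (simp add: f_def power2_eq_square[of z])
  qed
  ultimately have "\<forall>\<^sub>F b in at_right 0. \<forall>s. 0 \<le> s \<and> s \<le> pi / 2 \<and> zz b s \<le> 3 / 5 \<longrightarrow>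
    f (zz b s, 1 - (zz b s)\<^sup>2 - zd b s, Gm b (2 * pi - s) - 4 + zz b s,
       4 * b\<^sup>2 * Tm b (2 * pi - s), 4 * b\<^sup>2) > 0"
    by (rule separatrix_perturbation)
  then show ?thesis using eventually_b
  proof eventually_elim
    case (elim b)
    then have b: "b > 0" "b < 1 / 2" by auto
    show ?case
    proof (intro allI impI)
      fix s assume s: "0 \<le> s \<and> s \<le> pi / 2 \<and> zz b s \<le> 3 / 5"
      have "(xx b s)\<^sup>2 = 1 - (zz b s)\<^sup>2 - (1 - (zz b s)\<^sup>2 - zd b s) / 2"
        using xx_yy(2,3)[OF b, of s] by (simp add: field_simps)
      moreover have "f (zz b s, 1 - (zz b s)\<^sup>2 - zd b s, Gm b (2 * pi - s) - 4 + zz b s,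
         4 * b\<^sup>2 * Tm b (2 * pi - s), 4 * b\<^sup>2) > 0" using elim(1) s by blast
      ultimately have "(Gm b (2 * pi - s) + zz b (2 * pi - s))\<^sup>2 < (2 * (2 + e) * xx b (2 * pi - s))\<^sup>2"
        unfolding f_def zz_symm(2)[OF b] xx_symm[OF b] power_mult_distrib[of "2 * (2 + e)"] by simp
      then show "Gm b (2 * pi - s) + zz b (2 * pi - s) < 2 * (2 + e) * xx b (2 * pi - s)"
        by (rule power2_less_imp_less) (use assms xx_yy_pos[OF b, of "2 * pi - s"] in simp)
    qed
  qed
qed

text \<open>Since x' = - x z and z \<le> 1, the product of x and exp t does not decrease; compare
  the start, where x is at least \<open>mm b\<close>, with the quarter period, where x = sqrt b.
  This yields both the bound on b_r and the unboundedness of the period.\<close>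

lemma exp_quarter_ge:
  assumes b: "b > 0" "b < 1 / 2"
  shows "(mm b)\<^sup>2 \<le> b * exp (2 * Tm b (pi / 2))"
proof -
  have z1: "zz b t \<le> 1" for t
  proof -
    have "(zz b t)\<^sup>2 \<le> 1\<^sup>2"
      using xx_yy(2)[OF b, of t] zero_le_power2[of "xx b t"] zero_le_power2[of "yy b t"]
      unfolding one_power2 by linarith
    then show ?thesis by (rule power2_le_imp_le) simp
  qed
  have "(\<lambda>p. xx b p * exp (Tm b p)) 0 \<le> (\<lambda>p. xx b p * exp (Tm b p)) (pi / 2)"
  proof (rule deriv_nonneg_mono[where f = "\<lambda>p. xx b p * exp (Tm b p)"
        and f' = "\<lambda>t. xx b t * (1 - zz b t) / Del b t * exp (Tm b t)"])
    fix t
    have D: "Del b t > 0" by (rule Del_pos[OF b(1)])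
    show "((\<lambda>p. xx b p * exp (Tm b p)) has_real_derivative xx b t * (1 - zz b t) / Del b t * exp (Tm b t)) (at t)"
      using D by (auto intro!: derivative_eq_intros xx_deriv[OF b] Tm_deriv[OF b(1)] simp: field_simps)
    show "0 \<le> xx b t * (1 - zz b t) / Del b t * exp (Tm b t)"
      using D z1[of t] xx_yy_pos[OF b, of t] by simp
  qed simp
  then have le: "xx b 0 \<le> xx b (pi / 2) * exp (Tm b (pi / 2))" by simp
  have "mm b \<le> Del b 0"
    using b by (simp add: mm_def Del_def)
  then have "mm b \<le> xx b 0" by (simp add: xx_def)
  then have "(mm b)\<^sup>2 \<le> (xx b (pi / 2) * exp (Tm b (pi / 2)))\<^sup>2"
    using le mm_pos[OF b(2)] by (intro power_mono) auto
  also have "\<dots> = (xx b (pi / 2))\<^sup>2 * exp (2 * Tm b (pi / 2))"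
    by (simp add: power_mult_distrib flip: exp_double)
  also have "(xx b (pi / 2))\<^sup>2 = b"
    using Del_sq[OF b(1), of "pi / 2"] by (simp add: xx_def power_divide)
  finally show ?thesis .
qed

text \<open>While z \<le> 3/5, z' is at least 1 - 9/25 - 2 b, hence at least 3/5 for b \<le> 1/50,
  so reaching the height z \<le> 3/5 takes time at most 1.\<close>

lemma Tm_le_1:
  assumes b: "b > 0" "b \<le> 1 / 50" and s: "0 \<le> s" "s \<le> pi / 2" "zz b s \<le> 3 / 5"
  shows "Tm b s \<le> 1"
proof -
  have b': "b < 1 / 2" using b by simp
  have "(\<lambda>p. zz b p - 3 / 5 * Tm b p) 0 \<le> (\<lambda>p. zz b p - 3 / 5 * Tm b p) s"
  proof (rule deriv_nonneg_mono[OF s(1), where f = "\<lambda>p. zz b p - 3 / 5 * Tm b p"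
        and f' = "\<lambda>t. (zd b t - 3 / 5) / Del b t"])
    fix t
    have D: "Del b t > 0" by (rule Del_pos[OF b(1)])
    show "((\<lambda>p. zz b p - 3 / 5 * Tm b p) has_real_derivative (zd b t - 3 / 5) / Del b t) (at t)"
      using D by (auto intro!: derivative_eq_intros zz_deriv[OF b(1)] Tm_deriv[OF b(1)] simp: field_simps)
    assume t: "0 \<le> t" "t \<le> s"
    have "sin t \<le> sin s" using t s by (intro sin_monotone_2pi_le) auto
    then have "zz b t \<le> zz b s" using mm_pos[OF b'] by (simp add: zz_def)
    then have "zz b t * zz b t \<le> 3 / 5 * (3 / 5)"
      using s zz_nonneg[OF b(1) b', of t] t by (intro mult_mono) auto
    then have "zd b t \<ge> 3 / 5"
      using yy_sq_le[OF b(1) b', of t] t s b by (simp add: power2_eq_square)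
    then show "0 \<le> (zd b t - 3 / 5) / Del b t" using D by simp
  qed
  then show ?thesis using s by simp
qed

text \<open>The numerator G - z is at most 4 Gq, close to 4. For the denominator, y \<ge> b because
  x \<le> 1, and b exp (2 Tq) is nearly at least 1, while 2 Tq is half of the elapsed plus the
  remaining time, the latter being at most 1. All comes down to 4 < exp (3/2).\<close>

lemma eventually_b_bound:
  "\<forall>\<^sub>F b in at_right 0. \<forall>s. 0 \<le> s \<and> s \<le> pi / 2 \<and> zz b s \<le> 3 / 5 \<longrightarrow>
    Gm b (2 * pi - s) - zz b (2 * pi - s) < exp 2 * exp (Tm b (2 * pi - s) / 2) * yy b (2 * pi - s)"
proof -
  have "\<forall>\<^sub>F b in at_right 0. mm b > 99/100" "\<forall>\<^sub>F b in at_right 0. Gm b (pi/2) < 101/100"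
    "\<forall>\<^sub>F b in at_right (0::real). b < 1 / 50"
    using order_tendstoD(1)[OF quarter_limits(1), of "99/100"] order_tendstoD(2)[OF quarter_limits(2), of "101/100"]
    by (auto intro: eventually_at_rightI[of 0 "1/50"])
  with eventually_b show ?thesis
  proof eventually_elim
    case (elim b)
    then have b: "b > 0" "b < 1 / 2" by auto
    show ?case
    proof (intro allI impI)
      fix s assume s: "0 \<le> s \<and> s \<le> pi / 2 \<and> zz b s \<le> 3 / 5"
      let ?p = "2 * pi - s"
      have x1: "xx b ?p \<le> 1"
      proof (rule power2_le_imp_le)
        show "(xx b ?p)\<^sup>2 \<le> 1\<^sup>2" using xx_yy(2)[OF b, of ?p] zero_le_power2[of "zz b ?p"] zero_le_power2[of "yy b ?p"]
          unfolding one_power2 by linarith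
      qed simp
      have xpos: "xx b ?p > 0" "yy b ?p > 0" using xx_yy_pos[OF b] by auto
      have "b = xx b ?p * yy b ?p" using xx_yy(1)[OF b] by simp
      also have "\<dots> \<le> 1 * yy b ?p" using x1 xpos by (intro mult_right_mono) auto
      finally have yb: "b \<le> yy b ?p" by simp
      have G: "Gm b ?p - zz b ?p < 101/25"
        using Gm_minus_zz[OF b, of s] s elim unfolding Gm_symm[OF b] zz_symm[OF b] by simp
      have T: "2 * Tm b (pi / 2) \<le> Tm b ?p / 2 + 1 / 2"
        using Tm_le_1[of b s] s elim unfolding Tm_symm[OF b] by (simp add: field_simps)
      have m: "(mm b)\<^sup>2 > (99/100)\<^sup>2" using elim by (intro power_strict_mono) auto
      \<comment> \<open>13/8 is the quadratic Taylor value of exp (1/2); its cube, about 4.29,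
        leaves room for the 1 percent margins in \<open>mm b\<close> and Gq.\<close>
      have "exp (1/2 :: real) \<ge> 1 + 1/2 + (1/2)\<^sup>2 / 2" by (rule exp_lower_Taylor_quadratic) simp
      then have "exp (1/2 :: real) ^ 3 \<ge> (13/8) ^ 3" by (intro power_mono) (auto simp: power2_eq_square)
      then have e3: "exp (3/2 :: real) \<ge> (13/8) ^ 3"
        by (simp flip: exp_of_nat_mult)
      have "Gm b ?p - zz b ?p < 101/25" by (rule G)
      also have "(101/25 :: real) \<le> (13/8) ^ 3 * (99/100)\<^sup>2" by (simp add: power2_eq_square power3_eq_cube)
      also have "\<dots> \<le> exp (3/2) * (b * exp (2 * Tm b (pi / 2)))"
        using e3 m exp_quarter_ge[OF b] by (intro mult_mono) auto
      also have "\<dots> \<le> exp (3/2) * (yy b ?p * exp (Tm b ?p / 2 + 1 / 2))"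
        using T yb b by (intro mult_left_mono mult_mono) auto
      also have "\<dots> = exp 2 * exp (Tm b ?p / 2) * yy b ?p"
        by (simp add: mult_ac flip: exp_add)
      finally show "Gm b ?p - zz b ?p < exp 2 * exp (Tm b ?p / 2) * yy b ?p" .
    qed
  qed
qed

text \<open>Combines the positivity results on all earlier parts of the period; their two hypotheses
  tend to 0 < 4 and 8 < 48/5.\<close>

lemma eventually_cusp_fun_nonpos:
  "\<forall>\<^sub>F b in at_right 0. \<forall>p. 0 < p \<and> p \<le> 2 * pi \<and> cusp_fun b p \<le> 0 \<longrightarrow>
     (\<exists>s. p = 2 * pi - s \<and> 0 \<le> s \<and> s \<le> pi / 2 \<and> zz b s \<le> 3 / 5)"
proof -
  let ?G = "\<lambda>b. Gm b (pi / 2)" and ?T = "\<lambda>b. b\<^sup>2 * Tm b (pi / 2)"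
  have "((\<lambda>b. 2 * ?G b * (2 * ?G b - 12 * ?T b) - (4 * ?T b * ?G b + 2 - (mm b)\<^sup>2 - (?G b)\<^sup>2)) \<longlongrightarrow>
      2 * 1 * (2 * 1 - 12 * 0) - (4 * 0 * 1 + 2 - 1\<^sup>2 - 1\<^sup>2)) (at_right 0)"
    "((\<lambda>b. 3 / 5 * (16 * ?G b * (?G b - 4 * ?T b) - (4 * ?T b * ?G b + 2 - (mm b)\<^sup>2 - (?G b)\<^sup>2))
         - 8 * ?G b * (1 + 4 * ?T b)) \<longlongrightarrow>
      3 / 5 * (16 * 1 * (1 - 4 * 0) - (4 * 0 * 1 + 2 - 1\<^sup>2 - 1\<^sup>2)) - 8 * 1 * (1 + 4 * 0)) (at_right 0)"
    by (intro tendsto_intros quarter_limits)+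
  then have "\<forall>\<^sub>F b in at_right 0. 0 < 2 * ?G b * (2 * ?G b - 12 * ?T b) - (4 * ?T b * ?G b + 2 - (mm b)\<^sup>2 - (?G b)\<^sup>2)"
    "\<forall>\<^sub>F b in at_right 0. 0 < 3 / 5 * (16 * ?G b * (?G b - 4 * ?T b) - (4 * ?T b * ?G b + 2 - (mm b)\<^sup>2 - (?G b)\<^sup>2))
         - 8 * ?G b * (1 + 4 * ?T b)"
    by (auto dest!: order_tendstoD(1)[where a = 0])
  with eventually_b show ?thesis
  proof eventually_elim
    case (elim b)
    then have b: "b > 0" "b < 1 / 2" by auto
    show ?case
    proof (intro allI impI)
      fix p assume p: "0 < p \<and> p \<le> 2 * pi \<and> cusp_fun b p \<le> 0"
      have "p > pi" using cusp_fun_pos_first_half[OF b, of p] p by force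
      have "p > pi + pi / 2"
      proof (rule ccontr)
        assume "\<not> p > pi + pi / 2"
        then have "cusp_fun b (pi + (p - pi)) > 0"
          using \<open>p > pi\<close> elim(2) by (intro cusp_fun_pos_third_quarter b) (auto simp: mult.assoc)
        then show False using p by simp
      qed
      then have s: "0 \<le> 2 * pi - p" "2 * pi - p \<le> pi / 2" using p by auto
      have "zz b (2 * pi - p) \<le> 3 / 5"
      proof (rule ccontr)
        assume "\<not> zz b (2 * pi - p) \<le> 3 / 5"
        then have "cusp_fun b (2 * pi - (2 * pi - p)) > 0"
          using s elim(3) by (intro cusp_fun_pos_fourth_quarter b) (auto simp: mult.assoc)
        then show False using p by simp
      qed
      then show "\<exists>s. p = 2 * pi - s \<and> 0 \<le> s \<and> s \<le> pi / 2 \<and> zz b s \<le> 3 / 5"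
        using s by (intro exI[of _ "2 * pi - p"]) auto
    qed
  qed
qed

section \<open>The solutions and the curve\<close>

text \<open>If n q were nonnegative, the minimum of n on the interval would be negative and
  interior, so n' = 0 there, against the assumption that n' < 0 wherever n \<le> 0.\<close>

lemma neg_propagates:
  fixes n n' :: "real \<Rightarrow> real"
  assumes "p < q" and d: "\<And>t. p \<le> t \<Longrightarrow> t \<le> q \<Longrightarrow> (n has_real_derivative n' t) (at t)"
    and neg: "\<And>t. p \<le> t \<Longrightarrow> t \<le> q \<Longrightarrow> n t \<le> 0 \<Longrightarrow> n' t < 0" and "n p \<le> 0"
  shows "n q < 0"
proof (rule ccontr)
  assume q: "\<not> n q < 0"
  obtain e where e: "e > 0" "\<And>h. 0 < h \<Longrightarrow> h < e \<Longrightarrow> n (p + h) < n p"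
    using DERIV_neg_dec_right[OF d neg[of p]] assms by (metis less_imp_le order_refl)
  define h where "h = min (e / 2) (q - p)"
  have h: "0 < h" "h < e" "p + h \<le> q" using e(1) assms(1) by (auto simp: h_def min_def)
  have nh: "n (p + h) < 0" using e(2)[OF h(1,2)] assms(4) by simp
  have "continuous_on {p..q} n"
    using d by (intro DERIV_atLeastAtMost_imp_continuous_on) auto
  then obtain c where c: "c \<in> {p..q}" "\<And>y. y \<in> {p..q} \<Longrightarrow> n c \<le> n y"
    using continuous_attains_inf[of "{p..q}" n] assms(1) by auto
  have nc: "n c \<le> n (p + h)" using c(2)[of "p + h"] h by auto
  have "c \<noteq> q" using nc nh q by auto
  moreover have "c \<noteq> p" using nc e(2)[OF h(1,2)] by auto
  ultimately have i: "p < c" "c < q" using c(1) by auto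
  define m where "m = min (c - p) (q - c)"
  have "m > 0" using i by (simp add: m_def)
  moreover have "\<forall>y. \<bar>c - y\<bar> < m \<longrightarrow> n c \<le> n y"
    by (intro allI impI c(2)) (auto simp: m_def)
  ultimately have "n' c = 0" using DERIV_local_min[OF d[of c]] i by auto
  then show False using neg[of c] i nc nh by auto
qed

section \<open>The period as a decreasing function of the parameter\<close>

definition period :: "real \<Rightarrow> real" where
  "period b = Tm b (2 * pi)"

text \<open>Reflecting p to pi / 2 - p turns Gauss's integrand into \<open>2 / Del\<close>, so the
  complete integral is twice the quarter period and pi / AGM is the whole period.\<close>

lemma Lalpha_sqrt:
  assumes "b > 0" "b < 1 / 2"
  shows "Lalpha (sqrt b) = period b"
proof -
  let ?c = "sqrt (1 + 2 * (sqrt b)\<^sup>2) / 2"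
  have pos: "sqrt b > 0" "?c > 0" using assms by auto
  have rad: "1 / sqrt (ell_rad (sqrt b) ?c p) = 2 / Del b (pi / 2 - p)" for p
  proof -
    have e: "ell_rad (sqrt b) ?c p = (Del b (pi / 2 - p) / 2)\<^sup>2"
      unfolding power_divide Del_sq[OF assms(1)] ell_rad_def cos_diff sin_diff using assms
      by (simp add: power_divide cos_squared_eq[of p] algebra_simps)
    show ?thesis unfolding e using Del_pos[OF assms(1), of "pi / 2 - p"] by simp
  qed
  define f where "f p = 1 / sqrt (ell_rad (sqrt b) ?c p)" for p
  have f: "continuous_on UNIV f" unfolding f_def by (rule continuous_on_ell_integrand[OF pos])
  have "prim f (pi / 2) + 2 * Tm b (pi / 2 - pi / 2) = prim f 0 + 2 * Tm b (pi / 2 - 0)"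
  proof (rule DERIV_isconst_all[where f = "\<lambda>p. prim f p + 2 * Tm b (pi / 2 - p)"], rule allI)
    fix p
    have "((\<lambda>p. Tm b (pi / 2 - p)) has_real_derivative 1 / Del b (pi / 2 - p) * (0 - 1)) (at p)"
      by (rule DERIV_chain2[OF Tm_deriv[OF assms(1)]]) (intro derivative_intros)
    then show "((\<lambda>p. prim f p + 2 * Tm b (pi / 2 - p)) has_real_derivative 0) (at p)"
      by (intro DERIV_cong[OF DERIV_add[OF prim_deriv[OF f] DERIV_cmult]]) (auto simp: f_def rad)
  qed
  then have "ell_int (sqrt b) ?c = 2 * Tm b (pi / 2)"
    using assms unfolding ell_int_def f_def[abs_def] by simp
  then have "pi / AGM (sqrt b) ?c = 4 * Tm b (pi / 2)"
    using ell_int_AGM(1)[OF pos] by simp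
  then show ?thesis
    unfolding Lalpha_def period_def Tm_symm(3)[OF assms] .
qed

text \<open>The boundary term of \<open>Tb\<close> vanishes at 2 pi, so the sign is that of 4 b^2 T
  - G.\<close>

lemma period_deriv:
  assumes "b > 0" "b < 1 / 2"
  shows "(period has_real_derivative Tb b (2 * pi)) (at b)" "Tb b (2 * pi) < 0"
proof -
  show "(period has_real_derivative Tb b (2 * pi)) (at b)"
    unfolding period_def[abs_def] by (rule Tm_deriv_b) (use assms in auto)
  have "4 * b\<^sup>2 * Tm b (2 * pi) - Gm b (2 * pi) < 0"
    using Gm_gt_4b2_Tm[OF assms, of "2 * pi"] pi_gt_zero by simp
  then show "Tb b (2 * pi) < 0"
    unfolding Tb_def using one_minus_4b2_pos[OF assms] assms
    by (simp add: divide_neg_pos)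
qed

lemma period_less:
  assumes "b > 0" "b < c" "c < 1 / 2"
  shows "period c < period b"
  by (rule DERIV_neg_imp_decreasing[OF assms(2)]) (use period_deriv assms in \<open>meson le_less_trans less_le_trans\<close>)

lemma period_less_iff:
  assumes "b > 0" "b < 1 / 2" "c > 0" "c < 1 / 2"
  shows "period b < period c \<longleftrightarrow> c < b" "period b \<le> period c \<longleftrightarrow> c \<le> b" "period b = period c \<longleftrightarrow> b = c"
  using period_less[of b c] period_less[of c b] assms by (cases b c rule: linorder_cases; force)+

lemma period_surj:
  assumes "B > 0" "B < 1 / 2" "L > period B"
  obtains b where "b > 0" "b < B" "period b = L"
proof -
  \<comment> \<open>b1 \<le> 1/4 makes \<open>(mm b1)^2\<close> at least 1/2; then
    \<open>exp_quarter_ge\<close> with b1 \<le> exp (- L / 2) / 4 gives exp ((period b1 - L) / 2)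
    \<ge> 2, so the period exceeds L at b1.\<close>
  define b1 where "b1 = min B (min (1 / 4) (exp (- L / 2) / 4))"
  have b1: "0 < b1" "b1 \<le> B" "b1 \<le> 1 / 4" "b1 \<le> exp (- L / 2) / 4"
    using assms by (auto simp: b1_def)
  have "1 / 2 \<le> (mm b1)\<^sup>2" using mm_sq[of b1] b1 by simp
  also have "\<dots> \<le> b1 * exp (2 * Tm b1 (pi / 2))" using exp_quarter_ge[of b1] b1 by simp
  also have "\<dots> \<le> exp (- L / 2) / 4 * exp (2 * Tm b1 (pi / 2))" using b1 by (intro mult_right_mono) auto
  also have "2 * Tm b1 (pi / 2) = period b1 / 2" using Tm_symm(3)[of b1] b1 by (simp add: period_def)
  finally have "2 \<le> exp (- L / 2) * exp (period b1 / 2)" by simp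
  also have "\<dots> = exp ((period b1 - L) / 2)" by (simp add: diff_divide_distrib flip: exp_add)
  finally have "exp 0 < exp ((period b1 - L) / 2)" unfolding exp_zero by linarith
  then have L1: "L < period b1" unfolding exp_less_cancel_iff by simp
  have "\<exists>x\<ge>b1. x \<le> B \<and> period x = L"
  proof (intro IVT2 allI impI)
    fix x assume "b1 \<le> x \<and> x \<le> B"
    then show "isCont period x" using DERIV_isCont[OF period_deriv(1)[of x]] b1 assms by simp
  qed (use assms b1 L1 in auto)
  then obtain x where x: "b1 \<le> x" "x \<le> B" "period x = L" by blast
  moreover have "x \<noteq> B" using x assms by auto
  ultimately show ?thesis using that[of x] b1 by auto
qed

section \<open>Initial values and solutions selected by the definitions\<close>

lemma alpha_of_period:
  assumes "b > 0" "b < 1 / 2"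
  shows "alpha_of (period b) = sqrt b"
  unfolding alpha_of_def
proof (rule the_equality)
  have "sqrt b < sqrt (1 / 2)" using assms by (intro real_sqrt_less_mono)
  then show "0 < sqrt b \<and> sqrt b < 1 / sqrt 2 \<and> Lalpha (sqrt b) = period b"
    using assms Lalpha_sqrt[OF assms] by (simp add: real_sqrt_divide)
  fix a assume a: "0 < a \<and> a < 1 / sqrt 2 \<and> Lalpha a = period b"
  then have "a\<^sup>2 < (1 / sqrt 2)\<^sup>2" by (intro power_strict_mono) auto
  then have a2: "0 < a\<^sup>2" "a\<^sup>2 < 1 / 2" using a by (auto simp: power_divide)
  have "period (a\<^sup>2) = period b" using Lalpha_sqrt[OF a2] a by simp
  then have "a\<^sup>2 = b" using period_less_iff(3)[OF a2 assms] by simp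
  then show "a = sqrt b" using a by auto
qed

lemma init_xy_period:
  assumes "b > 0" "b < 1 / 2"
  shows "init_xy (period b) = (xx b 0, yy b 0)"
  unfolding init_xy_def alpha_of_period[OF assms]
proof (rule the_equality)
  have xy: "xx b 0 * yy b 0 = b" "(xx b 0)\<^sup>2 + (yy b 0)\<^sup>2 = 1"
    using xx_yy[OF assms, of 0] by simp_all
  have lt: "xx b 0 > yy b 0" "yy b 0 > 0"
    using xx_yy_pos[OF assms, of 0] mm_pos[OF assms(2)] by (auto simp: xx_def yy_def)
  show "case (xx b 0, yy b 0) of (x0, y0) \<Rightarrow> y0 < x0 \<and> 0 < y0 \<and> x0\<^sup>2 + y0\<^sup>2 = 1 \<and> x0 * y0 = (sqrt b)\<^sup>2"
    using xy lt assms by simp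
  fix v :: "real \<times> real"
  assume v: "case v of (x0, y0) \<Rightarrow> y0 < x0 \<and> 0 < y0 \<and> x0\<^sup>2 + y0\<^sup>2 = 1 \<and> x0 * y0 = (sqrt b)\<^sup>2"
  obtain x y where v': "v = (x, y)" by (cases v)
  have v: "y < x" "0 < y" "x\<^sup>2 + y\<^sup>2 = 1" "x * y = b" using v v' assms by auto
  have "(x + y)\<^sup>2 = (xx b 0 + yy b 0)\<^sup>2" "(x - y)\<^sup>2 = (xx b 0 - yy b 0)\<^sup>2"
    unfolding power2_sum power2_diff using v xy by simp_all
  then have "x + y = xx b 0 + yy b 0" "x - y = xx b 0 - yy b 0"
    using v lt by (simp_all add: power2_eq_iff_nonneg)
  then show "v = (xx b 0, yy b 0)" using v' by simp
qed

text \<open>Gronwall's argument in both time directions, since the solutions chosen by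
  \<open>THE\<close> live on the whole line.\<close>

lemma gronwall_zero:
  fixes u u' :: "real \<Rightarrow> real"
  assumes d: "\<And>t. (u has_real_derivative u' t) (at t)" and le: "\<And>t. \<bar>u' t\<bar> \<le> C * u t"
    and nonneg: "\<And>t. u t \<ge> 0" and "u 0 = 0"
  shows "u t = 0"
proof -
  have "u t * exp (- C * \<bar>t\<bar>) \<le> 0"
  proof (cases "t \<ge> 0")
    case True
    have "(\<lambda>t. u t * exp (- C * t)) 0 \<ge> (\<lambda>t. u t * exp (- C * t)) t"
    proof (rule DERIV_nonpos_imp_nonincreasing[OF True])
      fix x
      have "((\<lambda>t. u t * exp (- C * t)) has_real_derivative (u' x - C * u x) * exp (- C * x)) (at x)"
        by (auto intro!: derivative_eq_intros d simp: algebra_simps)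
      moreover have "(u' x - C * u x) * exp (- C * x) \<le> 0"
        using le[of x] by (intro mult_nonpos_nonneg) auto
      ultimately show "\<exists>y. ((\<lambda>t. u t * exp (- C * t)) has_real_derivative y) (at x) \<and> y \<le> 0" by blast
    qed
    then show ?thesis using True assms(4) by simp
  next
    case False
    have "(\<lambda>t. u t * exp (C * t)) t \<le> (\<lambda>t. u t * exp (C * t)) 0"
    proof (rule DERIV_nonneg_imp_nondecreasing[of t 0])
      fix x
      have "((\<lambda>t. u t * exp (C * t)) has_real_derivative (u' x + C * u x) * exp (C * x)) (at x)"
        by (auto intro!: derivative_eq_intros d simp: algebra_simps)
      moreover have "(u' x + C * u x) * exp (C * x) \<ge> 0"
        using le[of x] by (intro mult_nonneg_nonneg) auto
      ultimately show "\<exists>y. ((\<lambda>t. u t * exp (C * t)) has_real_derivative y) (at x) \<and> 0 \<le> y" by blast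
    qed (use False in simp)
    then show ?thesis using False assms(4) by simp
  qed
  then have "u t \<le> 0" by (simp add: mult_le_0_iff)
  then show ?thesis using nonneg[of t] by simp
qed

lemma phase_chain:
  assumes b: "b > 0" "b < 1 / 2"
  shows "((\<lambda>t. xx b (phase b t)) has_real_derivative - xx b (phase b t) * zz b (phase b t)) (at t)"
    "((\<lambda>t. yy b (phase b t)) has_real_derivative yy b (phase b t) * zz b (phase b t)) (at t)"
    "((\<lambda>t. zz b (phase b t)) has_real_derivative (xx b (phase b t))\<^sup>2 - (yy b (phase b t))\<^sup>2) (at t)"
    "((\<lambda>t. Gm b (phase b t)) has_real_derivative (xx b (phase b t))\<^sup>2 + (yy b (phase b t))\<^sup>2) (at t)"
proof -
  have D: "Del b (phase b t) \<noteq> 0" using Del_pos[OF b(1), of "phase b t"] by simp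
  show "((\<lambda>t. xx b (phase b t)) has_real_derivative - xx b (phase b t) * zz b (phase b t)) (at t)"
    using DERIV_chain2[OF xx_deriv[OF b] phase_deriv_t[OF b], of t] D by simp
  show "((\<lambda>t. yy b (phase b t)) has_real_derivative yy b (phase b t) * zz b (phase b t)) (at t)"
    using DERIV_chain2[OF yy_deriv[OF b] phase_deriv_t[OF b], of t] D by simp
  show "((\<lambda>t. zz b (phase b t)) has_real_derivative (xx b (phase b t))\<^sup>2 - (yy b (phase b t))\<^sup>2) (at t)"
    unfolding xx_yy(3)[OF b] using DERIV_chain2[OF zz_deriv[OF b(1)] phase_deriv_t[OF b], of t] D by simp
  show "((\<lambda>t. Gm b (phase b t)) has_real_derivative (xx b (phase b t))\<^sup>2 + (yy b (phase b t))\<^sup>2) (at t)"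
    unfolding xx_yy(2)[OF b] using DERIV_chain2[OF Gm_deriv[OF b] phase_deriv_t[OF b], of t] D by simp
qed

lemma has_vector_derivative_components:
  assumes "(f has_vector_derivative v) (at t)"
  shows "((\<lambda>t. fst (f t)) has_vector_derivative fst v) (at t)" "((\<lambda>t. snd (f t)) has_vector_derivative snd v) (at t)"
  using bounded_linear.has_vector_derivative[OF bounded_linear_fst assms]
    bounded_linear.has_vector_derivative[OF bounded_linear_snd assms] by simp_all

lemma xyz_sol_period:
  assumes b: "b > 0" "b < 1 / 2"
  shows "xyz_sol (period b) = (\<lambda>t. (xx b (phase b t), yy b (phase b t), zz b (phase b t)))"
  unfolding xyz_sol_def init_xy_period[OF b]
proof (rule the_equality)
  show "(\<lambda>t. (xx b (phase b t), yy b (phase b t), zz b (phase b t))) 0 = (fst (xx b 0, yy b 0), snd (xx b 0, yy b 0), 0) \<and>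
    (\<forall>t. ((\<lambda>t. (xx b (phase b t), yy b (phase b t), zz b (phase b t))) has_vector_derivative
       (let (x, y, z) = (xx b (phase b t), yy b (phase b t), zz b (phase b t)) in (- x * z, y * z, x\<^sup>2 - y\<^sup>2))) (at t))"
    using b phase_chain[OF b] unfolding Let_def prod.case has_real_derivative_iff_has_vector_derivative
    by (auto intro!: has_vector_derivative_Pair)
next
  fix f :: "real \<Rightarrow> real \<times> real \<times> real"
  assume f: "f 0 = (fst (xx b 0, yy b 0), snd (xx b 0, yy b 0), 0) \<and>
    (\<forall>t. (f has_vector_derivative (let (x, y, z) = f t in (- x * z, y * z, x\<^sup>2 - y\<^sup>2))) (at t))"
  define X Y Z where "X t = fst (f t)" and "Y t = fst (snd (f t))" and "Z t = snd (snd (f t))" for t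
  have ft: "f t = (X t, Y t, Z t)" for t by (simp add: X_def Y_def Z_def)
  have fd: "(f has_vector_derivative (- X t * Z t, Y t * Z t, (X t)\<^sup>2 - (Y t)\<^sup>2)) (at t)" for t
  proof -
    have "(f has_vector_derivative (let (x, y, z) = f t in (- x * z, y * z, x\<^sup>2 - y\<^sup>2))) (at t)"
      using f by blast
    then show ?thesis by (simp only: ft Let_def prod.case)
  qed
  have D: "(X has_real_derivative - X t * Z t) (at t)" "(Y has_real_derivative Y t * Z t) (at t)"
    "(Z has_real_derivative (X t)\<^sup>2 - (Y t)\<^sup>2) (at t)" for t
    using has_vector_derivative_components[OF fd[of t]]
      has_vector_derivative_components[OF has_vector_derivative_components(2)[OF fd[of t]]]
    by (simp_all add: has_real_derivative_iff_has_vector_derivative X_def[abs_def] Y_def[abs_def] Z_def[abs_def])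
  define x y z where "x t = xx b (phase b t)" and "y t = yy b (phase b t)" and "z t = zz b (phase b t)" for t
  have d: "(x has_real_derivative - x t * z t) (at t)" "(y has_real_derivative y t * z t) (at t)"
    "(z has_real_derivative (x t)\<^sup>2 - (y t)\<^sup>2) (at t)" for t
    using phase_chain(1-3)[OF b, of t] by (simp_all add: x_def[abs_def] y_def[abs_def] z_def[abs_def])
  define u where "u t = (x t - X t)\<^sup>2 + (y t - Y t)\<^sup>2 + (z t - Z t)\<^sup>2" for t
  \<comment> \<open>Half the derivative of the squared distance of two solutions. Terms cubic in the
    differences cancel, so the only coefficients left are components of the explicit solution,
    bounded by 1 on the unit sphere.\<close>
  define v where "v p q r t = - (p * p * z t) + q * q * z t + p * r * x t - q * r * y t" for p q r t
  have "u t = 0" for t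
  proof (rule gronwall_zero[where C = 4 and u = u and u' = "\<lambda>t. 2 * v (x t - X t) (y t - Y t) (z t - Z t) t"])
    fix t
    show "(u has_real_derivative 2 * v (x t - X t) (y t - Y t) (z t - Z t) t) (at t)"
      unfolding u_def power2_eq_square v_def
      by (rule DERIV_cong, (rule derivative_intros d[unfolded power2_eq_square] D[unfolded power2_eq_square])+) algebra
    have "\<bar>x t\<bar> \<le> 1 \<and> \<bar>y t\<bar> \<le> 1 \<and> \<bar>z t\<bar> \<le> 1"
      using xx_yy(2)[OF b, of "phase b t"] zero_le_power2[of "x t"] zero_le_power2[of "y t"] zero_le_power2[of "z t"]
      unfolding x_def y_def z_def abs_square_le_1[symmetric] by (intro conjI; linarith)
    then have bd: "\<bar>x t\<bar> \<le> 1" "\<bar>y t\<bar> \<le> 1" "\<bar>z t\<bar> \<le> 1" by auto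
    have m: "\<bar>s * w\<bar> \<le> \<bar>s\<bar>" if "\<bar>w\<bar> \<le> 1" for s w :: real
      using mult_left_mono[OF that, of "\<bar>s\<bar>"] by (simp add: abs_mult)
    have "\<bar>v p q r t\<bar> \<le> 2 * (p\<^sup>2 + q\<^sup>2 + r\<^sup>2)" for p q r
    proof -
      have am: "\<bar>s * w\<bar> \<le> (s\<^sup>2 + w\<^sup>2) / 2" for s w :: real
        using zero_le_power2[of "s - w"] zero_le_power2[of "s + w"]
        unfolding power2_diff power2_sum by (auto simp: abs_le_iff)
      have "\<bar>v p q r t\<bar> \<le> \<bar>p * p * z t\<bar> + \<bar>q * q * z t\<bar> + \<bar>p * r * x t\<bar> + \<bar>q * r * y t\<bar>"
        unfolding v_def by linarith
      also have "\<dots> \<le> p\<^sup>2 + q\<^sup>2 + (p\<^sup>2 + r\<^sup>2) / 2 + (q\<^sup>2 + r\<^sup>2) / 2"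
        using m[OF bd(3), of "p * p"] m[OF bd(3), of "q * q"] m[OF bd(1), of "p * r"] m[OF bd(2), of "q * r"]
          am[of p r] am[of q r] by (simp add: power2_eq_square) argo
      also have "\<dots> \<le> 2 * (p\<^sup>2 + q\<^sup>2 + r\<^sup>2)"
        using zero_le_power2[of p] zero_le_power2[of q] zero_le_power2[of r] by argo
      finally show ?thesis .
    qed
    from this[of "x t - X t" "y t - Y t" "z t - Z t"]
    show "\<bar>2 * v (x t - X t) (y t - Y t) (z t - Z t) t\<bar> \<le> 4 * u t"
      by (simp add: u_def abs_mult)
    show "u t \<ge> 0" by (simp add: u_def)
  next
    show "u 0 = 0" using f b by (simp add: u_def X_def Y_def Z_def x_def y_def z_def)
  qed
  then have "x t - X t = 0 \<and> y t - Y t = 0 \<and> z t - Z t = 0" for t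
    unfolding u_def by (smt (verit) zero_eq_power2 zero_le_power2)
  then show "f = (\<lambda>t. (xx b (phase b t), yy b (phase b t), zz b (phase b t)))"
    by (auto simp: ft x_def y_def z_def fun_eq_iff)
qed

lemma ab_sol_period:
  assumes b: "b > 0" "b < 1 / 2"
  shows "ab_sol (period b) = (\<lambda>t. ((Gm b (phase b t) + zz b (phase b t)) / xx b (phase b t),
     (Gm b (phase b t) - zz b (phase b t)) / yy b (phase b t)))"
proof -
  define X Y Z G where "X t = xx b (phase b t)" and "Y t = yy b (phase b t)" and "Z t = zz b (phase b t)"
    and "G t = Gm b (phase b t)" for t
  have d: "(X has_real_derivative - X t * Z t) (at t)" "(Y has_real_derivative Y t * Z t) (at t)"
    "(Z has_real_derivative (X t)\<^sup>2 - (Y t)\<^sup>2) (at t)" "(G has_real_derivative (X t)\<^sup>2 + (Y t)\<^sup>2) (at t)" for t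
    using phase_chain[OF b, of t] by (simp_all add: X_def[abs_def] Y_def[abs_def] Z_def[abs_def] G_def[abs_def])
  have pos: "X t > 0" "Y t > 0" for t using xx_yy_pos[OF b] by (auto simp: X_def Y_def)
  have sol: "((\<lambda>t. (G t + Z t) / X t) has_real_derivative 2 * X t + (G t + Z t) / X t * Z t) (at t)"
    "((\<lambda>t. (G t - Z t) / Y t) has_real_derivative 2 * Y t - (G t - Z t) / Y t * Z t) (at t)" for t
    using pos[of t]
    by (auto intro!: derivative_eq_intros d simp: divide_simps) (simp_all add: algebra_simps power2_eq_square)
  show ?thesis
    unfolding ab_sol_def xyz_sol_period[OF b] prod.case X_def[symmetric] Y_def[symmetric] Z_def[symmetric] G_def[symmetric]
  proof (rule the_equality)
    show "(\<lambda>t. ((G t + Z t) / X t, (G t - Z t) / Y t)) 0 = (0, 0) \<and>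
      (\<forall>t. ((\<lambda>t. ((G t + Z t) / X t, (G t - Z t) / Y t)) has_vector_derivative
        (let (x, y, z) = (X t, Y t, Z t); (a, b) = ((G t + Z t) / X t, (G t - Z t) / Y t)
         in (2 * x + a * z, 2 * y - b * z))) (at t))"
      using sol b unfolding Let_def prod.case has_real_derivative_iff_has_vector_derivative
      by (auto intro!: has_vector_derivative_Pair simp: G_def Z_def)
  next
    fix g :: "real \<Rightarrow> real \<times> real"
    assume g: "g 0 = (0, 0) \<and> (\<forall>t. (g has_vector_derivative
        (let (x, y, z) = (X t, Y t, Z t); (a, b) = g t in (2 * x + a * z, 2 * y - b * z))) (at t))"
    have gd: "(g has_vector_derivative (2 * X t + fst (g t) * Z t, 2 * Y t - snd (g t) * Z t)) (at t)" for t
      using g by (auto simp: Let_def split_beta)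
    have D: "((\<lambda>t. fst (g t)) has_real_derivative 2 * X t + fst (g t) * Z t) (at t)"
      "((\<lambda>t. snd (g t)) has_real_derivative 2 * Y t - snd (g t) * Z t) (at t)" for t
      using has_vector_derivative_components[OF gd[of t]]
      by (simp_all add: has_real_derivative_iff_has_vector_derivative)
    \<comment> \<open>For any solution (a x)' = 2 x^2 = (G + z)' and (b y)' = 2 y^2 = (G - z)', so
      uniqueness is the constancy of two differences.\<close>
    have "fst (g t) * X t - (G t + Z t) = fst (g 0) * X 0 - (G 0 + Z 0)" for t
      by (rule DERIV_isconst_all[where f = "\<lambda>t. fst (g t) * X t - (G t + Z t)"], rule allI,
          rule DERIV_cong, (rule derivative_intros D d)+) algebra
    moreover have "snd (g t) * Y t - (G t - Z t) = snd (g 0) * Y 0 - (G 0 - Z 0)" for t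
      by (rule DERIV_isconst_all[where f = "\<lambda>t. snd (g t) * Y t - (G t - Z t)"], rule allI,
          rule DERIV_cong, (rule derivative_intros D d)+) algebra
    ultimately have "fst (g t) = (G t + Z t) / X t" "snd (g t) = (G t - Z t) / Y t" for t
      using g b pos[of t] by (simp_all add: G_def Z_def field_simps)
    then show "g = (\<lambda>t. ((G t + Z t) / X t, (G t - Z t) / Y t))"
      by (auto simp: fun_eq_iff prod_eq_iff)
  qed
qed

section \<open>The curve and its velocity\<close>

definition AA :: "real \<Rightarrow> real \<Rightarrow> real" where
  "AA r b = (Gm b (phase b r) + zz b (phase b r)) / xx b (phase b r) / 2"

definition BB :: "real \<Rightarrow> real \<Rightarrow> real" where
  "BB r b = (Gm b (phase b r) - zz b (phase b r)) / yy b (phase b r) / 2"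

lemma Upsilon_period: "b > 0 \<Longrightarrow> b < 1 / 2 \<Longrightarrow> Upsilon r (period b) = (AA r b, BB r b)"
  by (simp add: Upsilon_def a_sol_def b_sol_def ab_sol_period AA_def BB_def)

lemma AA_BB_deriv:
  assumes b: "b > 0" "b < 1 / 2" and r: "r \<ge> 0" and p: "p = phase b r"
  shows "(AA r has_real_derivative - cusp_fun b p / (4 * b * (1 - 4 * b\<^sup>2) * xx b p)) (at b)"
    "(BB r has_real_derivative cusp_fun b p / (4 * b * (1 - 4 * b\<^sup>2) * yy b p)) (at b)"
proof -
  define k where "k = 1 - 4 * b\<^sup>2"
  have k: "k > 0" using one_minus_4b2_pos[OF b] by (simp add: k_def)
  have pos: "xx b p > 0" "yy b p > 0" using xx_yy_pos[OF b] by auto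
  \<comment> \<open>\<open>V\<close> is x times \<open>D\<close> of the coordinate a, and also minus
    y times \<open>D\<close> of the coordinate b: the Gauss lemma in explicit form.\<close>
  define V where "V = zw b p + zz b p + Gm b p * ww b p"
  have "k * zw b p = 4 * b\<^sup>2 * (zz b p + Tm b p * zd b p) - zd b p * Gm b p + zz b p * (1 - (zz b p)\<^sup>2)"
    "k * ww b p = 4 * b\<^sup>2 * Tm b p * zz b p - HH b p"
    using k by (simp_all add: zw_def ww_def k_def)
  then have "k * V = cusp_fun b p"
    unfolding V_def cusp_fun_def HH_def k_def by algebra
  then have V: "V = cusp_fun b p / k" using k by (simp add: field_simps)
  note D = xx_deriv_b[OF b r p] yy_deriv_b[OF b r p] zz_deriv_b[OF b r p] Gm_deriv_b_phase[OF b r p]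
  have "(AA r has_real_derivative (((Gm b p + zz b p * ww b p) / (2 * b) + - zw b p / (2 * b)) * xx b p
      - (Gm b p + zz b p) * (xx b p * (1 + ww b p) / (2 * b))) / (xx b p * xx b p) / 2) (at b)"
    unfolding AA_def[abs_def] p using pos p by (intro DERIV_cdivide DERIV_divide DERIV_add D[unfolded p]) simp
  moreover have "(((Gm b p + zz b p * ww b p) / (2 * b) + - zw b p / (2 * b)) * xx b p
      - (Gm b p + zz b p) * (xx b p * (1 + ww b p) / (2 * b))) / (xx b p * xx b p) / 2 = - V / (4 * b * xx b p)"
    unfolding V_def using pos b by (simp add: field_simps)
  ultimately show "(AA r has_real_derivative - cusp_fun b p / (4 * b * (1 - 4 * b\<^sup>2) * xx b p)) (at b)"
    unfolding V k_def by (simp add: mult_ac)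
  have "(BB r has_real_derivative (((Gm b p + zz b p * ww b p) / (2 * b) - - zw b p / (2 * b)) * yy b p
      - (Gm b p - zz b p) * (yy b p * (1 - ww b p) / (2 * b))) / (yy b p * yy b p) / 2) (at b)"
    unfolding BB_def[abs_def] p using pos p by (intro DERIV_cdivide DERIV_divide DERIV_diff D[unfolded p]) simp
  moreover have "(((Gm b p + zz b p * ww b p) / (2 * b) - - zw b p / (2 * b)) * yy b p
      - (Gm b p - zz b p) * (yy b p * (1 - ww b p) / (2 * b))) / (yy b p * yy b p) / 2 = V / (4 * b * yy b p)"
    unfolding V_def using pos b by (simp add: field_simps)
  ultimately show "(BB r has_real_derivative cusp_fun b p / (4 * b * (1 - 4 * b\<^sup>2) * yy b p)) (at b)"
    unfolding V k_def by (simp add: mult_ac)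
qed

text \<open>The inverse of \<open>period\<close>, through which the curve becomes a function of
  L.\<close>

definition beta_of :: "real \<Rightarrow> real" where
  "beta_of L = (alpha_of L)\<^sup>2"

lemma beta_of_period: "b > 0 \<Longrightarrow> b < 1 / 2 \<Longrightarrow> beta_of (period b) = b"
  by (simp add: beta_of_def alpha_of_period)

lemma beta_of_deriv:
  assumes "b > 0" "b < 1 / 2"
  shows "(beta_of has_real_derivative inverse (Tb b (2 * pi))) (at (period b))"
proof -
  \<comment> \<open>Any value strictly between b and 1/2 serves: all numbers above
    \<open>period B\<close> are periods, which gives an open neighbourhood of
    \<open>period b\<close> on which \<open>beta_of\<close> is a right inverse.\<close>
  define B where "B = (b + 1 / 2) / 2"
  have B: "b < B" "B > 0" "B < 1 / 2" using assms by (auto simp: B_def)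
  define e where "e = min b (1 / 2 - b) / 2"
  have e0: "e > 0" "e < b" "e < 1 / 2 - b" using assms by (auto simp: e_def min_def)
  have e: "0 < z" "z < 1 / 2" if "\<bar>z - b\<bar> \<le> e" for z
    using that e0 by linarith+
  have cont: "isCont beta_of (period b)"
  proof (rule isCont_inverse_function[OF e0(1), where f = period and g = beta_of])
    fix z assume z: "\<bar>z - b\<bar> \<le> e"
    show "beta_of (period z) = z" by (rule beta_of_period[OF e[OF z]])
    show "isCont period z" by (rule DERIV_isCont[OF period_deriv(1)[OF e[OF z]]])
  qed
  have d: "DERIV period (beta_of (period b)) :> Tb b (2 * pi)"
    using period_deriv(1)[OF assms] beta_of_period[OF assms] by simp
  show ?thesis
  proof (rule DERIV_inverse_function[where f = period and a = "period B" and b = "period b + 1"])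
    show "DERIV period (beta_of (period b)) :> Tb b (2 * pi)" by (rule d)
    show "Tb b (2 * pi) \<noteq> 0" using period_deriv(2)[OF assms] by simp
    show "period B < period b" using period_less[of b B] assms B by simp
    show "period b < period b + 1" by simp
    show "isCont beta_of (period b)" by (rule cont)
    fix y assume "period B < y"
    then obtain c where "c > 0" "c < B" "period c = y" using period_surj[OF B(2,3)] by metis
    then show "period (beta_of y) = y" using beta_of_period[of c] B by auto
  qed
qed

lemma Upsilon_deriv:
  assumes b: "b > 0" "b < 1 / 2" and r: "r \<ge> 0" and p: "p = phase b r"
  defines "j \<equiv> - cusp_fun b p / (4 * b * (1 - 4 * b\<^sup>2) * Tb b (2 * pi))"
  shows "(Upsilon r has_vector_derivative (j / xx b p, - j / yy b p)) (at (period b))"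
proof -
  define B where "B = (b + 1 / 2) / 2"
  have B: "b < B" "B > 0" "B < 1 / 2" using b by (auto simp: B_def)
  have beta_of: "beta_of (period b) = b" by (rule beta_of_period[OF b])
  have D: "(AA r has_real_derivative - cusp_fun b p / (4 * b * (1 - 4 * b\<^sup>2) * xx b p)) (at (beta_of (period b)))"
    "(BB r has_real_derivative cusp_fun b p / (4 * b * (1 - 4 * b\<^sup>2) * yy b p)) (at (beta_of (period b)))"
    unfolding beta_of by (rule AA_BB_deriv[OF b r p])+
  have eq: "- v / (w * x) * inverse t = - v / (w * t) / x" "v / (w * x) * inverse t = - (- v / (w * t)) / x"
    for v w x t :: real by (simp_all add: inverse_eq_divide mult_ac)
  have "((\<lambda>L. AA r (beta_of L)) has_real_derivative j / xx b p) (at (period b))"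
    using DERIV_chain2[OF D(1) beta_of_deriv[OF b]] unfolding j_def eq(1) .
  moreover have "((\<lambda>L. BB r (beta_of L)) has_real_derivative - j / yy b p) (at (period b))"
    using DERIV_chain2[OF D(2) beta_of_deriv[OF b]] unfolding j_def eq(2) .
  ultimately have "((\<lambda>L. (AA r (beta_of L), BB r (beta_of L))) has_vector_derivative (j / xx b p, - j / yy b p)) (at (period b))"
    by (intro has_vector_derivative_Pair) (simp_all add: has_real_derivative_iff_has_vector_derivative)
  then show ?thesis
  proof (rule has_vector_derivative_transform_within_open[where S = "{period B<..}"])
    show "period b \<in> {period B<..}" using period_less[of b B] b B by simp
    fix L assume "L \<in> {period B<..}"
    then obtain c where c: "c > 0" "c < B" "period c = L" using period_surj[OF B(2,3)] by auto
    then show "(AA r (beta_of L), BB r (beta_of L)) = Upsilon r L"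
      using Upsilon_period[of c r] beta_of_period[of c] B by auto
  qed simp
qed

section \<open>The cusp\<close>

text \<open>The velocity is a derivative within \<open>{r..}\<close>, one-sided at L = r; it is
  determined because this filter is nontrivial.\<close>

lemma at_within_atLeast_neq_bot:
  fixes r L :: real
  assumes "r \<le> L"
  shows "at L within {r..} \<noteq> bot"
proof -
  have "at_right L \<le> at L within {r..}"
    by (rule at_le) (use assms in auto)
  then show ?thesis
    using trivial_limit_at_right_real[of L] by (metis bot.extremum_unique)
qed

theorem theorem6p3:
  shows "\<forall>\<epsilon>>0. \<exists>R. \<forall>r>R.
     (\<forall>L\<ge>r. Upsilon r differentiable (at L within {r..})) \<and>
     (\<exists>Lr. is_cusp r Lr \<and> (\<forall>L. is_cusp r L \<longrightarrow> L = Lr) \<and>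
        (\<forall>L\<ge>r. L \<noteq> Lr \<longrightarrow> snd (velocity r L) / fst (velocity r L) < 0) \<and>
        fst (Upsilon r Lr) < 2 + \<epsilon> \<and>
        snd (Upsilon r Lr) < (exp 2 / 2 + \<epsilon>) * exp (r / 2))"
proof (intro allI impI)
  fix \<epsilon> :: real assume eps: "\<epsilon> > 0"
  define near where "near b s \<longleftrightarrow> 0 \<le> s \<and> s \<le> pi / 2 \<and> zz b s \<le> 3 / 5" for b s
  define good where "good b \<longleftrightarrow> (b > 0 \<and> b < 1 / 2) \<and>
      (\<forall>s. near b s \<longrightarrow> cusp_fun_slope (zz b (2 * pi - s)) (zd b (2 * pi - s)) (Gm b (2 * pi - s)) (4 * b\<^sup>2 * Tm b (2 * pi - s)) (4 * b\<^sup>2) > 0) \<and>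
      (\<forall>s. near b s \<longrightarrow> Gm b (2 * pi - s) + zz b (2 * pi - s) < 2 * (2 + \<epsilon>) * xx b (2 * pi - s)) \<and>
      (\<forall>s. near b s \<longrightarrow> Gm b (2 * pi - s) - zz b (2 * pi - s) < exp 2 * exp (Tm b (2 * pi - s) / 2) * yy b (2 * pi - s)) \<and>
      (\<forall>p. 0 < p \<and> p \<le> 2 * pi \<and> cusp_fun b p \<le> 0 \<longrightarrow> (\<exists>s. p = 2 * pi - s \<and> near b s))" for b
  have "\<forall>\<^sub>F b in at_right 0. good b"
    unfolding near_def good_def
    by (intro eventually_conj eventually_b eventually_cusp_fun_decreasing eventually_a_bound[OF eps]
        eventually_b_bound eventually_cusp_fun_nonpos)
  then obtain B0 where B0: "B0 > 0" and g: "\<And>b. 0 < b \<Longrightarrow> b < B0 \<Longrightarrow> good b"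
    unfolding eventually_at_right_field by auto
  have small:
    "\<And>b. 0 < b \<Longrightarrow> b < B0 \<Longrightarrow> b < 1 / 2"
    "\<And>b s. 0 < b \<Longrightarrow> b < B0 \<Longrightarrow> near b s \<Longrightarrow>
       cusp_fun_slope (zz b (2 * pi - s)) (zd b (2 * pi - s)) (Gm b (2 * pi - s)) (4 * b\<^sup>2 * Tm b (2 * pi - s)) (4 * b\<^sup>2) > 0"
    "\<And>b s. 0 < b \<Longrightarrow> b < B0 \<Longrightarrow> near b s \<Longrightarrow>
       Gm b (2 * pi - s) + zz b (2 * pi - s) < 2 * (2 + \<epsilon>) * xx b (2 * pi - s)"
    "\<And>b s. 0 < b \<Longrightarrow> b < B0 \<Longrightarrow> near b s \<Longrightarrow>
       Gm b (2 * pi - s) - zz b (2 * pi - s) < exp 2 * exp (Tm b (2 * pi - s) / 2) * yy b (2 * pi - s)"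
    "\<And>b p. 0 < b \<Longrightarrow> b < B0 \<Longrightarrow> 0 < p \<Longrightarrow> p \<le> 2 * pi \<Longrightarrow> cusp_fun b p \<le> 0 \<Longrightarrow> \<exists>s. p = 2 * pi - s \<and> near b s"
    using g unfolding good_def by presburger+
  \<comment> \<open>Strictly below \<open>B0\<close>, so the estimates hold at B itself and for
    every smaller positive parameter; \<open>period B\<close> will be the bound R.\<close>
  define B where "B = B0 / 2"
  have B: "0 < B" "B < B0" "B < 1 / 2" using B0 small(1)[of B] by (auto simp: B_def)
  show "\<exists>R. \<forall>r>R.
     (\<forall>L\<ge>r. Upsilon r differentiable (at L within {r..})) \<and>
     (\<exists>Lr. is_cusp r Lr \<and> (\<forall>L. is_cusp r L \<longrightarrow> L = Lr) \<and>
        (\<forall>L\<ge>r. L \<noteq> Lr \<longrightarrow> snd (velocity r L) / fst (velocity r L) < 0) \<and>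
        fst (Upsilon r Lr) < 2 + \<epsilon> \<and>
        snd (Upsilon r Lr) < (exp 2 / 2 + \<epsilon>) * exp (r / 2))"
  proof (intro exI[of _ "period B"] allI impI)
    fix r assume r: "period B < r"
    have "0 \<le> period B" unfolding period_def by (rule Tm_nonneg) (use B in auto)
    then have r0: "r > 0" "r \<ge> 0" using r by auto
    obtain br where br: "br > 0" "br < B" "period br = r" using period_surj[OF B(1,3) r] .
    have b: "b > 0" "b < 1 / 2" "b < B0" if "0 < b" "b \<le> br" for b
      using that br B by auto
    have ex: "\<exists>b. 0 < b \<and> b \<le> br \<and> period b = L" if "L \<ge> r" for L
    proof -
      have "period B < L" using that r by simp
      from period_surj[OF B(1,3) this] obtain c where c: "c > 0" "c < B" "period c = L" .
      then have "c \<le> br" using that br B period_less_iff(2)[of br c] by simp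
      then show ?thesis using c by auto
    qed
    have period_ge: "period b \<ge> r" if "0 < b" "b \<le> br" for b
      using period_less_iff(2)[of br b] br B that by simp
    have phase_range: "0 < phase b r" "phase b r \<le> 2 * pi" if "0 < b" "b \<le> br" for b
    proof -
      note b = b[OF that]
      have "Tm b 0 < Tm b (phase b r)" "Tm b (phase b r) \<le> Tm b (2 * pi)"
        using period_ge[OF that] r0 b by (simp_all add: period_def)
      then show "0 < phase b r" "phase b r \<le> 2 * pi"
        unfolding Tm_less_iff[OF b(1,2)] by auto
    qed
    define n where "n b = cusp_fun b (phase b r)" for b
    define n' where "n' b = - cusp_fun_slope (zz b (phase b r)) (zd b (phase b r)) (Gm b (phase b r)) (4 * b\<^sup>2 * Tm b (phase b r)) (4 * b\<^sup>2) / (2 * b * (1 - 4 * b\<^sup>2))" for b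
    have dn: "(n has_real_derivative n' b) (at b)" if "0 < b" "b \<le> br" for b
      unfolding n_def[abs_def] n'_def by (rule cusp_fun_deriv_b) (use b[OF that] r0 in auto)
    have neg: "n' b < 0" if h: "0 < b" "b \<le> br" "n b \<le> 0" for b
    proof -
      note b = b[OF h(1,2)]
      obtain s where s: "phase b r = 2 * pi - s" "near b s"
        using small(5)[OF b(1,3) phase_range[OF h(1,2)]] h(3) by (auto simp: n_def)
      have "cusp_fun_slope (zz b (phase b r)) (zd b (phase b r)) (Gm b (phase b r)) (4 * b\<^sup>2 * Tm b (phase b r)) (4 * b\<^sup>2) > 0"
        unfolding s(1) by (rule small(2)[OF b(1,3) s(2)])
      then show ?thesis
        unfolding n'_def using one_minus_4b2_pos[OF b(1,2)] b by (simp add: divide_neg_pos)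
    qed
    have n_prop: "n q < 0" if "0 < p" "p < q" "q \<le> br" "n p \<le> 0" for p q
      by (rule neg_propagates[OF that(2), of n n']) (use that dn neg in auto)
    have "phase br r = 2 * pi"
      using phase_Tm[OF b(1,2), of br "2 * pi"] br by (simp add: period_def)
    then have nbr: "n br < 0" using cusp_fun_2pi_neg[OF b(1,2), of br] br by (simp add: n_def)
    obtain b1 where b1: "0 < b1" "b1 < br" "period b1 = 2 * r"
      using period_surj[of br "2 * r"] br B r0 by auto
    have "Tm b1 (phase b1 r) \<le> Tm b1 pi"
      using b1 b[of b1] Tm_symm(1)[of b1 0] Tm_symm(3)[of b1] by (simp add: period_def)
    then have "phase b1 r \<le> pi"
      unfolding Tm_less_iff(2)[OF b(1,2)[OF b1(1) less_imp_le[OF b1(2)]]] .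
    then have nb1: "n b1 > 0"
      unfolding n_def using b[of b1] b1 phase_range(1)[of b1]
      by (intro cusp_fun_pos_first_half) auto
    have "\<exists>x\<ge>b1. x \<le> br \<and> n x = 0"
    proof (intro IVT2 allI impI)
      fix x assume "b1 \<le> x \<and> x \<le> br"
      then show "isCont n x" using DERIV_isCont[OF dn[of x]] b1 by simp
    qed (use nb1 nbr b1 in auto)
    then obtain c where c: "b1 \<le> c" "c \<le> br" "n c = 0" by blast
    have c0: "0 < c" using c b1 by simp
    have uniq: "b = c" if "0 < b" "b \<le> br" "n b = 0" for b
      using n_prop[of b c] n_prop[of c b] that c c0 by (cases b c rule: linorder_cases) auto
    define j where "j b = - n b / (4 * b * (1 - 4 * b\<^sup>2) * Tb b (2 * pi))" for b
    have j0: "j b = 0 \<longleftrightarrow> n b = 0" if "0 < b" "b \<le> br" for b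
      using b[OF that] one_minus_4b2_pos[of b] period_deriv(2)[of b] by (auto simp: j_def)
    have vd: "(Upsilon r has_vector_derivative (j b / xx b (phase b r), - j b / yy b (phase b r))) (at (period b) within {r..})"
      if "0 < b" "b \<le> br" for b
      unfolding j_def n_def
      by (rule has_vector_derivative_at_within, rule Upsilon_deriv) (use b[OF that] r0 in auto)
    have vel: "velocity r (period b) = (j b / xx b (phase b r), - j b / yy b (phase b r))" if "0 < b" "b \<le> br" for b
      unfolding velocity_def
      by (rule vector_derivative_within[OF at_within_atLeast_neq_bot[OF period_ge[OF that]] vd[OF that]])
    have pos: "xx b (phase b r) > 0" "yy b (phase b r) > 0" if "0 < b" "b \<le> br" for b
      using xx_yy_pos[OF b(1,2)[OF that]] by auto
    have cusp: "is_cusp r (period b) \<longleftrightarrow> b = c" if "0 < b" "b \<le> br" for b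
    proof -
      have "velocity r (period b) = 0 \<longleftrightarrow> j b = 0"
        unfolding vel[OF that] using pos[OF that] by (auto simp: zero_prod_def)
      then show ?thesis
        unfolding is_cusp_def j0[OF that] using period_ge[OF that] uniq[OF that] c by auto
    qed
    obtain s where s: "phase c r = 2 * pi - s" "near c s"
      using small(5)[OF b(1,3)[OF c0 c(2)] phase_range[OF c0 c(2)]] c(3) by (auto simp: n_def)
    have Uc: "Upsilon r (period c) = (AA r c, BB r c)"
      by (rule Upsilon_period) (use b[OF c0 c(2)] in auto)
    have "Gm c (phase c r) + zz c (phase c r) < 2 * (2 + \<epsilon>) * xx c (phase c r)"
      unfolding s(1) by (rule small(3)[OF b(1,3)[OF c0 c(2)] s(2)])
    then have A: "AA r c < 2 + \<epsilon>"
      unfolding AA_def using pos[OF c0 c(2)] by (simp add: field_simps)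
    have "Gm c (phase c r) - zz c (phase c r) < exp 2 * exp (Tm c (phase c r) / 2) * yy c (phase c r)"
      unfolding s(1) by (rule small(4)[OF b(1,3)[OF c0 c(2)] s(2)])
    then have "BB r c < exp 2 / 2 * exp (r / 2)"
      unfolding BB_def using pos[OF c0 c(2)] b[OF c0 c(2)] by (simp add: field_simps)
    also have "\<dots> \<le> (exp 2 / 2 + \<epsilon>) * exp (r / 2)"
      using eps by (intro mult_right_mono) auto
    finally have BBc: "BB r c < (exp 2 / 2 + \<epsilon>) * exp (r / 2)" .
    show "(\<forall>L\<ge>r. Upsilon r differentiable (at L within {r..})) \<and>
     (\<exists>Lr. is_cusp r Lr \<and> (\<forall>L. is_cusp r L \<longrightarrow> L = Lr) \<and>
        (\<forall>L\<ge>r. L \<noteq> Lr \<longrightarrow> snd (velocity r L) / fst (velocity r L) < 0) \<and>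
        fst (Upsilon r Lr) < 2 + \<epsilon> \<and>
        snd (Upsilon r Lr) < (exp 2 / 2 + \<epsilon>) * exp (r / 2))"
    proof (intro conjI exI[of _ "period c"] allI impI)
      fix L assume "r \<le> L"
      then obtain b where "0 < b" "b \<le> br" "period b = L" using ex by blast
      then show "Upsilon r differentiable (at L within {r..})"
        using vd[of b] differentiableI_vector by blast
    next
      show "is_cusp r (period c)" using cusp[OF c0 c(2)] by simp
    next
      fix L assume L: "is_cusp r L"
      then obtain b where "0 < b" "b \<le> br" "period b = L" using ex[of L] by (auto simp: is_cusp_def)
      then show "L = period c" using cusp[of b] L by auto
    next
      fix L assume "r \<le> L" and ne: "L \<noteq> period c"
      then obtain b where b: "0 < b" "b \<le> br" "period b = L" using ex by blast
      have "j b \<noteq> 0" using j0[OF b(1,2)] uniq[OF b(1,2)] b(3) ne by auto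
      then have "snd (velocity r L) / fst (velocity r L) = - (xx b (phase b r) / yy b (phase b r))"
        using vel[OF b(1,2)] pos[OF b(1,2)] unfolding b(3) by simp
      then show "snd (velocity r L) / fst (velocity r L) < 0"
        using pos[OF b(1,2)] by simp
    qed (use A BBc in \<open>simp_all add: Uc\<close>)
  qed
qed

end
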